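(* Let $X$ be an $n\times n$ generalized Jacobi–Trudi matrix and let $I,J,I',J'$ be $k$-element subsets of $[n]=\{1,\dots,n\}$. Then $$\Delta_{I\vee I',\,J\vee J'}(X)\cdot\Delta_{I\wedge I',\,J\wedge J'}(X) - \Delta_{I,J}(X)\cdot\Delta_{I',J'}(X)$$ is Schur nonnegative.
   Context: $h_k$ denotes the $k$-th complete homogeneous symmetric function, with $h_0=1$ and $h_k=0$ for $k<0$. A generalized Jacobi–Trudi matrix is an $n\times n$ matrix of the form $(h_{\mu_i-\nu_j})_{i,j=1}^n$ for partitions $\mu=(\mu_1\ge\cdots\ge\mu_n\ge0)$ and $\nu=(\nu_1\ge\cdots\ge\nu_n\ge 0)$. For subsets $I,J\subseteq[n]$ of equal size, $\Delta_{I,J}(X)$ is the minor of $X$ with row set $I$ and column set $J$. For $I=\{i_1<\cdots<i_k\}$ and $J=\{j_1<\cdots<j_k\}$, $I\vee J:=\{\max(i_1,j_1)<\cdots<\max(i_k,j_k)\}$ and $I\wedge J:=\{\min(i_1,j_1)<\cdots<\min(i_k,j_k)\}$. A symmetric function is Schur nonnegative if it is a nonnegative linear combination of Schur functions. *)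

theory Defs
  imports
    "HOL-Library.Multiset"
    "HOL-Library.FuncSet"
    "Jordan_Normal_Form.Determinant"
    "Jordan_Normal_Form.DL_Submatrix"
begin

text \<open>
  Symmetric functions are formal power series in variables \<open>x\<^sub>0, x\<^sub>1, x\<^sub>2, \<dots>\<close>.
  The monomial \<open>x\<^sub>a x\<^sub>b x\<^sub>c \<cdots>\<close> is encoded by the finite multiset \<open>{#a, b, c, \<dots>#}\<close> of its
  variable indices: multiplication of monomials is multiset union, and the total degree is the
  size of the multiset.
\<close>

typedef 'a mseries = "UNIV :: (nat multiset \<Rightarrow> 'a) set"
  morphisms coeff_ms Abs_ms ..

setup_lifting type_definition_mseries

lemma mseries_eqI: "(\<And>M. coeff_ms f M = coeff_ms g M) \<Longrightarrow> f = g"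
  by transfer auto

lemma finite_submsets: "finite {N. N \<subseteq># (M :: 'a multiset)}"
proof (induction M)
  case empty
  show ?case by simp
next
  case (add x M)
  have "{N. N \<subseteq># add_mset x M} \<subseteq> {N. N \<subseteq># M} \<union> add_mset x ` {N. N \<subseteq># M}"
  proof
    fix N assume N: "N \<in> {N. N \<subseteq># add_mset x M}"
    show "N \<in> {N. N \<subseteq># M} \<union> add_mset x ` {N. N \<subseteq># M}"
    proof (cases "x \<in># N")
      case True
      then obtain N' where "N = add_mset x N'"
        by (meson mset_add)
      with N show ?thesis by auto
    next
      case False
      with N have "N \<subseteq># M"
        by (metis diff_single_trivial mem_Collect_eq subset_eq_diff_conv add_mset_add_single)
      then show ?thesis by simp
    qed
  qed
  with add.IH show ?case
    by (meson finite_UnI finite_imageI finite_subset)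
qed

instantiation mseries :: (comm_ring_1) comm_ring_1
begin

lift_definition zero_mseries :: "'a mseries" is "\<lambda>_. 0" .
lift_definition one_mseries :: "'a mseries" is "\<lambda>M. if M = {#} then 1 else 0" .
lift_definition plus_mseries :: "'a mseries \<Rightarrow> 'a mseries \<Rightarrow> 'a mseries"
  is "\<lambda>f g M. f M + g M" .
lift_definition minus_mseries :: "'a mseries \<Rightarrow> 'a mseries \<Rightarrow> 'a mseries"
  is "\<lambda>f g M. f M - g M" .
lift_definition uminus_mseries :: "'a mseries \<Rightarrow> 'a mseries"
  is "\<lambda>f M. - f M" .
lift_definition times_mseries :: "'a mseries \<Rightarrow> 'a mseries \<Rightarrow> 'a mseries"
  is "\<lambda>f g M. \<Sum>N | N \<subseteq># M. f N * g (M - N)" .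

instance
proof
  fix f g h :: "'a mseries"
  show "f * g * h = f * (g * h)"
  proof (rule mseries_eqI, transfer)
    fix f g h :: "nat multiset \<Rightarrow> 'a" and M
    have "(\<Sum>N | N \<subseteq># M. (\<Sum>P | P \<subseteq># N. f P * g (N - P)) * h (M - N))
        = (\<Sum>(N, P)\<in>(SIGMA N:{N. N \<subseteq># M}. {P. P \<subseteq># N}). f P * g (N - P) * h (M - N))"
      by (subst sum.Sigma [symmetric]) (auto simp: finite_submsets sum_distrib_right)
    also have "\<dots> = (\<Sum>(P, Q)\<in>(SIGMA P:{P. P \<subseteq># M}. {Q. Q \<subseteq># M - P}).
        f P * (g Q * h (M - P - Q)))"
    proof (rule sum.reindex_bij_witness
        [where i = "\<lambda>(P, Q). (P + Q, P)" and j = "\<lambda>(N, P). (P, N - P)"], goal_cases)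
      case (1 a)
      then show ?case by auto
    next
      case (2 a)
      then obtain N P where a: "a = (N, P)" "N \<subseteq># M" "P \<subseteq># N" by auto
      then have "P \<subseteq># M" by (meson subset_mset.order_trans)
      moreover have "N - P \<subseteq># M - P"
        using a by (simp add: subseteq_mset_def diff_le_mono)
      ultimately show ?case by (simp add: a)
    next
      case (3 b)
      then show ?case by auto
    next
      case (4 b)
      then show ?case
        by (auto simp: subset_mset.le_diff_conv2 add.commute)
    next
      case (5 a)
      then obtain N P where a: "a = (N, P)" "N \<subseteq># M" "P \<subseteq># N" by auto
      then have "M - P - (N - P) = M - N"
        by (metis diff_diff_add_mset subset_mset.add_diff_inverse)
      with a show ?case by (simp add: mult.assoc)
    qed
    also have "\<dots> = (\<Sum>P | P \<subseteq># M. f P * (\<Sum>Q | Q \<subseteq># M - P. g Q * h (M - P - Q)))"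
      by (subst sum.Sigma [symmetric]) (auto simp: finite_submsets sum_distrib_left)
    finally show "(\<Sum>N | N \<subseteq># M. (\<Sum>P | P \<subseteq># N. f P * g (N - P)) * h (M - N))
        = (\<Sum>P | P \<subseteq># M. f P * (\<Sum>Q | Q \<subseteq># M - P. g Q * h (M - P - Q)))" .
  qed
  show "f * g = g * f"
  proof (rule mseries_eqI, transfer)
    fix f g :: "nat multiset \<Rightarrow> 'a" and M
    show "(\<Sum>N | N \<subseteq># M. f N * g (M - N)) = (\<Sum>N | N \<subseteq># M. g N * f (M - N))"
      by (rule sum.reindex_bij_witness [where i = "\<lambda>N. M - N" and j = "\<lambda>N. M - N"])
         (auto simp: subset_mset.diff_diff_right mult.commute)
  qed
  show "1 * f = f"
  proof (rule mseries_eqI, transfer)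
    fix f :: "nat multiset \<Rightarrow> 'a" and M
    have "(\<Sum>N | N \<subseteq># M. (if N = {#} then 1 else 0) * f (M - N))
        = (\<Sum>N\<in>{{#}}. (if N = {#} then 1 else 0) * f (M - N))"
      by (rule sum.mono_neutral_right) (auto simp: finite_submsets)
    then show "(\<Sum>N | N \<subseteq># M. (if N = {#} then 1 else 0) * f (M - N)) = f M" by simp
  qed
  show "(f + g) * h = f * h + g * h"
    by (rule mseries_eqI, transfer) (simp add: distrib_right sum.distrib)
  show "(0 :: 'a mseries) \<noteq> 1"
    by transfer (metis zero_neq_one)
qed (transfer; simp add: algebra_simps fun_eq_iff)+

end

lift_definition complete_h :: "int \<Rightarrow> 'a::comm_ring_1 mseries"
  is "\<lambda>k M. if int (size M) = k then 1 else 0" .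

definition is_partition :: "nat list \<Rightarrow> bool" where
  "is_partition la \<longleftrightarrow> sorted_wrt (\<ge>) la \<and> 0 \<notin> set la"

definition cells :: "nat list \<Rightarrow> (nat \<times> nat) set" where
  "cells la = {(i, j). i < length la \<and> j < la ! i}"

text \<open>Fillings are \<open>undefined\<close> outside the diagram, so that distinct elements of
  \<open>ssyt la\<close> are distinct tableaux; in particular only finitely many have a given monomial.\<close>

definition ssyt :: "nat list \<Rightarrow> (nat \<times> nat \<Rightarrow> nat) set" where
  "ssyt la = {T \<in> extensional (cells la).
     (\<forall>i j j'. j < j' \<and> (i, j') \<in> cells la \<longrightarrow> T (i, j) \<le> T (i, j')) \<and>
     (\<forall>i i' j. i < i' \<and> (i', j) \<in> cells la \<longrightarrow> T (i, j) < T (i', j))}"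

definition tableau_monomial :: "nat list \<Rightarrow> (nat \<times> nat \<Rightarrow> nat) \<Rightarrow> nat multiset" where
  "tableau_monomial la T = image_mset T (mset_set (cells la))"

lift_definition schur :: "nat list \<Rightarrow> 'a::comm_ring_1 mseries"
  is "\<lambda>la M. of_nat (card {T \<in> ssyt la. tableau_monomial la T = M})" .

text \<open>Symmetric functions are taken over the integers. As the Schur functions form an integral basis,
  rational or real coefficients would give the same notion for integral symmetric functions.\<close>

definition schur_nonneg :: "int mseries \<Rightarrow> bool" where
  "schur_nonneg f \<longleftrightarrow> (\<exists>S c. finite S \<and> (\<forall>la\<in>S. is_partition la \<and> 0 \<le> c la) \<and>
     f = (\<Sum>la\<in>S. of_int (c la) * schur la))"

text \<open>
  Rows and columns are indexed from 0, so the index set is \<open>{0..<n}\<close>, and \<open>mu ! i\<close> is the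
  part usually written \<open>\<mu>\<^sub>i\<^sub>+\<^sub>1\<close>. The lists \<open>mu\<close>, \<open>nu\<close> may have trailing zeros.
\<close>

definition gen_jacobi_trudi :: "nat \<Rightarrow> 'a::comm_ring_1 mseries mat \<Rightarrow> bool" where
  "gen_jacobi_trudi n X \<longleftrightarrow> (\<exists>mu nu :: nat list.
     length mu = n \<and> sorted_wrt (\<ge>) mu \<and> length nu = n \<and> sorted_wrt (\<ge>) nu \<and>
     X = mat n n (\<lambda>(i, j). complete_h (int (mu ! i) - int (nu ! j))))"

definition minor :: "nat set \<Rightarrow> nat set \<Rightarrow> 'a::comm_ring_1 mat \<Rightarrow> 'a" where
  "minor I J X = det (submatrix X I J)"

text \<open>Element-wise maximum and minimum of the increasing enumerations; intended for finite sets of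
  equal cardinality.\<close>

definition set_join :: "nat set \<Rightarrow> nat set \<Rightarrow> nat set" where
  "set_join I J = set (map2 max (sorted_list_of_set I) (sorted_list_of_set J))"

definition set_meet :: "nat set \<Rightarrow> nat set \<Rightarrow> nat set" where
  "set_meet I J = set (map2 min (sorted_list_of_set I) (sorted_list_of_set J))"

end

theory Submission
  imports Defs
begin

text \<open>
  Each minor is a skew Schur function (or zero), so a product of two minors is the generating
  function of pairs of skew tableaux, one for each minor. Such a pair is read column by column from
  right to left, inside a column from top to bottom, and the cells of the two tableaux in the same
  position one directly after the other. For this interleaved reading order Stembridge's
  sign-reversing involution still works, so the coefficient of a Schur function in the product is
  the number of pairs whose word is a lattice word.

  In a pair of tableaux one can exchange parts of corresponding rows. The parts that have to be
  exchanged together are the components of a graph, and exchanging exactly those components that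
  reach the boundary with the wrong orientation maps the pairs for
  \<open>\<Delta>\<^bsub>I,J\<^esub> \<Delta>\<^bsub>I',J'\<^esub>\<close> injectively to pairs for the join and the meet. The word changes only where
  two cells in the same position hold \<open>r\<close> and \<open>r + 1\<close>; if the order of these two matters for the
  lattice condition, they form a component of their own away from the boundary and are not
  exchanged. Hence lattice words go to lattice words.
\<close>

section \<open>Pairs of tableaux as shuffles\<close>

text \<open>Fillings are replaced by the boundaries \<open>L t b\<close> because both operations
  then become local: a toggle reflects entries of one layer \<open>L (Suc r)\<close>, and an
  exchange swaps two numbers. The obstacle is that one reading order has to serve both. In the
  interleaved order a cut between two pairs of rows sees only unordered pairs, so exchanges can do
  harm only at a cut inside a pair. The price is that cells read in succession belong to different
  tableaux; what they say about each other has to be found from the parities of their rows. Schur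
  functions enter as pairs with an empty second tableau, so the same cancellation treats both sides
  of the expansion: tested against antisymmetric functions only lattice words survive, and a
  straight shape has exactly one. Everything is counted in finitely many variables; this suffices
  because a monomial involves finitely many and the multiplicities do not depend on their number
  once it is large enough.\<close>

text \<open>
  In \<open>L\<close> the cell in row \<open>b\<close> and column \<open>c\<close> has entry \<open>t\<close> iff \<open>L t b \<le> c < L (Suc t) b\<close>.
  Rows \<open>2 * a\<close> and \<open>2 * a + 1\<close> are the \<open>a\<close>-th rows of the two tableaux, so that vertically adjacent
  cells of one tableau lie two rows apart. The entries are less than \<open>m\<close>.
\<close>

definition shuffles :: "nat \<Rightarrow> (nat \<Rightarrow> nat) \<Rightarrow> (nat \<Rightarrow> nat) \<Rightarrow> (nat \<Rightarrow> nat \<Rightarrow> nat) set" where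
  "shuffles m mu la = {L. L 0 = mu \<and> (\<forall>t\<ge>m. L t = la) \<and> (\<forall>t b. L t b \<le> L (Suc t) b) \<and>
     (\<forall>t b. L (Suc t) (Suc (Suc b)) \<le> L t b)}"

definition weight :: "nat \<Rightarrow> (nat \<Rightarrow> nat \<Rightarrow> nat) \<Rightarrow> nat \<Rightarrow> nat" where
  "weight n L t = (\<Sum>b<n. L (Suc t) b - L t b)"

text \<open>
  The cells read up to a certain point are those in row \<open>b\<close> and column \<open>\<ge> \<kappa> b\<close> for all \<open>b\<close>. In
  \<^term>\<open>reading_cut c j\<close> these are the columns to the right of \<open>c\<close> and the first \<open>j\<close> rows of column \<open>c\<close>.
  The excess is the number of entries \<open>Suc r\<close> minus the number of entries \<open>r\<close> among them.
\<close>

definition reading_cut :: "nat \<Rightarrow> nat \<Rightarrow> nat \<Rightarrow> nat" where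
  "reading_cut c j = (\<lambda>b. if b < j then c else Suc c)"

definition excess :: "nat \<Rightarrow> (nat \<Rightarrow> nat \<Rightarrow> nat) \<Rightarrow> nat \<Rightarrow> (nat \<Rightarrow> nat) \<Rightarrow> int" where
  "excess n L r \<kappa> = (\<Sum>b<n. int (max (L (Suc (Suc r)) b) (\<kappa> b))
     - 2 * int (max (L (Suc r) b) (\<kappa> b)) + int (max (L r b) (\<kappa> b)))"

definition lattice :: "nat \<Rightarrow> (nat \<Rightarrow> nat \<Rightarrow> nat) \<Rightarrow> bool" where
  "lattice n L \<longleftrightarrow> (\<forall>r c j. j \<le> n \<longrightarrow> excess n L r (reading_cut c j) \<le> 0)"

definition cell_sign :: "(nat \<Rightarrow> nat \<Rightarrow> nat) \<Rightarrow> nat \<Rightarrow> nat \<Rightarrow> nat \<Rightarrow> int" where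
  "cell_sign L r b c = of_bool (L (Suc r) b \<le> c \<and> c < L (Suc (Suc r)) b)
     - of_bool (L r b \<le> c \<and> c < L (Suc r) b)"

lemma shufflesD:
  assumes "L \<in> shuffles m mu la"
  shows "L 0 = mu" "m \<le> t \<Longrightarrow> L t = la" "L t b \<le> L (Suc t) b"
    "L (Suc t) (Suc (Suc b)) \<le> L t b"
  using assms by (auto simp: shuffles_def)

lemma shuffles_mono:
  assumes "L \<in> shuffles m mu la" "s \<le> t"
  shows "L s b \<le> L t b"
  using lift_Suc_mono_le[of "\<lambda>t. L t b"] shufflesD(3)[OF assms(1)] assms(2) by blast

lemma shuffles_le_final:
  assumes "L \<in> shuffles m mu la"
  shows "L t b \<le> la b"
  using shuffles_mono[OF assms, of t "max t m" b] shufflesD(2)[OF assms, of "max t m"] by simp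

lemma excess_step:
  assumes "L \<in> shuffles m mu la" "b < n"
  shows "excess n L r (reading_cut c (Suc b)) = excess n L r (reading_cut c b) + cell_sign L r b c"
proof -
  let ?f = "\<lambda>j b. int (max (L (Suc (Suc r)) b) (reading_cut c j b))
     - 2 * int (max (L (Suc r) b) (reading_cut c j b)) + int (max (L r b) (reading_cut c j b))"
  have "?f (Suc b) b = ?f b b + cell_sign L r b c"
    using shufflesD(3)[OF assms(1), of r b] shufflesD(3)[OF assms(1), of "Suc r" b]
    by (auto simp: reading_cut_def cell_sign_def max_def)
  moreover have "(\<Sum>i\<in>{..<n} - {b}. ?f (Suc b) i) = (\<Sum>i\<in>{..<n} - {b}. ?f b i)"
    by (rule sum.cong) (auto simp: reading_cut_def)
  ultimately show ?thesis
    unfolding excess_def using assms(2)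
    by (simp add: sum.remove[of "{..<n}" b])
qed

lemma excess_wrap: "excess n L r (reading_cut (Suc c) n) = excess n L r (reading_cut c 0)"
  unfolding excess_def by (rule sum.cong) (auto simp: reading_cut_def)

lemma int_weight:
  assumes "L \<in> shuffles m mu la"
  shows "int (weight n L t) = (\<Sum>b<n. int (L (Suc t) b)) - (\<Sum>b<n. int (L t b))"
  using shufflesD(3)[OF assms]
  by (simp add: weight_def of_nat_diff sum_subtractf)

section \<open>Bender--Knuth toggles and the lattice condition\<close>

text \<open>
  The entries \<open>r\<close> and \<open>Suc r\<close> of row \<open>b\<close> that are not vertically adjacent to each other occupy the
  columns between \<^term>\<open>toggle_low L r b\<close> and \<^term>\<open>toggle_high L r b\<close>. A toggle is the Bender--Knuth
  involution on the cells to the left of \<open>\<kappa>\<close>. Admissibility says that the cells to the right do not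
  interfere.
\<close>

definition toggle_low :: "(nat \<Rightarrow> nat \<Rightarrow> nat) \<Rightarrow> nat \<Rightarrow> nat \<Rightarrow> nat" where
  "toggle_low L r b = max (L r b) (L (Suc (Suc r)) (Suc (Suc b)))"

definition toggle_high :: "(nat \<Rightarrow> nat \<Rightarrow> nat) \<Rightarrow> nat \<Rightarrow> nat \<Rightarrow> nat" where
  "toggle_high L r b =
     (if b < 2 then L (Suc (Suc r)) b else min (L (Suc (Suc r)) b) (L r (b - 2)))"

definition toggle :: "(nat \<Rightarrow> nat) \<Rightarrow> nat \<Rightarrow> (nat \<Rightarrow> nat \<Rightarrow> nat) \<Rightarrow> nat \<Rightarrow> nat \<Rightarrow> nat" where
  "toggle \<kappa> r L = L(Suc r := \<lambda>b. if toggle_low L r b < \<kappa> b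
     then toggle_low L r b + min (toggle_high L r b) (\<kappa> b) - L (Suc r) b else L (Suc r) b)"

text \<open>By the first clause no free \<open>r\<close> has been read in a row whose free interval
  begins to the left of the cut, so the reflection stays among unread cells. The second clause
  concerns rows between which the cut jumps: in column \<open>\<kappa> b\<close> it must not divide
  a vertical pair of \<open>r\<close> above \<open>Suc r\<close>.\<close>

definition admissible :: "(nat \<Rightarrow> nat) \<Rightarrow> nat \<Rightarrow> (nat \<Rightarrow> nat \<Rightarrow> nat) \<Rightarrow> bool" where
  "admissible \<kappa> r L \<longleftrightarrow> (\<forall>b. toggle_low L r b < \<kappa> b \<longrightarrow> L (Suc r) b \<le> \<kappa> b) \<and>
     (\<forall>b. \<kappa> (Suc (Suc b)) = \<kappa> b \<or> \<kappa> (Suc (Suc b)) = Suc (\<kappa> b) \<and>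
        (\<kappa> b < L r b \<or> L (Suc (Suc r)) (Suc (Suc b)) \<le> \<kappa> b))"

lemma toggle_bounds:
  assumes "L \<in> shuffles m mu la"
  shows "toggle_low L r b \<le> L (Suc r) b" "L (Suc r) b \<le> toggle_high L r b"
proof -
  show "toggle_low L r b \<le> L (Suc r) b"
    using shufflesD(3,4)[OF assms] by (simp add: toggle_low_def)
  have "L (Suc r) b \<le> L r (b - 2)" if "\<not> b < 2"
    using shufflesD(4)[OF assms, of r "b - 2"] that by (simp add: numeral_2_eq_2 Suc_diff_Suc)
  then show "L (Suc r) b \<le> toggle_high L r b"
    using shufflesD(3)[OF assms, of "Suc r"] by (auto simp: toggle_high_def)
qed

lemma toggle_layer_bounds:
  assumes "L \<in> shuffles m mu la" "admissible \<kappa> r L"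
  shows "toggle_low L r b \<le> toggle \<kappa> r L (Suc r) b"
    "toggle \<kappa> r L (Suc r) b \<le> toggle_high L r b"
  using toggle_bounds[OF assms(1), of r b] assms(2)
  by (auto simp: toggle_def admissible_def min_def split: if_splits)

lemma toggle_other: "t \<noteq> Suc r \<Longrightarrow> toggle \<kappa> r L t = L t"
  by (simp add: toggle_def)

lemma toggle_low_high_toggle [simp]:
  "toggle_low (toggle \<kappa> r L) r = toggle_low L r" "toggle_high (toggle \<kappa> r L) r = toggle_high L r"
  by (auto simp: toggle_low_def toggle_high_def toggle_other)

lemma toggle_in_shuffles:
  assumes L: "L \<in> shuffles m mu la" and "admissible \<kappa> r L" "Suc r < m"
  shows "toggle \<kappa> r L \<in> shuffles m mu la"
proof -
  let ?L = "toggle \<kappa> r L"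
  note b = toggle_layer_bounds[OF assms(1,2)]
  have lo: "L r b \<le> ?L (Suc r) b" "L (Suc (Suc r)) (Suc (Suc b)) \<le> ?L (Suc r) b" for b
    using b(1)[of b] by (auto simp: toggle_low_def)
  have hi: "?L (Suc r) b \<le> L (Suc (Suc r)) b" "?L (Suc r) (Suc (Suc b)) \<le> L r b" for b
    using b(2)[of b] b(2)[of "Suc (Suc b)"] by (auto simp: toggle_high_def split: if_splits)
  have "?L t b \<le> ?L (Suc t) b" for t b
    using lo(1)[of b] hi(1)[of b] shufflesD(3)[OF L, of t b]
    by (cases "t = r"; cases "t = Suc r") (auto simp: toggle_other)
  moreover have "?L (Suc t) (Suc (Suc b)) \<le> ?L t b" for t b
    using lo(2)[of b] hi(2)[of b] shufflesD(4)[OF L, of t b]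
    by (cases "t = r"; cases "t = Suc r") (auto simp: toggle_other)
  moreover have "?L 0 = mu" "\<forall>t\<ge>m. ?L t = la"
    using shufflesD(1,2)[OF L] assms(3) by (auto simp: toggle_other)
  ultimately show ?thesis by (simp add: shuffles_def)
qed

lemma admissible_toggle:
  assumes "L \<in> shuffles m mu la" "admissible \<kappa> r L"
  shows "admissible \<kappa> r (toggle \<kappa> r L)"
proof -
  have "toggle \<kappa> r L (Suc r) b \<le> \<kappa> b" if "toggle_low L r b < \<kappa> b" for b
    using that assms(2) toggle_bounds[OF assms(1), of r b]
    by (auto simp: toggle_def admissible_def min_def split: if_splits)
  then show ?thesis
    using assms(2) by (auto simp: admissible_def toggle_other)
qed

lemma toggle_toggle:
  assumes "L \<in> shuffles m mu la" "admissible \<kappa> r L"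
  shows "toggle \<kappa> r (toggle \<kappa> r L) = L"
proof (rule ext)
  fix t
  have "toggle \<kappa> r (toggle \<kappa> r L) (Suc r) b = L (Suc r) b" for b
    using toggle_bounds[OF assms(1), of r b] assms(2)
    by (auto simp: toggle_def[of \<kappa> r "toggle \<kappa> r L"] admissible_def min_def)
       (auto simp: toggle_def min_def split: if_splits)
  then show "toggle \<kappa> r (toggle \<kappa> r L) t = L t"
    by (cases "t = Suc r") (auto simp: toggle_other)
qed

lemma max_toggle:
  assumes L: "L \<in> shuffles m mu la" and "admissible \<kappa> r L" "\<kappa> b \<le> x"
  shows "max (toggle \<kappa> r L t b) x = max (L t b) x"
proof (cases "t = Suc r \<and> toggle_low L r b < \<kappa> b")
  case True
  then have "L (Suc r) b \<le> \<kappa> b" "toggle \<kappa> r L (Suc r) b \<le> \<kappa> b"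
    using assms(2) admissible_toggle[OF assms(1,2)] by (auto simp: admissible_def)
  then show ?thesis using True assms(3) by simp
next
  case False
  then show ?thesis by (auto simp: toggle_def)
qed

lemma excess_toggle:
  assumes "L \<in> shuffles m mu la" "admissible \<kappa> r L" "\<And>b. \<kappa> b \<le> \<kappa>' b"
  shows "excess n (toggle \<kappa> r L) r' \<kappa>' = excess n L r' \<kappa>'"
  unfolding excess_def using max_toggle[OF assms(1,2)] assms(3) by simp

text \<open>Vertical pairs of \<open>r\<close> above \<open>Suc r\<close> push
  \<open>toggle_low\<close> of the upper row up by as much as they push \<open>toggle_high\<close>
  of the lower row down, and the cut divides no such pair. Hence row \<open>b\<close> is balanced
  against row \<open>b + 2\<close>, and rows 0 and 1 have nothing above them.\<close>

lemma sum_low_high: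
  assumes L: "L \<in> shuffles m mu la" and adm: "admissible \<kappa> r L" and z: "\<forall>b\<ge>n. la b = 0"
  shows "(\<Sum>b<n. int (min (toggle_low L r b) (\<kappa> b)) + int (min (toggle_high L r b) (\<kappa> b)))
    = (\<Sum>b<n. int (min (L r b) (\<kappa> b)) + int (min (L (Suc (Suc r)) b) (\<kappa> b)))"
proof -
  let ?hi = "\<lambda>b. int (min (toggle_high L r b) (\<kappa> b))"
  let ?R = "\<lambda>b. int (min (L (Suc (Suc r)) b) (\<kappa> b))"
  have zero: "L t b = 0" if "n \<le> b" for t b
    using shuffles_le_final[OF L, of t b] z that by simp
  have shift: "(\<Sum>b<n. f b) = f 0 + f 1 + (\<Sum>b<n. f (Suc (Suc b)))"
    if "f n = 0" "f (Suc n) = 0" for f :: "nat \<Rightarrow> int"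
  proof -
    have "(\<Sum>b<n. f b) = (\<Sum>b<Suc (Suc n). f b)" using that by simp
    also have "\<dots> = f 0 + f 1 + (\<Sum>b<n. f (Suc (Suc b)))"
      by (subst sum.lessThan_Suc_shift)+ simp
    finally show ?thesis .
  qed
  have "toggle_high L r n = 0" "toggle_high L r (Suc n) = 0"
    using zero by (auto simp: toggle_high_def)
  then have hi: "(\<Sum>b<n. ?hi b) = ?hi 0 + ?hi 1 + (\<Sum>b<n. ?hi (Suc (Suc b)))"
    by (intro shift) auto
  have R: "(\<Sum>b<n. ?R b) = ?R 0 + ?R 1 + (\<Sum>b<n. ?R (Suc (Suc b)))"
    using zero by (intro shift) auto
  have "int (min (toggle_low L r b) (\<kappa> b)) + ?hi (Suc (Suc b))
      = int (min (L r b) (\<kappa> b)) + ?R (Suc (Suc b))" for b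
    using adm[unfolded admissible_def, THEN conjunct2, rule_format, of b]
    by (auto simp: toggle_low_def toggle_high_def min_def max_def)
  then have "(\<Sum>b<n. int (min (toggle_low L r b) (\<kappa> b)) + ?hi (Suc (Suc b)))
      = (\<Sum>b<n. int (min (L r b) (\<kappa> b)) + ?R (Suc (Suc b)))"
    by (intro sum.cong) auto
  moreover have "?hi 0 = ?R 0" "?hi 1 = ?R 1" by (auto simp: toggle_high_def)
  ultimately show ?thesis
    unfolding sum.distrib hi R by linarith
qed

text \<open>A reflection makes the old and the new boundary add up to the two ends of the interval.
  What the truncation at the cut changes in this sum is the excess of the cells already
  read.\<close>

lemma sum_toggle_layer:
  assumes L: "L \<in> shuffles m mu la" and adm: "admissible \<kappa> r L" and z: "\<forall>b\<ge>n. la b = 0"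
  shows "(\<Sum>b<n. int (toggle \<kappa> r L (Suc r) b)) + (\<Sum>b<n. int (L (Suc r) b))
    = (\<Sum>b<n. int (L r b)) + (\<Sum>b<n. int (L (Suc (Suc r)) b)) - excess n L r \<kappa>"
proof -
  have row: "int (toggle \<kappa> r L (Suc r) b) + int (L (Suc r) b) = 2 * int (max (L (Suc r) b) (\<kappa> b))
      + (int (min (toggle_low L r b) (\<kappa> b)) + int (min (toggle_high L r b) (\<kappa> b))) - 2 * int (\<kappa> b)" for b
    using toggle_bounds[OF L, of r b] adm[unfolded admissible_def, THEN conjunct1, rule_format, of b]
    by (auto simp: toggle_def min_def max_def)
  have mm: "int (max x k) = int x + int k - int (min x k)" for x k :: nat
    by (auto simp: max_def min_def)
  have "(\<Sum>b<n. int (toggle \<kappa> r L (Suc r) b) + int (L (Suc r) b))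
    = (\<Sum>b<n. 2 * int (max (L (Suc r) b) (\<kappa> b))) + (\<Sum>b<n. int (min (L r b) (\<kappa> b))
      + int (min (L (Suc (Suc r)) b) (\<kappa> b))) - (\<Sum>b<n. 2 * int (\<kappa> b))"
    unfolding row sum_subtractf sum.distrib[of _ "\<lambda>b. _ b + _ b"]
    by (simp only: sum_low_high[OF L adm z])
  then show ?thesis
    unfolding excess_def mm[of "L r _"] mm[of "L (Suc (Suc r)) _"]
    by (simp add: sum.distrib sum_subtractf)
qed

text \<open>Unread cells exchange their numbers of \<open>r\<close> and \<open>Suc r\<close> while
  read cells keep theirs, so the exchange of the total weights is off by the excess.\<close>

lemma weight_toggle:
  assumes L: "L \<in> shuffles m mu la" and adm: "admissible \<kappa> r L" and z: "\<forall>b\<ge>n. la b = 0"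
    and "Suc r < m"
  shows "int (weight n (toggle \<kappa> r L) r) = int (weight n L (Suc r)) - excess n L r \<kappa>"
    "int (weight n (toggle \<kappa> r L) (Suc r)) = int (weight n L r) + excess n L r \<kappa>"
    "t \<noteq> r \<Longrightarrow> t \<noteq> Suc r \<Longrightarrow> weight n (toggle \<kappa> r L) t = weight n L t"
proof -
  note T = toggle_in_shuffles[OF L adm \<open>Suc r < m\<close>]
  have layer: "(\<Sum>b<n. int (toggle \<kappa> r L (Suc r) b)) + (\<Sum>b<n. int (L (Suc r) b))
    = (\<Sum>b<n. int (L r b)) + (\<Sum>b<n. int (L (Suc (Suc r)) b)) - excess n L r \<kappa>"
    by (rule sum_toggle_layer[OF L adm z])
  show "int (weight n (toggle \<kappa> r L) r) = int (weight n L (Suc r)) - excess n L r \<kappa>"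
    "int (weight n (toggle \<kappa> r L) (Suc r)) = int (weight n L r) + excess n L r \<kappa>"
    using layer unfolding int_weight[OF T] int_weight[OF L] by (simp_all add: toggle_other)
  show "weight n (toggle \<kappa> r L) t = weight n L t" if "t \<noteq> r" "t \<noteq> Suc r"
    using that by (simp add: weight_def toggle_other)
qed

lemma shuffles_row_antimono:
  assumes "L \<in> shuffles m mu la"
  shows "L t (b + 2 * k) \<le> L t b"
proof (induction k)
  case (Suc k)
  have "L t (Suc (Suc (b + 2 * k))) \<le> L t (b + 2 * k)"
    using shufflesD(3,4)[OF assms] order_trans by blast
  with Suc show ?case by simp
qed simp

lemma shuffles_row_antimono_Suc:
  assumes "L \<in> shuffles m mu la" "b < b'" "even (b' - b)"
  shows "L (Suc t) b' \<le> L t b"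
proof -
  from assms(2,3) obtain k where "b' - b = 2 * k" "0 < k" by (elim evenE) auto
  then have "b' = Suc (Suc b) + 2 * (k - 1)" using assms(2) by auto
  then show ?thesis
    using shuffles_row_antimono[OF assms(1), of "Suc t" "Suc (Suc b)" "k - 1"]
      shufflesD(4)[OF assms(1), of t b] by simp
qed

lemma excess_steps:
  assumes "L \<in> shuffles m mu la" "j \<le> j'" "j' \<le> n"
  shows "excess n L r (reading_cut c j') = excess n L r (reading_cut c j) + (\<Sum>i\<in>{j..<j'}. cell_sign L r i c)"
  using assms(2,3)
proof (induction j' rule: dec_induct)
  case (step j')
  then show ?case using excess_step[OF assms(1), of j' n r c] by simp
qed simp

lemma cell_sign_nonpos:
  assumes "c < L (Suc r) b \<or> L (Suc (Suc r)) b \<le> c"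
  shows "cell_sign L r b c \<le> 0"
  using assms by (auto simp: cell_sign_def)

section \<open>The first violation of the lattice condition\<close>

lemma excess_large:
  assumes L: "L \<in> shuffles m mu la" and "sum la {..<n} \<le> c"
  shows "excess n L r (reading_cut c j) = 0"
  unfolding excess_def
proof (rule sum.neutral, rule ballI)
  fix b assume "b \<in> {..<n}"
  then have "la b \<le> sum la {..<n}" by (intro member_le_sum) auto
  then have "L t b \<le> reading_cut c j b" for t
    using shuffles_le_final[OF L, of t b] assms(2) by (simp add: reading_cut_def)
  then show "int (max (L (Suc (Suc r)) b) (reading_cut c j b)) - 2 * int (max (L (Suc r) b) (reading_cut c j b)) +
         int (max (L r b) (reading_cut c j b)) = 0"
    by (simp add: max_absorb2)
qed

definition first_violation where
  "first_violation n L c b r \<longleftrightarrow> b < n \<and> 0 < excess n L r (reading_cut c (Suc b)) \<and>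
     (\<forall>r' c' j. c < c' \<and> j \<le> n \<longrightarrow> excess n L r' (reading_cut c' j) \<le> 0) \<and>
     (\<forall>r' j. j \<le> b \<longrightarrow> excess n L r' (reading_cut c j) \<le> 0)"

lemma first_violation_exists:
  assumes L: "L \<in> shuffles m mu la" and "\<not> lattice n L"
  obtains c b r where "first_violation n L c b r"
proof -
  define P where "P c j \<longleftrightarrow> j \<le> n \<and> (\<exists>r. 0 < excess n L r (reading_cut c j))" for c j
  define A where "A = {c. \<exists>j. P c j}"
  have "c < sum la {..<n}" if "c \<in> A" for c
    using that excess_large[OF L, of n c] by (force simp: A_def P_def not_le[symmetric])
  then have fin: "finite A" by (meson finite_nat_set_iff_bounded)
  from assms(2) obtain r c j where "j \<le> n" "0 < excess n L r (reading_cut c j)"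
    by (auto simp: lattice_def not_le)
  then have "c \<in> A" by (auto simp: A_def P_def)
  then have "A \<noteq> {}" by auto
  define c where "c = Max A"
  have "\<exists>j. P c j" using Max_in[OF fin \<open>A \<noteq> {}\<close>] by (simp add: A_def c_def)
  define j where "j = (LEAST j. P c j)"
  have j: "P c j" unfolding j_def by (rule LeastI_ex) fact
  have later: "excess n L r' (reading_cut c' j') \<le> 0" if "c < c'" "j' \<le> n" for r' c' j'
    using that Max_ge[OF fin, of c'] by (force simp: A_def P_def c_def not_le[symmetric])
  have before: "excess n L r' (reading_cut c j') \<le> 0" if "j' < j" for r' j'
  proof -
    have "\<not> P c j'" using not_less_Least[of j' "P c"] that unfolding j_def by blast
    moreover have "j' \<le> n" using that j by (simp add: P_def)
    ultimately show ?thesis by (auto simp: P_def not_less)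
  qed
  \<comment> \<open>A violation before any cell of column \<open>c\<close> is read already occurs at
    the end of column \<open>c + 1\<close>.\<close>
  have "j \<noteq> 0"
  proof
    assume "j = 0"
    with j obtain r where "0 < excess n L r (reading_cut c 0)" by (auto simp: P_def)
    then show False using later[of "Suc c" n r] excess_wrap[of n L r c] by simp
  qed
  then obtain b where b: "j = Suc b" by (cases j) auto
  from j obtain r where "0 < excess n L r (reading_cut c j)" "j \<le> n" by (auto simp: P_def)
  then have "first_violation n L c b r"
    using later before by (simp add: first_violation_def b)
  then show ?thesis by (rule that)
qed

lemma first_violationD:
  assumes L: "L \<in> shuffles m mu la" and v: "first_violation n L c b r"
  shows "excess n L r (reading_cut c (Suc b)) = 1" "excess n L r (reading_cut c b) = 0"
    "L (Suc r) b \<le> c" "c < L (Suc (Suc r)) b" "b < n"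
proof -
  have "cell_sign L r b c \<le> 1" by (simp add: cell_sign_def)
  moreover have "excess n L r (reading_cut c (Suc b)) = excess n L r (reading_cut c b) + cell_sign L r b c"
    using excess_step[OF L] v by (simp add: first_violation_def)
  moreover have "excess n L r (reading_cut c b) \<le> 0" "0 < excess n L r (reading_cut c (Suc b))"
    using v by (auto simp: first_violation_def)
  ultimately have *: "excess n L r (reading_cut c (Suc b)) = 1 \<and> excess n L r (reading_cut c b) = 0 \<and>
    cell_sign L r b c = 1" by linarith
  then show "excess n L r (reading_cut c (Suc b)) = 1" "excess n L r (reading_cut c b) = 0" by auto
  have "L (Suc r) b \<le> c \<and> c < L (Suc (Suc r)) b"
    using * by (auto simp: cell_sign_def of_bool_def split: if_splits)
  then show "L (Suc r) b \<le> c" "c < L (Suc (Suc r)) b" by auto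
  show "b < n" using v by (simp add: first_violation_def)
qed

lemma first_violation_not_earlier:
  assumes "first_violation n L c b r" "first_violation n L c' b' r'"
  shows "\<not> c < c'" "c = c' \<Longrightarrow> \<not> b' < b"
proof -
  have "Suc b' \<le> n" "0 < excess n L r' (reading_cut c' (Suc b'))"
    using assms(2) by (auto simp: first_violation_def)
  then have *: "\<not> (c < c' \<or> c = c' \<and> Suc b' \<le> b)"
    using assms(1) unfolding first_violation_def by (meson not_less)
  then show "\<not> c < c'" "c = c' \<Longrightarrow> \<not> b' < b" by auto
qed

text \<open>Neither position can precede the other, because the earlier cuts are controlled for
  every \<open>r'\<close>. The entry read at the violation is \<open>Suc r\<close>, which determines
  \<open>r\<close>.\<close>

lemma first_violation_unique:
  assumes L: "L \<in> shuffles m mu la"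
    and v: "first_violation n L c b r" and v': "first_violation n L c' b' r'"
  shows "c = c' \<and> b = b' \<and> r = r'"
proof -
  have "c = c'"
    using first_violation_not_earlier(1)[OF v v'] first_violation_not_earlier(1)[OF v' v] by simp
  moreover have "b = b'"
    using first_violation_not_earlier(2)[OF v v'] first_violation_not_earlier(2)[OF v' v] \<open>c = c'\<close> by simp
  moreover have "r = r'"
  proof (rule ccontr)
    note d = first_violationD(3,4)[OF L v] first_violationD(3,4)[OF L v']
    assume "r \<noteq> r'"
    then have "Suc (Suc r) \<le> Suc r' \<or> Suc (Suc r') \<le> Suc r" by linarith
    then show False
      using shuffles_mono[OF L, of "Suc (Suc r)" "Suc r'" b] shuffles_mono[OF L, of "Suc (Suc r')" "Suc r" b]
        d \<open>c = c'\<close> \<open>b = b'\<close> by auto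
  qed
  ultimately show ?thesis by simp
qed

text \<open>This is what makes the involution possible. If a free \<open>r\<close> had been read, go
  back from the violation to it: no cell on the way contributes 1, so the excess just before that
  \<open>r\<close> would already be positive. Rows of equal parity belong to one tableau, and column
  strictness controls them; the parity of \<open>b' - b\<close> has to be odd.\<close>

lemma first_violation_admissible:
  assumes L: "L \<in> shuffles m mu la" and v: "first_violation n L c b r"
    and z: "\<forall>b\<ge>n. la b = 0"
  shows "admissible (reading_cut c (Suc b)) r L"
proof -
  note d = first_violationD[OF L v]
  note dec = shuffles_row_antimono_Suc[OF L]
  have later: "excess n L r (reading_cut (Suc c) j) \<le> 0" if "j \<le> n" for j
    using v that by (simp add: first_violation_def)
  have before: "excess n L r (reading_cut c j) \<le> 0" if "j \<le> b" for j
    using v that by (simp add: first_violation_def)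
  have V1: "L (Suc r) b' \<le> reading_cut c (Suc b) b'" if lo: "toggle_low L r b' < reading_cut c (Suc b) b'" for b'
  proof (rule ccontr)
    assume "\<not> ?thesis"
    then have Q: "reading_cut c (Suc b) b' < L (Suc r) b'" by simp
    have lo: "L r b' < reading_cut c (Suc b) b'" "L (Suc (Suc r)) (Suc (Suc b')) < reading_cut c (Suc b) b'"
      using lo by (auto simp: toggle_low_def)
    consider "b' < b" | "b' = b" | "b < b'" by linarith
    then show False
    proof cases
      \<comment> \<open>In column \<open>c\<close>, rows below \<open>b'\<close> of its parity hold
        entries beyond \<open>Suc r\<close> or none, and rows above \<open>b\<close> of its parity
        hold at most \<open>r\<close>. Together they cover all rows in between.\<close>
      case 1
      then have k: "reading_cut c (Suc b) b' = c" by (simp add: reading_cut_def)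
      have R: "L (Suc (Suc r)) i \<le> c" if "b' < i" "even (i - b')" for i
      proof -
        from that obtain k where k: "i - b' = 2 * k" "0 < k" by (elim evenE) auto
        then have "i = Suc (Suc b') + 2 * (k - 1)" using that by auto
        then show ?thesis
          using shuffles_row_antimono[OF L, of "Suc (Suc r)" "Suc (Suc b')" "k - 1"] lo(2)
          by (simp add: \<open>reading_cut c (Suc b) b' = c\<close>)
      qed
      have "odd (b - b')" using R[of b] 1 d(4) by auto
      have "cell_sign L r i c \<le> 0" if "i \<in> {Suc b'..<b}" for i
      proof (cases "even (i - b')")
        case True
        then show ?thesis using R[of i] that by (intro cell_sign_nonpos) auto
      next
        case False
        then have "even (b - i)" using \<open>odd (b - b')\<close> that by auto
        then show ?thesis using dec[of i b "Suc r"] that d(4) by (intro cell_sign_nonpos) auto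
      qed
      then have "(\<Sum>i\<in>{Suc b'..<b}. cell_sign L r i c) \<le> 0" by (rule sum_nonpos)
      moreover have "cell_sign L r b' c = -1"
        using lo Q k by (auto simp: cell_sign_def)
      moreover have "excess n L r (reading_cut c b) = excess n L r (reading_cut c b') + (\<Sum>i\<in>{b'..<b}. cell_sign L r i c)"
        using excess_steps[OF L, of b' b n] 1 d(5) by simp
      moreover have "(\<Sum>i\<in>{b'..<b}. cell_sign L r i c) = cell_sign L r b' c + (\<Sum>i\<in>{Suc b'..<b}. cell_sign L r i c)"
        using 1 by (simp add: sum.atLeast_Suc_lessThan)
      ultimately show False using before[of b'] 1 d(2) by linarith
    next
      case 2
      then show False using Q d(3) by (simp add: reading_cut_def)
    next
      \<comment> \<open>The free \<open>r\<close> now stands in column \<open>c + 1\<close>, so the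
        way back goes up to the top of column \<open>c\<close> and continues from the bottom of
        column \<open>c + 1\<close>.\<close>
      case 3
      then have k: "reading_cut c (Suc b) b' = Suc c" by (simp add: reading_cut_def)
      have "b' < n"
        using Q spec[OF z, of b'] shuffles_le_final[OF L, of "Suc r" b'] by (cases "b' < n") auto
      have odd: "odd (b' - b)"
        using dec[OF 3, of "Suc r"] d(3) Q k shufflesD(3)[OF L, of "Suc r" b'] by auto
      have "cell_sign L r i c \<le> 0" if "i \<in> {0..<b}" for i
      proof (cases "even (b - i)")
        case True
        then show ?thesis using dec[of i b "Suc r"] that d(4) by (intro cell_sign_nonpos) auto
      next
        case False
        then have "even (b' - i)" using odd that 3 by auto
        then show ?thesis
          using dec[of i b' r] that 3 Q k shufflesD(3)[OF L, of r i] by (intro cell_sign_nonpos) auto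
      qed
      then have "(\<Sum>i\<in>{0..<b}. cell_sign L r i c) \<le> 0" by (rule sum_nonpos)
      then have "0 \<le> excess n L r (reading_cut (Suc c) n)"
        using excess_steps[OF L, of 0 b n r c] d(2,5) excess_wrap[of n L r c] by simp
      have "cell_sign L r i (Suc c) \<le> 0" if "i \<in> {Suc b'..<n}" for i
      proof (rule cell_sign_nonpos, rule disjI2)
        show "L (Suc (Suc r)) i \<le> Suc c"
        proof (cases "even (i - b')")
          case True
          with that obtain k where k: "i - b' = 2 * k" "0 < k" by (elim evenE) auto
          then have "i = Suc (Suc b') + 2 * (k - 1)" using that by auto
          then show ?thesis
            using shuffles_row_antimono[OF L, of "Suc (Suc r)" "Suc (Suc b')" "k - 1"] lo(2)
            by (simp add: \<open>reading_cut c (Suc b) b' = Suc c\<close>)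
        next
          case False
          then have "even (i - b)" using odd that 3 by auto
          then show ?thesis using dec[of b i "Suc r"] that 3 d(3) by auto
        qed
      qed
      then have "(\<Sum>i\<in>{Suc b'..<n}. cell_sign L r i (Suc c)) \<le> 0" by (rule sum_nonpos)
      moreover have "cell_sign L r b' (Suc c) = -1"
        using lo Q k by (auto simp: cell_sign_def)
      moreover have "(\<Sum>i\<in>{b'..<n}. cell_sign L r i (Suc c)) = cell_sign L r b' (Suc c) + (\<Sum>i\<in>{Suc b'..<n}. cell_sign L r i (Suc c))"
        using \<open>b' < n\<close> by (simp add: sum.atLeast_Suc_lessThan)
      ultimately show False
        using excess_steps[OF L, of b' n n r "Suc c"] \<open>b' < n\<close> later[of b']
          \<open>0 \<le> excess n L r (reading_cut (Suc c) n)\<close> by simp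
    qed
  qed
  \<comment> \<open>The cut jumps only at rows \<open>b\<close> and \<open>b - 1\<close>. At
    \<open>b\<close> column strictness suffices; at \<open>b - 1\<close> a divided pair would put an
    \<open>r\<close> directly before the violating cell, and the excess before that \<open>r\<close>
    would be 1.\<close>
  have V2: "L (Suc (Suc r)) (Suc (Suc b')) \<le> c \<or> c < L r b'" if "b' = b \<or> Suc b' = b" for b'
  proof (cases "b' = b")
    case True
    then show ?thesis using shufflesD(4)[OF L, of "Suc r" b] d(3) by simp
  next
    case False
    with that have b: "b = Suc b'" by simp
    show ?thesis
    proof (rule ccontr)
      assume "\<not> ?thesis"
      then have "cell_sign L r b' c = -1"
        using shufflesD(4)[OF L, of "Suc r" b'] by (auto simp: cell_sign_def)
      then show False
        using excess_step[OF L, of b' n r c] b d(2,5) before[of b'] by simp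
    qed
  qed
  have "reading_cut c (Suc b) (Suc (Suc b')) = reading_cut c (Suc b) b' \<or>
      reading_cut c (Suc b) (Suc (Suc b')) = Suc (reading_cut c (Suc b) b') \<and>
        (reading_cut c (Suc b) b' < L r b' \<or> L (Suc (Suc r)) (Suc (Suc b')) \<le> reading_cut c (Suc b) b')" for b'
  proof (cases "b' = b \<or> Suc b' = b")
    case True
    then show ?thesis using V2[of b'] by (auto simp: reading_cut_def)
  next
    case False
    then show ?thesis by (auto simp: reading_cut_def)
  qed
  with V1 show ?thesis by (simp add: admissible_def)
qed

lemma first_violation_less:
  assumes L: "L \<in> shuffles m mu la" and v: "first_violation n L c b r"
  shows "Suc r < m"
proof (rule ccontr)
  assume "\<not> Suc r < m"
  then have "L (Suc r) = L (Suc (Suc r))" using shufflesD(2)[OF L] by simp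
  then show False using first_violationD(3,4)[OF L v] by simp
qed

text \<open>The violation is decided by cells that have been read, and the toggle alters only the
  others. So a second application toggles with the same data.\<close>

lemma first_violation_toggle:
  assumes L: "L \<in> shuffles m mu la" and v: "first_violation n L c b r"
    and z: "\<forall>b\<ge>n. la b = 0"
  shows "first_violation n (toggle (reading_cut c (Suc b)) r L) c b r"
proof -
  note e = excess_toggle[OF L first_violation_admissible[OF L v z]]
  have "excess n (toggle (reading_cut c (Suc b)) r L) r' (reading_cut c' j) = excess n L r' (reading_cut c' j)"
    if "c < c' \<or> c = c' \<and> j \<le> Suc b" for r' c' j
    using that by (intro e) (auto simp: reading_cut_def)
  then show ?thesis using v by (auto simp: first_violation_def)
qed

lemma finite_shuffles:
  assumes z: "\<forall>b\<ge>n. la b = 0"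
  shows "finite (shuffles m mu la)"
proof -
  let ?D = "{..<m} \<times> {..<n}"
  let ?F = "PiE ?D (\<lambda>p. {..la (snd p)})"
  let ?g = "\<lambda>f t b. if t < m then if b < n then f (t, b) else 0 else la b"
  have "shuffles m mu la \<subseteq> ?g ` ?F"
  proof
    fix L assume L: "L \<in> shuffles m mu la"
    have zero: "L t b = 0" if "n \<le> b" for t b
      using shuffles_le_final[OF L, of t b] z that by simp
    have "L = ?g (restrict (\<lambda>(t, b). L t b) ?D)"
      using zero shufflesD(2)[OF L] by (auto simp: fun_eq_iff)
    moreover have "restrict (\<lambda>(t, b). L t b) ?D \<in> ?F"
      using shuffles_le_final[OF L] by auto
    ultimately show "L \<in> ?g ` ?F" by blast
  qed
  moreover have "finite ?F" by (intro finite_PiE) auto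
  ultimately show ?thesis using finite_subset by blast
qed

text \<open>
  The shift by \<open>- t\<close> is the usual staircase up to a constant. A violation exceeds the lattice
  condition by exactly one, so toggling the unread cells exchanges two entries of the shifted weight.
\<close>

lemma sum_antisymmetric_shuffles:
  fixes a :: "(nat \<Rightarrow> int) \<Rightarrow> int"
  assumes z: "\<forall>b\<ge>n. la b = 0"
    and a: "\<And>r v. Suc r < m \<Longrightarrow> a (v \<circ> transpose r (Suc r)) = - a v"
  shows "(\<Sum>L\<in>shuffles m mu la. a (\<lambda>t. int (weight n L t) - int t))
    = (\<Sum>L\<in>{L\<in>shuffles m mu la. lattice n L}. a (\<lambda>t. int (weight n L t) - int t))"
proof -
  let ?B = "{L\<in>shuffles m mu la. \<not> lattice n L}"
  let ?a = "\<lambda>L. a (\<lambda>t. int (weight n L t) - int t)"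
  define \<phi> where "\<phi> L = (case (SOME (c, b, r). first_violation n L c b r) of
    (c, b, r) \<Rightarrow> toggle (reading_cut c (Suc b)) r L)" for L
  have \<phi>: "\<phi> L = toggle (reading_cut c (Suc b)) r L"
    if "L \<in> shuffles m mu la" "first_violation n L c b r" for L c b r
  proof -
    have "(SOME (c, b, r). first_violation n L c b r) = (c, b, r)"
    proof (rule some_equality)
      fix p assume "case p of (c, b, r) \<Rightarrow> first_violation n L c b r"
      then show "p = (c, b, r)"
        using first_violation_unique[OF that(1) that(2)] by (cases p) fastforce
    qed (simp add: that)
    then show ?thesis by (simp add: \<phi>_def)
  qed
  have step: "\<phi> L \<in> ?B \<and> \<phi> (\<phi> L) = L \<and> ?a (\<phi> L) = - ?a L" if "L \<in> ?B" for L
  proof -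
    from that have L: "L \<in> shuffles m mu la" by simp
    from that obtain c b r where v: "first_violation n L c b r"
      using first_violation_exists[OF L, of n] by blast
    let ?\<kappa> = "reading_cut c (Suc b)"
    note adm = first_violation_admissible[OF L v z]
    note m = first_violation_less[OF L v]
    note v' = first_violation_toggle[OF L v z]
    note L' = toggle_in_shuffles[OF L adm m]
    have "\<not> lattice n (toggle ?\<kappa> r L)"
      using v' unfolding lattice_def first_violation_def by (meson Suc_leI not_le)
    moreover have "\<phi> (\<phi> L) = L"
      by (simp add: \<phi>[OF L v] \<phi>[OF L' v'] toggle_toggle[OF L adm])
    moreover have "(\<lambda>t. int (weight n (toggle ?\<kappa> r L) t) - int t)
        = (\<lambda>t. int (weight n L t) - int t) \<circ> transpose r (Suc r)"
    proof (rule ext)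
      fix t
      show "int (weight n (toggle ?\<kappa> r L) t) - int t
        = ((\<lambda>t. int (weight n L t) - int t) \<circ> transpose r (Suc r)) t"
        using weight_toggle(1,2)[OF L adm z m] weight_toggle(3)[OF L adm z m, of t] first_violationD(1)[OF L v]
        by (cases "t = r"; cases "t = Suc r") simp_all
    qed
    ultimately show ?thesis using L' a[OF m] by (simp add: \<phi>[OF L v])
  qed
  have fin: "finite (shuffles m mu la)" by (rule finite_shuffles[OF z])
  have "sum ?a ?B = (\<Sum>L\<in>?B. ?a (\<phi> L))"
    by (rule sum.reindex_bij_witness[where i = \<phi> and j = \<phi>]) (use step in simp_all)
  also have "\<dots> = (\<Sum>L\<in>?B. - ?a L)" by (rule sum.cong) (use step in simp_all)
  finally have "sum ?a ?B = 0" by (simp add: sum_negf)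
  moreover have "sum ?a (shuffles m mu la) = sum ?a {L\<in>shuffles m mu la. lattice n L} + sum ?a ?B"
  proof -
    have "shuffles m mu la = {L\<in>shuffles m mu la. lattice n L} \<union> ?B" by blast
    then show ?thesis using fin by (metis (no_types, lifting) finite_Un sum.union_disjoint Int_emptyI mem_Collect_eq)
  qed
  ultimately show ?thesis by simp
qed

text \<open>With the cut beyond all rows every cell is unread: the toggle is the ordinary
  Bender-Knuth involution and the excess vanishes.\<close>

lemma card_shuffles_weight_transpose:
  assumes z: "\<forall>b\<ge>n. la b = 0" and m: "Suc r < m"
  shows "card {L\<in>shuffles m mu la. weight n L = w \<circ> transpose r (Suc r)}
    = card {L\<in>shuffles m mu la. weight n L = w}"
proof -
  define \<kappa> :: "nat \<Rightarrow> nat" where "\<kappa> = (\<lambda>_. sum la {..<n})"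
  have le: "L t b \<le> \<kappa> b" if "L \<in> shuffles m mu la" for L t b
  proof (cases "b < n")
    case True
    then have "la b \<le> sum la {..<n}" by (intro member_le_sum) auto
    then show ?thesis using shuffles_le_final[OF that, of t b] by (simp add: \<kappa>_def)
  next
    case False
    then show ?thesis using shuffles_le_final[OF that, of t b] spec[OF z, of b] by simp
  qed
  have adm: "admissible \<kappa> r L" if "L \<in> shuffles m mu la" for L
    using le[OF that] by (simp add: admissible_def \<kappa>_def)
  have excess: "excess n L r \<kappa> = 0" if "L \<in> shuffles m mu la" for L
    using le[OF that] by (simp add: excess_def max_absorb2)
  have w: "weight n (toggle \<kappa> r L) = weight n L \<circ> transpose r (Suc r)" if "L \<in> shuffles m mu la" for L
  proof (rule ext)
    fix t
    show "weight n (toggle \<kappa> r L) t = (weight n L \<circ> transpose r (Suc r)) t"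
      using weight_toggle(1,2)[OF that adm[OF that] z m] weight_toggle(3)[OF that adm[OF that] z m, of t] excess[OF that]
      by (cases "t = r"; cases "t = Suc r") simp_all
  qed
  have "bij_betw (toggle \<kappa> r) {L\<in>shuffles m mu la. weight n L = w \<circ> transpose r (Suc r)}
      {L\<in>shuffles m mu la. weight n L = w}"
    by (rule bij_betw_byWitness[where f' = "toggle \<kappa> r"])
       (auto simp: w toggle_toggle adm toggle_in_shuffles m comp_assoc)
  then show ?thesis by (rule bij_betw_same_card)
qed

section \<open>Expansion into Schur functions\<close>

lemma permutes_strict_mono_id:
  assumes p: "\<pi> permutes {..<m::nat}" and mono: "\<And>i. Suc i < m \<Longrightarrow> \<pi> i < \<pi> (Suc i)"
  shows "\<pi> = id"
proof -
  have ge: "i \<le> \<pi> i" if "i < m" for i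
    using that
  proof (induction i)
    case (Suc i)
    then show ?case using mono[of i] by simp
  qed simp
  have "m - i \<le> d \<Longrightarrow> \<pi> i = i" for d i
  proof (induction d arbitrary: i)
    case 0
    then show ?case using permutes_not_in[OF p] by simp
  next
    case (Suc d)
    show ?case
    proof (cases "i < \<pi> i")
      case True
      then have "m - \<pi> i \<le> d" using Suc.prems by linarith
      then have "\<pi> (\<pi> i) = \<pi> i" by (rule Suc.IH)
      then show ?thesis using permutes_inj[OF p] by (simp add: inj_eq)
    next
      case False
      then show ?thesis using ge[of i] permutes_not_in[OF p, of i] by (cases "i < m") auto
    qed
  qed
  then show ?thesis by (auto simp: fun_eq_iff)
qed

lemma antimono_from_steps:
  fixes f :: "nat \<Rightarrow> nat"
  assumes "\<And>i. Suc i < m \<Longrightarrow> f (Suc i) \<le> f i" "i \<le> j" "j < m"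
  shows "f j \<le> f i"
  using assms(2,3)
proof (induction j rule: dec_induct)
  case (step j)
  then show ?case using assms(1)[of j] by simp
qed simp

lemma sum_swap_adjacent:
  fixes f :: "nat \<Rightarrow> int"
  assumes "Suc r < m"
  shows "(\<Sum>t<m. int t * f (transpose r (Suc r) t)) = (\<Sum>t<m. int t * f t) + f r - f (Suc r)"
proof -
  let ?A = "{..<m} - {r} - {Suc r}"
  have split: "sum h {..<m} = h r + (h (Suc r) + sum h ?A)" for h :: "nat \<Rightarrow> int"
  proof -
    have "sum h {..<m} = h r + sum h ({..<m} - {r})" using assms by (intro sum.remove) auto
    also have "sum h ({..<m} - {r}) = h (Suc r) + sum h ?A" using assms by (intro sum.remove) auto
    finally show ?thesis .
  qed
  have "(\<Sum>t\<in>?A. int t * f (transpose r (Suc r) t)) = (\<Sum>t\<in>?A. int t * f t)"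
    by (rule sum.cong) (auto simp: transpose_def)
  then show ?thesis unfolding split by (simp add: algebra_simps)
qed

text \<open>An adjacent swap lowers the value at every arrangement that fails to increase somewhere,
  so the identity is the only minimiser.\<close>

lemma rearrangement_strict:
  fixes z :: "nat \<Rightarrow> int"
  assumes z: "\<And>i j. i < j \<Longrightarrow> j < m \<Longrightarrow> z j < z i" and p: "\<pi> permutes {..<m}" and "\<pi> \<noteq> id"
  shows "(\<Sum>t<m. int t * z t) < (\<Sum>t<m. int t * z (\<pi> t))"
proof -
  define f where "f \<pi> = (\<Sum>t<m. int t * z (\<pi> t))" for \<pi>
  let ?P = "{\<pi>. \<pi> permutes {..<m}}"
  have fin: "finite ?P" by (simp add: finite_permutations)
  have minimal: "\<sigma> = id" if \<sigma>: "\<sigma> permutes {..<m}" and min: "\<And>\<rho>. \<rho> permutes {..<m} \<Longrightarrow> f \<sigma> \<le> f \<rho>" for \<sigma>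
  proof (rule permutes_strict_mono_id[OF \<sigma>], rule ccontr)
    fix i assume i: "Suc i < m" "\<not> \<sigma> i < \<sigma> (Suc i)"
    have "\<sigma> i \<noteq> \<sigma> (Suc i)" using permutes_inj[OF \<sigma>] by (simp add: inj_eq)
    then have "z (\<sigma> i) < z (\<sigma> (Suc i))"
      using i permutes_in_image[OF \<sigma>, of i] by (intro z) auto
    moreover have "f (\<sigma> \<circ> transpose i (Suc i)) = f \<sigma> + z (\<sigma> i) - z (\<sigma> (Suc i))"
      using sum_swap_adjacent[OF i(1), of "\<lambda>t. z (\<sigma> t)"] by (simp add: f_def)
    moreover have "\<sigma> \<circ> transpose i (Suc i) permutes {..<m}"
      using i(1) by (intro permutes_compose permutes_swap_id \<sigma>) auto
    ultimately show False using min by fastforce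
  qed
  obtain \<sigma> where \<sigma>: "\<sigma> permutes {..<m}" "\<And>\<rho>. \<rho> permutes {..<m} \<Longrightarrow> f \<sigma> \<le> f \<rho>"
  proof -
    have "?P \<noteq> {}" using permutes_id[of "{..<m}"] by blast
    from ex_is_arg_min_if_finite[OF fin this, of f] show thesis
      using that by (auto simp: is_arg_min_linorder)
  qed
  have "\<sigma> = id" using minimal \<sigma> by blast
  then have "f id \<le> f \<rho>" if "\<rho> permutes {..<m}" for \<rho> using \<sigma>(2)[OF that] by simp
  moreover have "f \<pi> \<noteq> f id" using minimal[OF p] calculation \<open>\<pi> \<noteq> id\<close> by auto
  ultimately have "f id < f \<pi>" using p by (simp add: order_less_le)
  then show ?thesis by (simp add: f_def)
qed

text \<open>
  Substitute for \<open>a\<close> the alternant of a weight \<open>w\<close> in the support with maximal sum of squares: by the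
  rearrangement inequality no other weight in the support contributes.
\<close>

lemma symmetric_eq_zero:
  fixes G :: "(nat \<Rightarrow> nat) \<Rightarrow> int"
  assumes fin: "finite W" and supp: "\<And>w. G w \<noteq> 0 \<Longrightarrow> w \<in> W"
    and vars: "\<And>w t. G w \<noteq> 0 \<Longrightarrow> m \<le> t \<Longrightarrow> w t = 0"
    and sym: "\<And>r w. Suc r < m \<Longrightarrow> G (w \<circ> transpose r (Suc r)) = G w"
    and anti: "\<And>a :: (nat \<Rightarrow> int) \<Rightarrow> int. (\<And>r v. Suc r < m \<Longrightarrow> a (v \<circ> transpose r (Suc r)) = - a v) \<Longrightarrow>
      (\<Sum>w\<in>W. G w * a (\<lambda>t. int (w t) - int t)) = 0"
  shows "G u = 0"
proof (rule ccontr)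
  assume "G u \<noteq> 0"
  define S where "S w = (\<Sum>t<m. (int (w t))\<^sup>2)" for w
  \<comment> \<open>\<open>T\<close> breaks ties: among the weights of maximal \<open>S\<close>, one
    with least \<open>T\<close> is weakly decreasing, since by symmetry its adjacent swaps are
    competitors. The shifted \<open>z\<close> below is then strictly decreasing.\<close>
  define T where "T w = (\<Sum>t<m. int t * int (w t))" for w
  let ?V = "{w\<in>W. G w \<noteq> 0}"
  have V: "finite ?V" "?V \<noteq> {}" using fin supp \<open>G u \<noteq> 0\<close> by auto
  define M where "M = Max (S ` ?V)"
  have "M \<in> S ` ?V" unfolding M_def using V by (intro Max_in) auto
  then have V': "{w\<in>?V. S w = M} \<noteq> {}" by auto
  have fin_V': "finite {w\<in>?V. S w = M}" by (rule finite_subset[OF _ V(1)]) auto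
  obtain w where w: "w \<in> {w\<in>?V. S w = M}" and T_min: "\<And>v. v \<in> {w\<in>?V. S w = M} \<Longrightarrow> T w \<le> T v"
    using ex_is_arg_min_if_finite[OF fin_V' V', of T] unfolding is_arg_min_linorder by blast
  have S_max: "S v \<le> S w" if "G v \<noteq> 0" for v
  proof -
    have "S v \<le> M" unfolding M_def using V(1) that supp by (intro Max_ge) auto
    then show ?thesis using w by simp
  qed
  have dec: "w (Suc r) \<le> w r" if r: "Suc r < m" for r
  proof (rule ccontr)
    assume less: "\<not> ?thesis"
    let ?v = "w \<circ> transpose r (Suc r)"
    have "transpose r (Suc r) permutes {..<m}" using r by (intro permutes_swap_id) auto
    then have "S ?v = S w"
      using sum.permute[of "transpose r (Suc r)" "{..<m}" "\<lambda>t. (int (w t))\<^sup>2"] by (simp add: S_def o_def)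
    then have "?v \<in> {w\<in>?V. S w = M}" using w sym[OF r, of w] supp by auto
    then have "T w \<le> T ?v" by (rule T_min)
    moreover have "T ?v = T w + int (w r) - int (w (Suc r))"
      using sum_swap_adjacent[OF r, of "\<lambda>t. int (w t)"] by (simp add: T_def)
    ultimately show False using less by simp
  qed
  define z where "z t = int (w t) - int t" for t
  have z: "z j < z i" if "i < j" "j < m" for i j
  proof -
    have "w j \<le> w i" using antimono_from_steps[of m w i j] dec that by simp
    then show ?thesis using that by (simp add: z_def)
  qed
  have wz: "int (w t) = z t + int t" for t by (simp add: z_def)
  \<comment> \<open>If \<open>v\<close> shifts to a rearrangement of \<open>z\<close>, equality of
    the square sums turns \<open>S v \<le> S w\<close> into \<open>T v \<le> T w\<close>, which the
    rearrangement inequality allows for the identity only.\<close>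
  have square: "(\<Sum>t<m. (f t)\<^sup>2) = S x - 2 * T x + (\<Sum>t<m. (int t)\<^sup>2)"
    if "\<And>t. int (x t) = f t + int t" for f x
  proof -
    have "(f t)\<^sup>2 = (int (x t))\<^sup>2 - 2 * (int t * int (x t)) + (int t)\<^sup>2" for t
      unfolding that by (simp add: power2_eq_square algebra_simps)
    then show ?thesis by (simp add: S_def T_def sum.distrib sum_subtractf sum_distrib_left)
  qed
  have moment: "T x = (\<Sum>t<m. int t * f t) + (\<Sum>t<m. (int t)\<^sup>2)"
    if "\<And>t. int (x t) = f t + int t" for f x
    by (simp add: T_def that power2_eq_square algebra_simps sum.distrib)
  let ?P = "{\<pi>. \<pi> permutes {..<m}}"
  \<comment> \<open>The signed indicator of the rearrangements of \<open>z\<close>; testing against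
    it isolates \<open>G w\<close>.\<close>
  define a where "a v = (\<Sum>\<pi>\<in>?P. sign \<pi> * of_bool (v = z \<circ> \<pi>))" for v
  have "a (v \<circ> transpose r (Suc r)) = - a v" if r: "Suc r < m" for r v
  proof -
    let ?\<tau> = "transpose r (Suc r)"
    have \<tau>: "?\<tau> permutes {..<m}" using r by (intro permutes_swap_id) auto
    have "v \<circ> ?\<tau> = z \<circ> (\<pi> \<circ> ?\<tau>) \<longleftrightarrow> v = z \<circ> \<pi>" for \<pi>
      by (metis comp_assoc comp_id transpose_comp_involutory)
    moreover have "sign (\<pi> \<circ> ?\<tau>) = - sign \<pi>" if "\<pi> \<in> ?P" for \<pi>
      using that permutes_imp_permutation[OF _ \<tau>] permutes_imp_permutation[of "{..<m}" \<pi>]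
      by (simp add: sign_compose sign_swap_id)
    moreover have "bij_betw (\<lambda>\<pi>. \<pi> \<circ> ?\<tau>) ?P ?P"
      by (rule bij_betw_byWitness[where f' = "\<lambda>\<pi>. \<pi> \<circ> ?\<tau>"])
         (auto simp: comp_assoc intro!: permutes_compose \<tau>)
    ultimately show ?thesis
      unfolding a_def
      by (subst sum.reindex_bij_betw[symmetric, where h = "\<lambda>\<pi>. \<pi> \<circ> ?\<tau>" and S = ?P])
         (simp_all add: sum_negf[symmetric])
  qed
  then have "(\<Sum>v\<in>W. G v * a (\<lambda>t. int (v t) - int t)) = 0" by (rule anti)
  moreover have "G v * a (\<lambda>t. int (v t) - int t) = (if v = w then G w else 0)" if "v \<in> W" for v
  proof (cases "G v = 0")
    case False
    have only_id: "\<pi> = id \<and> v = w" if "\<pi> permutes {..<m}" "(\<lambda>t. int (v t) - int t) = z \<circ> \<pi>" for \<pi>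
    proof -
      have vz: "int (v t) = z (\<pi> t) + int t" for t
        using fun_cong[OF that(2), of t] by simp
      have "(\<Sum>t<m. (z (\<pi> t))\<^sup>2) = (\<Sum>t<m. (z t)\<^sup>2)"
        using sum.permute[OF that(1), of "\<lambda>t. (z t)\<^sup>2"] by (simp add: o_def)
      moreover have "(\<Sum>t<m. (z (\<pi> t))\<^sup>2) = S v - 2 * T v + (\<Sum>t<m. (int t)\<^sup>2)"
        "(\<Sum>t<m. (z t)\<^sup>2) = S w - 2 * T w + (\<Sum>t<m. (int t)\<^sup>2)"
        by (rule square, rule vz) (rule square, rule wz)
      ultimately have "T v \<le> T w" using S_max[OF False] by linarith
      moreover have "T v = (\<Sum>t<m. int t * z (\<pi> t)) + (\<Sum>t<m. (int t)\<^sup>2)"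
        "T w = (\<Sum>t<m. int t * z t) + (\<Sum>t<m. (int t)\<^sup>2)"
        by (rule moment, rule vz) (rule moment, rule wz)
      ultimately have "(\<Sum>t<m. int t * z (\<pi> t)) \<le> (\<Sum>t<m. int t * z t)" by linarith
      then have id: "\<pi> = id"
        using rearrangement_strict[of m z \<pi>, OF z that(1)] by (metis not_le)
      have "v t = w t" for t using vz[of t] wz[of t] by (simp add: id)
      with id show ?thesis by (simp add: ext)
    qed
    have "a (\<lambda>t. int (v t) - int t) = (\<Sum>\<pi>\<in>?P. if \<pi> = id then of_bool (v = w) else 0)"
      unfolding a_def
    proof (intro sum.cong refl)
      fix \<pi> assume \<pi>: "\<pi> \<in> ?P"
      show "sign \<pi> * of_bool ((\<lambda>t. int (v t) - int t) = z \<circ> \<pi>)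
          = (if \<pi> = id then of_bool (v = w) else 0)"
      proof (cases "\<pi> = id")
        case True
        have "(\<lambda>t. int (v t) - int t) = z \<longleftrightarrow> v = w"
          unfolding z_def by (simp add: fun_eq_iff)
        then show ?thesis by (simp add: True)
      next
        case False
        then have "(\<lambda>t. int (v t) - int t) \<noteq> z \<circ> \<pi>" using only_id[of \<pi>] \<pi> by blast
        with False show ?thesis by simp
      qed
    qed
    also have "\<dots> = of_bool (v = w)"
      using permutes_id[of "{..<m}"] by (simp add: finite_permutations)
    finally show ?thesis by simp
  next
    case True
    then have "v \<noteq> w" using w by blast
    with True show ?thesis by simp
  qed
  then have "(\<Sum>v\<in>W. G v * a (\<lambda>t. int (v t) - int t)) = (\<Sum>v\<in>W. if v = w then G w else 0)"
    by (intro sum.cong refl)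
  ultimately have "(\<Sum>v\<in>W. if v = w then G w else 0) = 0" by simp
  then have "G w = 0" using w fin by simp
  then show False using w by simp
qed

section \<open>Straight shapes and their superstandard filling\<close>

definition part :: "nat list \<Rightarrow> nat \<Rightarrow> nat" where
  "part la t = (if t < length la then la ! t else 0)"

text \<open>A single straight shape in the format for pairs: the odd rows, which form the second
  tableau, are empty.\<close>

definition straight :: "nat list \<Rightarrow> nat \<Rightarrow> nat" where
  "straight la b = (if even b then part la (b div 2) else 0)"

text \<open>The Yamanouchi tableau: every cell of row \<open>a\<close> of the first tableau holds
  \<open>a\<close>.\<close>

definition superstandard :: "nat list \<Rightarrow> nat \<Rightarrow> nat \<Rightarrow> nat" where
  "superstandard la t b = (if b div 2 < t then straight la b else 0)"

lemma part_antimono: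
  assumes "is_partition la" "i \<le> j"
  shows "part la j \<le> part la i"
  using assms by (cases "i = j") (auto simp: part_def is_partition_def sorted_wrt_iff_nth_less)

lemma straight_eq_0: "2 * length la \<le> b \<Longrightarrow> straight la b = 0"
  by (auto simp: straight_def part_def)

lemma partition_eqI:
  assumes "is_partition la" "is_partition ka" "part la = part ka"
  shows "la = ka"
proof (rule nth_equalityI)
  have pos: "part ka t \<noteq> 0 \<longleftrightarrow> t < length ka" if "is_partition ka" for ka t
    using that by (auto simp: part_def is_partition_def set_conv_nth)
  show len: "length la = length ka"
    using pos[OF assms(1)] pos[OF assms(2)] assms(3) by (metis nat_neq_iff less_irrefl)
  show "la ! i = ka ! i" if "i < length la" for i
    using fun_cong[OF assms(3), of i] that len by (simp add: part_def)
qed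

lemma ex_partition:
  fixes w :: "nat \<Rightarrow> nat"
  assumes dec: "\<And>t. w (Suc t) \<le> w t" and fin: "\<And>t. m \<le> t \<Longrightarrow> w t = 0"
  obtains la where "is_partition la" "part la = w" "sum_list la = (\<Sum>t<m. w t)"
proof
  define l where "l = (LEAST l. w l = 0)"
  have l: "w l = 0" unfolding l_def by (rule LeastI[of _ m]) (simp add: fin)
  have pos: "w t \<noteq> 0" if "t < l" for t using not_less_Least that unfolding l_def by blast
  have mono: "w t \<le> w s" if "s \<le> t" for s t
    using lift_Suc_antimono_le[of w s t] dec that by blast
  have zero: "w t = 0" if "l \<le> t" for t using mono[OF that] l by simp
  have "l \<le> m" using pos[of m] fin[of m] by (cases "m < l") auto
  show "is_partition (map w [0..<l])"
    unfolding is_partition_def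
  proof
    show "sorted_wrt (\<ge>) (map w [0..<l])" using mono by (simp add: sorted_wrt_iff_nth_less)
    show "0 \<notin> set (map w [0..<l])"
    proof
      assume "0 \<in> set (map w [0..<l])"
      then obtain t where "t < l" "w t = 0" by auto
      then show False using pos by blast
    qed
  qed
  show "part (map w [0..<l]) = w" using zero by (auto simp: part_def fun_eq_iff)
  have "sum_list (map w [0..<l]) = (\<Sum>t<l. w t)"
    by (simp add: interv_sum_list_conv_sum_set_nat atLeast0LessThan)
  also have "\<dots> = (\<Sum>t<m. w t)"
    using \<open>l \<le> m\<close> zero by (intro sum.mono_neutral_left) auto
  finally show "sum_list (map w [0..<l]) = (\<Sum>t<m. w t)" .
qed

lemma length_partition_le:
  assumes "is_partition la"
  shows "length la \<le> sum_list la"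
proof -
  have "0 \<notin> set la" using assms by (simp add: is_partition_def)
  then show ?thesis by (induction la) auto
qed

lemma finite_partitions: "finite {la. is_partition la \<and> sum_list la = d}"
proof (rule finite_subset)
  show "{la. is_partition la \<and> sum_list la = d} \<subseteq> {xs. set xs \<subseteq> {..d} \<and> length xs \<le> d}"
    using length_partition_le member_le_sum_list by fastforce
  show "finite {xs. set xs \<subseteq> {..d} \<and> length xs \<le> d}" by (rule finite_lists_length_le) simp
qed

lemma superstandard_in_shuffles:
  assumes "is_partition la" "length la \<le> m"
  shows "superstandard la \<in> shuffles m (\<lambda>_. 0) (straight la)"
proof -
  have "superstandard la t b = straight la b" if "m \<le> t" for t b
    using that assms(2) by (auto simp: superstandard_def straight_def part_def)
  moreover have "straight la (Suc (Suc b)) \<le> straight la b" for b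
    using part_antimono[OF assms(1), of "b div 2" "Suc (b div 2)"] by (simp add: straight_def)
  ultimately show ?thesis
    by (auto simp: shuffles_def superstandard_def fun_eq_iff)
qed

lemma sum_pairs:
  fixes f :: "nat \<Rightarrow> 'a::comm_monoid_add"
  shows "(\<Sum>b<2 * k. f b) = (\<Sum>a<k. f (2 * a) + f (Suc (2 * a)))"
  by (induction k) (simp_all add: add.assoc)

lemma superstandard_lattice:
  assumes la: "is_partition la"
  shows "lattice (2 * length la) (superstandard la)"
  unfolding lattice_def
proof (intro allI impI)
  fix r c j
  let ?l = "length la"
  define x where "x i = int (max (part la i) (reading_cut c j (2 * i))) - int (reading_cut c j (2 * i))" for i
  have "excess (2 * ?l) (superstandard la) r (reading_cut c j)
      = (\<Sum>a<?l. (if a = Suc r then x a else 0) - (if a = r then x a else 0))"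
    unfolding excess_def sum_pairs
    by (rule sum.cong) (auto simp: superstandard_def straight_def x_def)
  also have "\<dots> = (if Suc r < ?l then x (Suc r) else 0) - (if r < ?l then x r else 0)"
    by (simp add: sum_subtractf)
  also have "\<dots> \<le> 0"
  proof -
    have "x (Suc r) \<le> x r"
      using part_antimono[OF la, of r "Suc r"] by (auto simp: x_def reading_cut_def max_def)
    moreover have "0 \<le> x r" by (simp add: x_def)
    ultimately show ?thesis by simp
  qed
  finally show "excess (2 * ?l) (superstandard la) r (reading_cut c j) \<le> 0" .
qed

lemma weight_superstandard: "weight (2 * length la) (superstandard la) = part la"
proof
  fix t
  have "weight (2 * length la) (superstandard la) t = (\<Sum>a<length la. if a = t then part la a else 0)"
    unfolding weight_def sum_pairs
    by (rule sum.cong) (auto simp: superstandard_def straight_def)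
  also have "\<dots> = part la t" by (simp add: part_def)
  finally show "weight (2 * length la) (superstandard la) t = part la t" .
qed

text \<open>
  The end of the first row \<open>a\<close> that is not filled with \<open>a\<close> would be the first \<open>Suc r\<close> to be read for
  some \<open>r \<ge> a\<close>, before any \<open>r\<close>.
\<close>

lemma lattice_straight_unique:
  assumes la: "is_partition la" and L: "L \<in> shuffles m (\<lambda>_. 0) (straight la)"
    and lat: "lattice (2 * length la) L"
  shows "L = superstandard la"
proof -
  have le: "L t b \<le> straight la b" for t b by (rule shuffles_le_final[OF L])
  have low: "L t b = 0" if "t \<le> b div 2" for t b
    using that
  proof (induction t arbitrary: b)
    case 0
    then show ?case using shufflesD(1)[OF L] by simp
  next
    case (Suc t)
    then obtain b' where b: "b = Suc (Suc b')" by (cases b; cases "b - 1") auto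
    with Suc have "L t b' = 0" by simp
    then show ?case using shufflesD(4)[OF L, of t b'] by (simp add: b)
  qed
  have full: "L (Suc a) (2 * a) = part la a" for a
  proof (induction a rule: less_induct)
    case (less a)
    show ?case
    proof (rule ccontr)
      assume "L (Suc a) (2 * a) \<noteq> part la a"
      then have less_part: "L (Suc a) (2 * a) < part la a"
        using le[of "Suc a" "2 * a"] by (simp add: straight_def)
      define c where "c = part la a - 1"
      have c: "part la a = Suc c" using less_part by (simp add: c_def)
      have "a < length la" using c by (auto simp: part_def split: if_splits)
      \<comment> \<open>The last cell of row \<open>a\<close> holds \<open>t - 1\<close>. This
        exceeds \<open>a\<close>, hence it is \<open>Suc r\<close> with
        \<open>a \<le> r\<close>.\<close>
      define t where "t = (LEAST t. c < L t (2 * a))"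
      have "c < L m (2 * a)" using shufflesD(2)[OF L, of m] c by (simp add: straight_def)
      then have t: "c < L t (2 * a)" unfolding t_def by (rule LeastI)
      have before: "L s (2 * a) \<le> c" if "s < t" for s
        using not_less_Least that unfolding t_def by (meson not_less)
      have "\<not> t \<le> Suc a"
        using t less_part c shuffles_mono[OF L, of t "Suc a" "2 * a"] by auto
      then obtain r where r: "t = Suc (Suc r)" "a \<le> r"
        by (cases t; cases "t - 1") auto
      let ?\<kappa> = "reading_cut c (Suc (2 * a))"
      let ?term = "\<lambda>b. int (max (L (Suc (Suc r)) b) (?\<kappa> b)) - 2 * int (max (L (Suc r) b) (?\<kappa> b))
        + int (max (L r b) (?\<kappa> b))"
      have "?term b = (if b = 2 * a then 1 else 0)" for b
      proof (cases "even b")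
        case False
        then show ?thesis using le[of _ b] by (auto simp: straight_def)
      next
        case True
        then obtain i where b: "b = 2 * i" by (elim evenE)
        consider "i < a" | "i = a" | "a < i" by linarith
        then show ?thesis
        proof cases
          case 1
          have "L s b = part la i" if "a \<le> s" for s
            using less.IH[OF 1] shuffles_mono[OF L, of "Suc i" s b] le[of s b] 1 that
            by (simp add: b straight_def)
          then show ?thesis using r 1 b by simp
        next
          case 2
          have "L (Suc (Suc r)) b = Suc c"
            using t le[of "Suc (Suc r)" b] c by (simp add: b 2 r straight_def)
          moreover have "L (Suc r) b \<le> c" "L r b \<le> c" using before[of "Suc r"] before[of r] r b 2 by auto
          ultimately show ?thesis using 2 b by (simp add: reading_cut_def max_def)
        next
          case 3
          have "L s b \<le> Suc c" for s
            using le[of s b] part_antimono[OF la, of a i] 3 c by (simp add: b straight_def)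
          then show ?thesis using 3 b by (simp add: reading_cut_def max_absorb2)
        qed
      qed
      then have "excess (2 * length la) L r ?\<kappa> = 1"
        using \<open>a < length la\<close> by (simp add: excess_def)
      moreover have "Suc (2 * a) \<le> 2 * length la" using \<open>a < length la\<close> by simp
      ultimately show False using lat unfolding lattice_def by (metis not_one_le_zero)
    qed
  qed
  show ?thesis
  proof (intro ext)
    fix t b
    show "L t b = superstandard la t b"
    proof (cases "even b \<and> b div 2 < t")
      case True
      then obtain a where b: "b = 2 * a" by (elim conjE evenE)
      then show ?thesis
        using full[of a] shuffles_mono[OF L, of "Suc a" t b] le[of t b] True
        by (simp add: superstandard_def straight_def)
    next
      case False
      then show ?thesis using low[of t b] le[of t b] by (auto simp: superstandard_def straight_def)
    qed
  qed
qed

lemma sum_card_fibres: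
  fixes g :: "'b \<Rightarrow> int"
  assumes "finite A" "finite W" "f ` A \<subseteq> W"
  shows "(\<Sum>w\<in>W. int (card {x\<in>A. f x = w}) * g w) = (\<Sum>x\<in>A. g (f x))"
proof -
  have "(\<Sum>x\<in>A. g (f x)) = (\<Sum>w\<in>W. \<Sum>x\<in>{x\<in>A. f x = w}. g (f x))"
    by (rule sum.group[symmetric]) (use assms in auto)
  then show ?thesis by simp
qed

lemma weight_zero:
  assumes "L \<in> shuffles m mu la" "m \<le> t"
  shows "weight n L t = 0"
  using shufflesD(2)[OF assms(1)] assms(2) by (simp add: weight_def)

lemma sum_weight:
  assumes L: "L \<in> shuffles m mu la"
  shows "int (\<Sum>t<m. weight n L t) = (\<Sum>b<n. int (la b)) - (\<Sum>b<n. int (mu b))"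
proof -
  have "int (\<Sum>t<m. weight n L t) = (\<Sum>t<m. (\<Sum>b<n. int (L (Suc t) b)) - (\<Sum>b<n. int (L t b)))"
    by (simp add: int_weight[OF L])
  also have "\<dots> = (\<Sum>b<n. int (L m b)) - (\<Sum>b<n. int (L 0 b))"
    by (rule sum_lessThan_telescope)
  finally show ?thesis using shufflesD(1,2)[OF L] by simp
qed

lemma lattice_weight_partition:
  assumes L: "L \<in> shuffles m mu la" and lat: "lattice n L"
  obtains ka where "is_partition ka" "part ka = weight n L" "sum_list ka = (\<Sum>b<n. la b) - (\<Sum>b<n. mu b)"
proof -
  have "weight n L (Suc t) \<le> weight n L t" for t
  proof -
    \<comment> \<open>This cut reads the whole word, so its excess is a difference of consecutive
      weights.\<close>
    have "excess n L t (reading_cut 0 n) \<le> 0" using lat by (simp add: lattice_def)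
    moreover have "excess n L t (reading_cut 0 n) = (\<Sum>b<n. int (L (Suc (Suc t)) b) - 2 * int (L (Suc t) b) + int (L t b))"
      unfolding excess_def by (rule sum.cong) (auto simp: reading_cut_def)
    ultimately have "int (weight n L (Suc t)) \<le> int (weight n L t)"
      unfolding int_weight[OF L] by (simp add: sum.distrib sum_subtractf sum_distrib_left[symmetric])
    then show ?thesis by simp
  qed
  then obtain ka where "is_partition ka" "part ka = weight n L" "sum_list ka = (\<Sum>t<m. weight n L t)"
    using ex_partition weight_zero[OF L] by blast
  moreover have "(\<Sum>t<m. weight n L t) = (\<Sum>b<n. la b) - (\<Sum>b<n. mu b)"
    using sum_weight[OF L, of n] by (simp flip: of_nat_sum)
  ultimately show ?thesis using that by simp
qed

text \<open>Both sides are symmetric in \<open>w\<close> by the Bender-Knuth toggles. Paired with an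
  antisymmetric function, the left side keeps its lattice shuffles and each straight shape keeps
  only the superstandard filling, so the difference of the two sides is annihilated. The bound
  \<open>d \<le> m\<close> gives every partition of \<open>d\<close> enough entries for that
  filling.\<close>

theorem shuffles_schur_expansion:
  assumes z: "\<forall>b\<ge>n. la b = 0" and d: "d = (\<Sum>b<n. la b) - (\<Sum>b<n. mu b)" and "d \<le> m"
  shows "int (card {L\<in>shuffles m mu la. weight n L = w})
    = (\<Sum>ka | is_partition ka \<and> sum_list ka = d.
        int (card {L\<in>shuffles m mu la. lattice n L \<and> weight n L = part ka}) *
        int (card {L\<in>shuffles m (\<lambda>_. 0) (straight ka). weight (2 * length ka) L = w}))"
    (is "?F w = (\<Sum>ka\<in>?P. ?N ka * ?K ka w)")
proof -
  let ?A = "shuffles m mu la" and ?B = "\<lambda>ka. shuffles m (\<lambda>_. 0) (straight ka)"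
  let ?wB = "\<lambda>ka. weight (2 * length ka)"
  define G where "G w = ?F w - (\<Sum>ka\<in>?P. ?N ka * ?K ka w)" for w
  define W where "W = weight n ` ?A \<union> (\<Union>ka\<in>?P. ?wB ka ` ?B ka)"
  have finA: "finite ?A" by (rule finite_shuffles[OF z])
  have finB: "finite (?B ka)" for ka by (rule finite_shuffles[of "2 * length ka"]) (simp add: straight_eq_0)
  have finW: "finite W" using finA finB finite_partitions by (auto simp: W_def)
  have G_outside: "G w = 0" if "w \<notin> weight n ` ?A" "\<And>ka. ka \<in> ?P \<Longrightarrow> w \<notin> ?wB ka ` ?B ka" for w
  proof -
    have A: "{L\<in>?A. weight n L = w} = {}" using that(1) by auto
    have B: "{L\<in>?B ka. ?wB ka L = w} = {}" if "ka \<in> ?P" for ka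
      using \<open>\<And>ka. ka \<in> ?P \<Longrightarrow> _\<close>[OF that] by auto
    have "?F w = 0" by (simp only: A card.empty of_nat_0)
    moreover have "(\<Sum>ka\<in>?P. ?N ka * ?K ka w) = 0"
      by (rule sum.neutral) (simp only: B card.empty of_nat_0 mult_zero_right ball_simps simp_thms cong: ball_cong)
    ultimately show ?thesis by (simp add: G_def)
  qed
  have "G w = 0"
  proof (rule symmetric_eq_zero[of W G m, OF finW])
    fix w assume "G w \<noteq> 0"
    then have "w \<in> weight n ` ?A \<or> (\<exists>ka\<in>?P. w \<in> ?wB ka ` ?B ka)" using G_outside by blast
    then show "w \<in> W" and "\<And>t. m \<le> t \<Longrightarrow> w t = 0"
      using weight_zero by (auto simp: W_def)
  next
    fix r w assume r: "Suc r < m"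
    have "\<forall>b\<ge>2 * length ka. straight ka b = 0" for ka by (simp add: straight_eq_0)
    note B = card_shuffles_weight_transpose[OF this r]
    show "G (w \<circ> transpose r (Suc r)) = G w"
      unfolding G_def B card_shuffles_weight_transpose[OF z r] ..
  next
    fix a :: "(nat \<Rightarrow> int) \<Rightarrow> int"
    assume a: "\<And>r v. Suc r < m \<Longrightarrow> a (v \<circ> transpose r (Suc r)) = - a v"
    let ?a = "\<lambda>w. a (\<lambda>t. int (w t) - int t)"
    have "(\<Sum>w\<in>W. ?F w * ?a w) = (\<Sum>L\<in>?A. ?a (weight n L))"
      using finA finW by (rule sum_card_fibres) (auto simp: W_def)
    also have "\<dots> = (\<Sum>L\<in>{L\<in>?A. lattice n L}. ?a (weight n L))"
      by (rule sum_antisymmetric_shuffles[OF z a])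
    also have "\<dots> = (\<Sum>w\<in>part ` ?P. int (card {L\<in>{L\<in>?A. lattice n L}. weight n L = w}) * ?a w)"
    proof (rule sum_card_fibres[symmetric])
      show "weight n ` {L\<in>?A. lattice n L} \<subseteq> part ` ?P"
      proof (rule image_subsetI)
        fix L assume "L \<in> {L\<in>?A. lattice n L}"
        then obtain ka where "is_partition ka" "part ka = weight n L" "sum_list ka = d"
          using lattice_weight_partition d by blast
        then show "weight n L \<in> part ` ?P" by force
      qed
    qed (use finA finite_partitions in auto)
    also have "\<dots> = (\<Sum>ka\<in>?P. ?N ka * ?a (part ka))"
      by (subst sum.reindex) (auto intro!: inj_onI partition_eqI simp: conj_ac)
    finally have F: "(\<Sum>w\<in>W. ?F w * ?a w) = (\<Sum>ka\<in>?P. ?N ka * ?a (part ka))" .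
    have K: "(\<Sum>w\<in>W. ?K ka w * ?a w) = ?a (part ka)" if "ka \<in> ?P" for ka
    proof -
      from that have ka: "is_partition ka" "length ka \<le> m"
        using length_partition_le[of ka] \<open>d \<le> m\<close> by auto
      have "{L\<in>?B ka. lattice (2 * length ka) L} = {superstandard ka}"
        using lattice_straight_unique[OF ka(1)] superstandard_in_shuffles[OF ka] superstandard_lattice[OF ka(1)]
        by blast
      moreover have "(\<Sum>w\<in>W. ?K ka w * ?a w) = (\<Sum>L\<in>?B ka. ?a (?wB ka L))"
        using finB finW by (rule sum_card_fibres) (use that in \<open>auto simp: W_def\<close>)
      moreover have "\<dots> = (\<Sum>L\<in>{L\<in>?B ka. lattice (2 * length ka) L}. ?a (?wB ka L))"
        by (rule sum_antisymmetric_shuffles[OF _ a]) (simp_all add: straight_eq_0)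
      ultimately show ?thesis by (simp add: weight_superstandard)
    qed
    have "(\<Sum>w\<in>W. (\<Sum>ka\<in>?P. ?N ka * ?K ka w) * ?a w) = (\<Sum>ka\<in>?P. ?N ka * (\<Sum>w\<in>W. ?K ka w * ?a w))"
      unfolding sum_distrib_left sum_distrib_right by (subst sum.swap) (simp add: mult.assoc)
    also have "\<dots> = (\<Sum>ka\<in>?P. ?N ka * ?a (part ka))" by (rule sum.cong) (simp_all add: K)
    finally show "(\<Sum>w\<in>W. G w * ?a w) = 0"
      using F by (simp add: G_def left_diff_distrib sum_subtractf)
  qed
  then show ?thesis by (simp add: G_def)
qed

section \<open>Exchanging parts of the two tableaux\<close>

definition pair_low :: "(nat \<Rightarrow> nat \<Rightarrow> nat) \<Rightarrow> nat \<Rightarrow> nat \<Rightarrow> nat" where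
  "pair_low L t a = min (L t (2 * a)) (L t (Suc (2 * a)))"

definition pair_high :: "(nat \<Rightarrow> nat \<Rightarrow> nat) \<Rightarrow> nat \<Rightarrow> nat \<Rightarrow> nat" where
  "pair_high L t a = max (L t (2 * a)) (L t (Suc (2 * a)))"

text \<open>
  Nodes \<open>(t, a)\<close> stand for the pair of values of \<open>L t\<close> in rows \<open>2 * a\<close> and \<open>2 * a + 1\<close>. Two nodes are
  bound if exchanging the values at only one of them can violate an inequality of \<^const>\<open>shuffles\<close>.
  This depends only on the unordered pairs, so exchanges do not affect it.
\<close>

inductive bound for L where
  up: "pair_low L (Suc t) a < pair_high L t a \<Longrightarrow> bound L (t, a) (Suc t, a)"
| down: "pair_low L (Suc t) a < pair_high L t a \<Longrightarrow> bound L (Suc t, a) (t, a)"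
| up_next: "pair_low L t a < pair_high L (Suc t) (Suc a) \<Longrightarrow> bound L (t, a) (Suc t, Suc a)"
| down_next: "pair_low L t a < pair_high L (Suc t) (Suc a) \<Longrightarrow> bound L (Suc t, Suc a) (t, a)"

text \<open>Layer 0 carries the inner shapes, and every layer from \<open>m\<close> on carries the
  outer ones, so all of these count as boundary.\<close>

definition inverted_boundary where
  "inverted_boundary m mu la = {(0, a) |a. mu (2 * a) < mu (Suc (2 * a))} \<union>
     {(t, a) |t a. m \<le> t \<and> la (2 * a) < (la (Suc (2 * a)) :: nat)}"

definition flip_set where
  "flip_set m mu la L = {q. \<exists>p\<in>inverted_boundary m mu la. (bound L)\<^sup>*\<^sup>* p q}"

definition partner :: "nat \<Rightarrow> nat" where
  "partner b = (if even b then Suc b else b - 1)"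

definition flip :: "(nat \<times> nat) set \<Rightarrow> (nat \<Rightarrow> nat \<Rightarrow> nat) \<Rightarrow> nat \<Rightarrow> nat \<Rightarrow> nat" where
  "flip S L t b = (if (t, b div 2) \<in> S then L t (partner b) else L t b)"

definition sort_pairs :: "(nat \<Rightarrow> nat) \<Rightarrow> nat \<Rightarrow> nat" where
  "sort_pairs f b = (if even b then max (f b) (f (partner b)) else min (f b) (f (partner b)))"

lemma partner_simps [simp]:
  "partner (2 * a) = Suc (2 * a)" "partner (Suc (2 * a)) = 2 * a"
  "partner (partner b) = b" "partner b div 2 = b div 2"
  "partner (Suc (Suc b)) = Suc (Suc (partner b))"
  by (auto simp: partner_def elim!: oddE evenE)

lemma pair_bounds:
  "pair_low L t (b div 2) \<le> L t b" "L t b \<le> pair_high L t (b div 2)"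
  "pair_low L t (b div 2) \<le> L t (partner b)" "L t (partner b) \<le> pair_high L t (b div 2)"
  by (cases "even b"; auto simp: pair_low_def pair_high_def partner_def elim!: evenE oddE)+

lemma flip_simps [simp]:
  "flip S (flip S L) = L" "pair_low (flip S L) = pair_low L" "pair_high (flip S L) = pair_high L"
  by (auto simp: fun_eq_iff flip_def pair_low_def pair_high_def)

lemma bound_flip [simp]: "bound (flip S L) = bound L"
  by (simp add: fun_eq_iff bound.simps)

lemma flip_set_flip [simp]: "flip_set m mu la (flip S L) = flip_set m mu la L"
  by (simp add: flip_set_def)

lemma bound_sym: "bound L p q \<Longrightarrow> bound L q p"
  by (auto elim!: bound.cases intro: bound.intros)

lemma flip_set_closed: "p \<in> flip_set m mu la L \<Longrightarrow> bound L p q \<Longrightarrow> q \<in> flip_set m mu la L"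
  unfolding flip_set_def by (blast intro: rtranclp.rtrancl_into_rtrancl)

lemma flip_set_bound_iff: "bound L p q \<Longrightarrow> p \<in> flip_set m mu la L \<longleftrightarrow> q \<in> flip_set m mu la L"
  using flip_set_closed bound_sym by blast

text \<open>A bond passes the orientation on: if the odd row is the longer one at one end,
  monotonicity within each tableau leaves the bond inequality no other way to hold than with the odd
  row longer at the other end too. So boundary pairs that are already sorted are never
  exchanged.\<close>

lemma flip_set_inverted:
  assumes L: "L \<in> shuffles m mu la" and "(t, a) \<in> flip_set m mu la L"
  shows "L t (2 * a) < L t (Suc (2 * a))"
proof -
  from assms(2) obtain p where p: "p \<in> inverted_boundary m mu la" "(bound L)\<^sup>*\<^sup>* p (t, a)"
    by (auto simp: flip_set_def)
  from p(2) have "L (fst (t, a)) (2 * snd (t, a)) < L (fst (t, a)) (Suc (2 * snd (t, a)))"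
  proof (induction rule: rtranclp_induct)
    case base
    then show ?case using p(1) shufflesD(1,2)[OF L] by (auto simp: inverted_boundary_def)
  next
    case (step q s)
    from step(2) show ?case
    proof cases
      case (up t a)
      then show ?thesis
        using step(3) shufflesD(3)[OF L, of t "2 * a"] shufflesD(3)[OF L, of t "Suc (2 * a)"]
        by (auto simp: pair_low_def pair_high_def)
    next
      case (down t a)
      then show ?thesis
        using step(3) shufflesD(3)[OF L, of t "2 * a"] shufflesD(3)[OF L, of t "Suc (2 * a)"]
        by (auto simp: pair_low_def pair_high_def)
    next
      case (up_next t a)
      then show ?thesis
        using step(3) shufflesD(4)[OF L, of t "2 * a"] shufflesD(4)[OF L, of t "Suc (2 * a)"]
        by (auto simp: pair_low_def pair_high_def)
    next
      case (down_next t a)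
      then show ?thesis
        using step(3) shufflesD(4)[OF L, of t "2 * a"] shufflesD(4)[OF L, of t "Suc (2 * a)"]
        by (auto simp: pair_low_def pair_high_def)
    qed
  qed
  then show ?thesis by simp
qed

text \<open>Inequalities between nodes treated alike are inherited. Nodes treated differently are
  not bound, and then their inequality holds in every orientation.\<close>

lemma flip_in_shuffles:
  assumes L: "L \<in> shuffles m mu la"
  shows "flip (flip_set m mu la L) L \<in> shuffles m (sort_pairs mu) (sort_pairs la)"
proof -
  let ?S = "flip_set m mu la L"
  have boundary: "flip ?S L t b = sort_pairs (L t) b"
    if "\<And>a. L t (2 * a) < L t (Suc (2 * a)) \<Longrightarrow> (t, a) \<in> ?S" for t b
  proof (cases "(t, b div 2) \<in> ?S")
    case True
    then show ?thesis
      using flip_set_inverted[OF L True]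
      by (cases "even b") (auto simp: flip_def sort_pairs_def partner_def elim!: evenE oddE)
  next
    case False
    then have "\<not> L t (2 * (b div 2)) < L t (Suc (2 * (b div 2)))" using that by blast
    then show ?thesis
      using False by (cases "even b") (auto simp: flip_def sort_pairs_def partner_def elim!: evenE oddE)
  qed
  have start: "p \<in> ?S" if "p \<in> inverted_boundary m mu la" for p
    using that by (auto simp: flip_set_def)
  have "flip ?S L 0 = sort_pairs mu"
    using boundary[of 0] start shufflesD(1)[OF L] by (auto simp: inverted_boundary_def fun_eq_iff)
  moreover have "flip ?S L t = sort_pairs la" if "m \<le> t" for t
    using boundary[of t] start shufflesD(2)[OF L that] that by (auto simp: inverted_boundary_def fun_eq_iff)
  moreover have "flip ?S L t b \<le> flip ?S L (Suc t) b" for t b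
  proof (cases "(t, b div 2) \<in> ?S \<longleftrightarrow> (Suc t, b div 2) \<in> ?S")
    case True
    then show ?thesis using shufflesD(3)[OF L] by (auto simp: flip_def)
  next
    case False
    then have "\<not> bound L (t, b div 2) (Suc t, b div 2)" using flip_set_bound_iff by blast
    then have "pair_high L t (b div 2) \<le> pair_low L (Suc t) (b div 2)"
      by (auto simp: not_less[symmetric] intro: bound.intros)
    moreover have "flip ?S L t b \<le> pair_high L t (b div 2)" "pair_low L (Suc t) (b div 2) \<le> flip ?S L (Suc t) b"
      using pair_bounds by (auto simp: flip_def)
    ultimately show ?thesis by linarith
  qed
  moreover have "flip ?S L (Suc t) (Suc (Suc b)) \<le> flip ?S L t b" for t b
  proof (cases "(t, b div 2) \<in> ?S \<longleftrightarrow> (Suc t, Suc (b div 2)) \<in> ?S")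
    case True
    then show ?thesis using shufflesD(4)[OF L] by (auto simp: flip_def)
  next
    case False
    then have "\<not> bound L (t, b div 2) (Suc t, Suc (b div 2))" using flip_set_bound_iff by blast
    then have "pair_high L (Suc t) (Suc (b div 2)) \<le> pair_low L t (b div 2)"
      by (auto simp: not_less[symmetric] intro: bound.intros)
    moreover have "flip ?S L (Suc t) (Suc (Suc b)) \<le> pair_high L (Suc t) (Suc (b div 2))"
      "pair_low L t (b div 2) \<le> flip ?S L t b"
      using pair_bounds[of L "Suc t" "Suc (Suc b)"] pair_bounds[of L t b] by (auto simp: flip_def)
    ultimately show ?thesis by linarith
  qed
  ultimately show ?thesis by (simp add: shuffles_def)
qed

section \<open>Weight and lattice condition under exchanges\<close>

lemma sum_flip:
  fixes g :: "nat \<Rightarrow> nat \<Rightarrow> 'a::comm_monoid_add"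
  assumes "\<And>a x. g (Suc (2 * a)) x = g (2 * a) x"
  shows "(\<Sum>b<2 * k. g b (flip S L t b)) = (\<Sum>b<2 * k. g b (L t b))"
  unfolding sum_pairs by (rule sum.cong) (auto simp: flip_def assms add.commute)

lemma weight_flip:
  assumes "L \<in> shuffles m mu la" "flip S L \<in> shuffles m mu' la'"
  shows "weight (2 * k) (flip S L) t = weight (2 * k) L t"
proof -
  have "int (weight (2 * k) (flip S L) t) = int (weight (2 * k) L t)"
    unfolding int_weight[OF assms(1)] int_weight[OF assms(2)]
    by (simp add: sum_flip[of "\<lambda>_. int"])
  then show ?thesis by simp
qed

text \<open>An even cut has the same column bound in both rows of each pair, so only the unordered
  pair enters.\<close>

lemma excess_flip:
  "excess (2 * k) (flip S L) r (reading_cut c (2 * j)) = excess (2 * k) L r (reading_cut c (2 * j))"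
proof -
  have "reading_cut c (2 * j) (Suc (2 * a)) = reading_cut c (2 * j) (2 * a)" for a
    by (auto simp: reading_cut_def)
    show ?thesis
    unfolding excess_def sum.distrib sum_subtractf sum_distrib_left[symmetric]
    by (subst (1 2 3) sum_flip) (simp_all add: reading_cut_def)
qed

lemma excess_steps_zero:
  assumes "L \<in> shuffles m mu la" "j \<le> j'" "j' \<le> n"
    and "\<And>i. j \<le> i \<Longrightarrow> i < j' \<Longrightarrow> c < L r i \<or> L (Suc (Suc r)) i \<le> c"
  shows "excess n L r (reading_cut c j') = excess n L r (reading_cut c j)"
proof -
  have "(\<Sum>i\<in>{j..<j'}. cell_sign L r i c) = 0"
  proof (rule sum.neutral, rule ballI)
    fix i assume "i \<in> {j..<j'}"
    then have "c < L r i \<or> L (Suc (Suc r)) i \<le> c" using assms(4) by simp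
    then show "cell_sign L r i c = 0"
      using shufflesD(3)[OF assms(1), of r i] shufflesD(3)[OF assms(1), of "Suc r" i]
      by (auto simp: cell_sign_def)
  qed
  then show ?thesis using excess_steps[OF assms(1-3)] by simp
qed

text \<open>
  Here the cells of rows \<open>2 * a\<close> and \<open>2 * a + 1\<close> in column \<open>c\<close> hold \<open>Suc r\<close> and \<open>r\<close>, and the order in
  which they are read matters because the excess before them is zero. Since the excess cannot become
  positive, it stays zero when the reading is followed back to the right end \<open>q\<close> of the entries \<open>r\<close>,
  and on to the left end \<open>p\<close> of the entries \<open>Suc r\<close>. This determines the neighbouring entries.
\<close>

lemma critical_not_bound:
  assumes L: "L \<in> shuffles m mu la" and z: "\<forall>b\<ge>2 * k. la b = 0" and "a < k"
    and ex: "\<And>c j. j \<le> k \<Longrightarrow> excess (2 * k) L r (reading_cut c (2 * j)) \<le> 0"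
    and tight: "excess (2 * k) L r (reading_cut c (2 * a)) = 0"
    and B: "L (Suc r) (2 * a) \<le> c" "c < L (Suc (Suc r)) (2 * a)"
    and A: "L r (Suc (2 * a)) \<le> c" "c < L (Suc r) (Suc (2 * a))"
  shows "\<not> bound L (Suc r, a) node"
proof -
  let ?D = "\<lambda>c j. excess (2 * k) L r (reading_cut c j)"
  define q where "q = L (Suc r) (Suc (2 * a))"
  define p where "p = L (Suc r) (2 * a)"
  note mono = shufflesD(3)[OF L] and str = shufflesD(4)[OF L]
  have pq: "p \<le> c" "c < q" using A B by (auto simp: p_def q_def)
  have odd_above: "d < L r i" if "d < q" "i < 2 * a" "odd i" for d i
  proof -
    have "even (Suc (2 * a) - i)" "i < Suc (2 * a)" using that by auto
    then show ?thesis
      using shuffles_row_antimono_Suc[OF L, of i "Suc (2 * a)" r] that(1) by (simp add: q_def)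
  qed
  have even_below: "L (Suc (Suc r)) i \<le> d" if "p \<le> d" "2 * a < i" "even i" for d i
    using shuffles_row_antimono_Suc[OF L, of "2 * a" i "Suc r"] that by (simp add: p_def)
  have odd_below: "L (Suc (Suc r)) i \<le> d"
    if "L (Suc (Suc r)) (2 * a + 3) \<le> d" "Suc (2 * a) < i" "odd i" for d i
  proof -
    from that(2,3) obtain j where "i = 2 * j + 1" by (elim oddE)
    with that(2) have "i = 2 * a + 3 + 2 * (j - a - 1)" by simp
    then show ?thesis
      using shuffles_row_antimono[OF L, of "Suc (Suc r)" "2 * a + 3" "j - a - 1"] that(1) by simp
  qed
  \<comment> \<open>Otherwise the row just above in the first tableau holds \<open>r\<close> in
    column \<open>d\<close>, the odd row between contributes nothing, and the even cut before both
    has excess 1.\<close>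
  have even_above: "d < L r i"
    if "?D d (2 * a) = 0" "d < L (Suc (Suc r)) (2 * a)" "d < q" "i < 2 * a" "even i" for d i
  proof -
    from \<open>i < 2 * a\<close> obtain a' where a': "a = Suc a'" by (cases a) auto
    have "d < L r (2 * a')"
    proof (rule ccontr)
      assume "\<not> ?thesis"
      then have "cell_sign L r (2 * a') d = -1"
        using that(2) str[of "Suc r" "2 * a'"] by (auto simp: cell_sign_def a')
      moreover have "cell_sign L r (Suc (2 * a')) d = 0"
        using odd_above[OF that(3), of "Suc (2 * a')"] mono[of r "Suc (2 * a')"]
        by (auto simp: cell_sign_def a')
      ultimately have "?D d (2 * a') = 1"
        using that(1) excess_step[OF L, of "2 * a'" "2 * k" r d] excess_step[OF L, of "Suc (2 * a')" "2 * k" r d]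
          \<open>a < k\<close> by (simp add: a')
      then show False using ex[of a' d] \<open>a < k\<close> by (simp add: a')
    qed
    moreover from \<open>even i\<close> \<open>i < 2 * a\<close> obtain j where "2 * a' = i + 2 * j"
    proof (elim evenE)
      fix e assume "i = 2 * e"
      then show thesis using that[of "a' - e"] \<open>i < 2 * a\<close> a' by simp
    qed
    ultimately show ?thesis using shuffles_row_antimono[OF L, of r i j] by simp
  qed
  \<comment> \<open>Otherwise row \<open>2 * a + 3\<close> holds \<open>Suc r\<close> there, and the
    four rows from \<open>2 * a\<close> on contribute 1, -1, 0, 1.\<close>
  have below: "L (Suc (Suc r)) (2 * a + 3) \<le> d"
    if "?D d (2 * a) = 0" "p \<le> d" "d < L (Suc (Suc r)) (2 * a)" "L r (Suc (2 * a)) \<le> d" "d < q" for d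
  proof (rule ccontr)
    assume *: "\<not> ?thesis"
    then have "2 * a + 3 < 2 * k"
      using shuffles_le_final[OF L, of "Suc (Suc r)" "2 * a + 3"] z by (cases "2 * a + 3 < 2 * k") auto
    have "cell_sign L r (2 * a) d = 1"
      using that mono[of r "2 * a"] by (auto simp: cell_sign_def p_def)
    moreover have "cell_sign L r (Suc (2 * a)) d = -1"
      using that by (auto simp: cell_sign_def q_def)
    moreover have "cell_sign L r (2 * a + 2) d = 0"
      using even_below[OF that(2), of "2 * a + 2"] mono[of "Suc r" "2 * a + 2"] by (auto simp: cell_sign_def)
    moreover have "cell_sign L r (2 * a + 3) d = 1"
      using * that(4) str[of r "Suc (2 * a)"] mono[of r "2 * a + 3"] by (auto simp: cell_sign_def eval_nat_numeral)
    ultimately have "?D d (2 * a + 4) = 1"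
      using that(1) excess_step[OF L, of "2 * a" "2 * k" r d] excess_step[OF L, of "2 * a + 1" "2 * k" r d]
        excess_step[OF L, of "2 * a + 2" "2 * k" r d] excess_step[OF L, of "2 * a + 3" "2 * k" r d]
        \<open>2 * a + 3 < 2 * k\<close> by (simp add: eval_nat_numeral)
    then show False using ex[of "a + 2" d] \<open>2 * a + 3 < 2 * k\<close> by (simp add: eval_nat_numeral)
  qed
  have row_a: "?D d (Suc (Suc (2 * a))) = ?D d (2 * a) + cell_sign L r (2 * a) d + cell_sign L r (Suc (2 * a)) d" for d
    using excess_step[OF L, of "2 * a" "2 * k" r d] excess_step[OF L, of "Suc (2 * a)" "2 * k" r d] \<open>a < k\<close> by simp
  have top: "?D d (2 * a) = ?D d 0" if "d < q" "\<And>i. i < 2 * a \<Longrightarrow> even i \<Longrightarrow> d < L r i" for d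
  proof (rule excess_steps_zero[OF L])
    fix i assume "i < 2 * a"
    then show "d < L r i \<or> L (Suc (Suc r)) i \<le> d"
      using that odd_above by blast
  qed (use \<open>a < k\<close> in auto)
  have bottom: "?D d (2 * k) = ?D d (Suc (Suc (2 * a)))" if "p \<le> d" "L (Suc (Suc r)) (2 * a + 3) \<le> d" for d
  proof (rule excess_steps_zero[OF L])
    fix i assume "Suc (Suc (2 * a)) \<le> i"
    then show "d < L r i \<or> L (Suc (Suc r)) i \<le> d"
      using even_below[OF that(1), of i] odd_below[OF that(2), of i] by (cases "even i") auto
  qed (use \<open>a < k\<close> in auto)
  \<comment> \<open>Excess zero in column \<open>d\<close> is excess zero at the end of column
    \<open>d + 1\<close>, where the \<open>r\<close> in the odd row has to be balanced by a
    \<open>Suc r\<close> in the even row.\<close>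
  have right: "?D d (2 * a) = 0 \<and> d < L (Suc (Suc r)) (2 * a)" if "c \<le> d" "d < q" for d
    using that
  proof (induction d rule: dec_induct)
    case base
    then show ?case using tight B by simp
  next
    case (step d)
    then have IH: "?D d (2 * a) = 0" "d < L (Suc (Suc r)) (2 * a)" and "d < q" by auto
    have "?D (Suc d) (2 * k) = 0"
      using top[OF \<open>d < q\<close> even_above[OF IH \<open>d < q\<close>]] IH excess_wrap[of "2 * k" L r d] by simp
    moreover have "L (Suc (Suc r)) (2 * a + 3) \<le> Suc d"
      using below[OF tight \<open>p \<le> c\<close> B(2) A(1) \<open>c < q\<close>] step(1) by simp
    moreover have "cell_sign L r (Suc (2 * a)) (Suc d) = -1"
      using A(1) step by (auto simp: cell_sign_def q_def)
    ultimately have "?D (Suc d) (2 * a) + cell_sign L r (2 * a) (Suc d) = 1"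
      using bottom[of "Suc d"] row_a[of "Suc d"] pq(1) step(1) by simp
    moreover have "cell_sign L r (2 * a) (Suc d) \<le> 1" by (simp add: cell_sign_def)
    moreover have "?D (Suc d) (2 * a) \<le> 0" using ex \<open>a < k\<close> by simp
    ultimately have "?D (Suc d) (2 * a) = 0" "cell_sign L r (2 * a) (Suc d) = 1" by linarith+
    then show ?case by (auto simp: cell_sign_def of_bool_def split: if_splits)
  qed
  \<comment> \<open>In column \<open>d + 1\<close> the pair contributes 1 and -1, so excess zero
    passes on to column \<open>d\<close>. An odd-row entry smaller than \<open>r\<close> there would
    leave the \<open>Suc r\<close> uncompensated.\<close>
  have left: "?D d (2 * a) = 0 \<and> L r (Suc (2 * a)) \<le> d \<and> L (Suc (Suc r)) (2 * a + 3) \<le> d"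
    if "p \<le> d" "d \<le> c" for d
    using that(2,1)
  proof (induction d rule: inc_induct)
    case base
    then show ?case using tight A(1) below[OF tight \<open>p \<le> c\<close> B(2) A(1) \<open>c < q\<close>] by simp
  next
    case (step d)
    then have IH: "?D (Suc d) (2 * a) = 0" "L r (Suc (2 * a)) \<le> Suc d"
      "L (Suc (Suc r)) (2 * a + 3) \<le> Suc d" by auto
    have d: "p \<le> d" "d < q" "d < L (Suc (Suc r)) (2 * a)" using step B pq by auto
    have "cell_sign L r (2 * a) (Suc d) = 1" "cell_sign L r (2 * a) d = 1"
      using step B d mono[of r "2 * a"] by (auto simp: cell_sign_def p_def)
    moreover have "cell_sign L r (Suc (2 * a)) (Suc d) = -1"
      using IH step pq by (auto simp: cell_sign_def q_def)
    ultimately have "?D (Suc d) (2 * k) = 0"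
      using bottom[of "Suc d"] row_a[of "Suc d"] IH d by simp
    moreover have "?D d (2 * a) = ?D d 0"
      using even_above[OF tight B(2) pq(2)] step(2) by (intro top d) (meson le_less_trans less_imp_le_nat)
    ultimately have D: "?D d (2 * a) = 0" using excess_wrap[of "2 * k" L r d] by simp
    have "L r (Suc (2 * a)) \<le> d"
    proof (rule ccontr)
      assume "\<not> ?thesis"
      then have "cell_sign L r (Suc (2 * a)) d = 0"
        using mono[of r "Suc (2 * a)"] by (auto simp: cell_sign_def)
      then have "?D d (2 * Suc a) = 1"
        using row_a[of d] D \<open>cell_sign L r (2 * a) d = 1\<close> by simp
      then show False using ex[of "Suc a" d] \<open>a < k\<close> by simp
    qed
    then show ?case using D below[OF D d(1,3) _ d(2)] by simp
  qed
  have q1: "c \<le> q - 1" "q - 1 < q" using pq by auto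
  have q_le: "q \<le> L (Suc (Suc r)) (2 * a)" using right[OF q1] by linarith
  have q_le_above: "q \<le> L r (2 * a')" if "a = Suc a'" for a'
    using even_above[of "q - 1" "2 * a'"] right[OF q1] q1(2) that by simp
  have l: "L r (Suc (2 * a)) \<le> p" "L (Suc (Suc r)) (2 * a + 3) \<le> p" using left[of p] pq by auto
  \<comment> \<open>The bonds \<open>up\<close> and \<open>down_next\<close> fail because the
    neighbouring values are at least \<open>q\<close>, the bonds \<open>down\<close> and
    \<open>up_next\<close> because they are at most \<open>p\<close>.\<close>
  show ?thesis
  proof
    assume "bound L (Suc r, a) node"
    then show False
    proof cases
      case up
      then show False using q_le mono[of "Suc r" "Suc (2 * a)"] pq
        by (auto simp: pair_low_def pair_high_def p_def q_def)
    next
      case down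
      then show False using l(1) mono[of r "2 * a"] pq
        by (auto simp: pair_low_def pair_high_def p_def q_def)
    next
      case up_next
      then show False using l(2) str[of "Suc r" "2 * a"] pq
        by (auto simp: pair_low_def pair_high_def p_def q_def eval_nat_numeral)
    next
      case (down_next a')
      then show False using q_le_above[of a'] str[of r "Suc (2 * a')"] pq
        by (auto simp: pair_low_def pair_high_def p_def q_def eval_nat_numeral)
    qed
  qed
qed

text \<open>Even cuts keep their excess. A violation at an odd cut of the result creates the
  critical situation, whose isolated node was not exchanged, so \<open>L\<close> itself was violated
  there.\<close>

lemma lattice_flip:
  assumes L: "L \<in> shuffles m mu la" and z: "\<forall>b\<ge>2 * k. la b = 0" and lat: "lattice (2 * k) L"
  shows "lattice (2 * k) (flip (flip_set m mu la L) L)"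
proof -
  let ?S = "flip_set m mu la L"
  define K where "K = flip ?S L"
  have K: "K \<in> shuffles m (sort_pairs mu) (sort_pairs la)"
    unfolding K_def by (rule flip_in_shuffles[OF L])
  have zK: "\<forall>b\<ge>2 * k. sort_pairs la b = 0"
    using z by (auto simp: sort_pairs_def)
  have LK: "L = flip ?S K" by (simp add: K_def)
  have even_cut: "excess (2 * k) K r (reading_cut c (2 * j)) \<le> 0" if "j \<le> k" for r c j
    using lat that by (simp add: K_def excess_flip lattice_def)
  have odd_cut: "excess (2 * k) K r (reading_cut c (Suc (2 * a))) \<le> 0" if "a < k" for r c a
  proof (rule ccontr)
    assume pos: "\<not> ?thesis"
    have s: "excess (2 * k) K r (reading_cut c (Suc (2 * a)))
        = excess (2 * k) K r (reading_cut c (2 * a)) + cell_sign K r (2 * a) c"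
      "excess (2 * k) K r (reading_cut c (2 * Suc a))
        = excess (2 * k) K r (reading_cut c (Suc (2 * a))) + cell_sign K r (Suc (2 * a)) c"
      using excess_step[OF K, of "2 * a" "2 * k" r c] excess_step[OF K, of "Suc (2 * a)" "2 * k" r c] that by auto
    have "excess (2 * k) K r (reading_cut c (2 * a)) \<le> 0" "excess (2 * k) K r (reading_cut c (2 * Suc a)) \<le> 0"
      using even_cut[of a] even_cut[of "Suc a"] that by auto
    moreover have "cell_sign K r (2 * a) c \<le> 1" "- 1 \<le> cell_sign K r (Suc (2 * a)) c"
      by (simp_all add: cell_sign_def)
    ultimately have tight: "excess (2 * k) K r (reading_cut c (2 * a)) = 0"
      and "cell_sign K r (2 * a) c = 1" "cell_sign K r (Suc (2 * a)) c = - 1"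
      using s pos by linarith+
    then have B: "K (Suc r) (2 * a) \<le> c" "c < K (Suc (Suc r)) (2 * a)"
      and A: "K r (Suc (2 * a)) \<le> c" "c < K (Suc r) (Suc (2 * a))"
      by (auto simp: cell_sign_def of_bool_def split: if_splits)
    have "(Suc r, a) \<notin> ?S"
    proof
      assume "(Suc r, a) \<in> ?S"
      then obtain p where p: "p \<in> inverted_boundary m mu la" "(bound L)\<^sup>*\<^sup>* p (Suc r, a)"
        by (auto simp: flip_set_def)
      have "\<not> bound L p' (Suc r, a)" for p'
        using critical_not_bound[OF K zK that even_cut tight B A, of p'] bound_sym[of L p' "(Suc r, a)"]
        by (auto simp: K_def)
      then have "p = (Suc r, a)" using p(2) by (auto elim: rtranclp.cases)
      \<comment> \<open>An isolated node is reached only from itself and would have to be a boundary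
        node. It is not in layer 0, and from layer \<open>m\<close> on no \<open>Suc r\<close> is
        left to be placed.\<close>
      then have "m \<le> Suc r" using p(1) by (auto simp: inverted_boundary_def)
      then have "K (Suc r) = K (Suc (Suc r))" using shufflesD(2)[OF K] by simp
      then show False using B by simp
    qed
    then have "L (Suc r) (2 * a) \<le> c" using B by (simp add: K_def flip_def)
    \<comment> \<open>The next layer may have been exchanged, but both of its values exceed
      \<open>c\<close>.\<close>
    moreover have "c < pair_low K (Suc (Suc r)) a"
      using B A shufflesD(3)[OF K, of "Suc r" "Suc (2 * a)"] by (simp add: pair_low_def)
    then have "c < L (Suc (Suc r)) (2 * a)" by (simp add: K_def pair_low_def)
    ultimately have "cell_sign L r (2 * a) c = 1"
      using shufflesD(3)[OF L, of r "2 * a"] by (auto simp: cell_sign_def)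
    then have "excess (2 * k) L r (reading_cut c (Suc (2 * a))) = 1"
      using excess_step[OF L, of "2 * a" "2 * k" r c] that tight by (simp add: K_def excess_flip)
    moreover have "Suc (2 * a) \<le> 2 * k" using that by simp
    ultimately show False using lat unfolding lattice_def by (metis not_one_le_zero zero_less_one not_le)
  qed
  have "excess (2 * k) K r (reading_cut c j) \<le> 0" if "j \<le> 2 * k" for r c j
  proof (cases "even j")
    case True
    then show ?thesis using even_cut that by (auto elim!: evenE)
  next
    case False
    then show ?thesis using odd_cut that by (auto elim!: oddE)
  qed
  then show ?thesis by (simp add: lattice_def K_def)
qed

text \<open>The flip set is computed from the original boundary and unordered pairs, so repeating
  the map undoes it.\<close>

theorem card_lattice_le_sort_pairs:
  assumes z: "\<forall>b\<ge>2 * k. la b = 0"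
  shows "card {L\<in>shuffles m mu la. lattice (2 * k) L \<and> weight (2 * k) L = w}
    \<le> card {L\<in>shuffles m (sort_pairs mu) (sort_pairs la). lattice (2 * k) L \<and> weight (2 * k) L = w}"
proof (rule card_inj_on_le)
  let ?f = "\<lambda>L. flip (flip_set m mu la L) L"
  show "inj_on ?f {L\<in>shuffles m mu la. lattice (2 * k) L \<and> weight (2 * k) L = w}"
    by (rule inj_on_inverseI[where g = ?f]) simp
  show "?f ` {L\<in>shuffles m mu la. lattice (2 * k) L \<and> weight (2 * k) L = w}
    \<subseteq> {L\<in>shuffles m (sort_pairs mu) (sort_pairs la). lattice (2 * k) L \<and> weight (2 * k) L = w}"
    using lattice_flip[OF _ z] flip_in_shuffles by (auto simp: weight_flip[OF _ flip_in_shuffles])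
  have "finite (shuffles m (sort_pairs mu) (sort_pairs la))"
    by (rule finite_shuffles[of "2 * k"]) (use z in \<open>auto simp: sort_pairs_def\<close>)
  then show "finite {L\<in>shuffles m (sort_pairs mu) (sort_pairs la). lattice (2 * k) L \<and> weight (2 * k) L = w}"
    by simp
qed

section \<open>Jacobi--Trudi minors as sums over chains\<close>

lift_definition monom_ms :: "nat multiset \<Rightarrow> 'a::comm_ring_1 mseries"
  is "\<lambda>N M. if M = N then 1 else 0" .

lift_definition trunc_ms :: "nat \<Rightarrow> 'a::comm_ring_1 mseries \<Rightarrow> 'a mseries"
  is "\<lambda>m f M. if set_mset M \<subseteq> {..<m} then f M else 0" .

lemma coeff_ms_mult: "coeff_ms (f * g) M = (\<Sum>N | N \<subseteq># M. coeff_ms f N * coeff_ms g (M - N))"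
  by transfer simp

lemma coeff_ms_add: "coeff_ms (f + g) M = coeff_ms f M + coeff_ms g M"
  by transfer simp

lemma coeff_ms_diff: "coeff_ms (f - g) M = coeff_ms f M - coeff_ms g M"
  by transfer simp

lemma coeff_ms_uminus: "coeff_ms (- f) M = - coeff_ms f M"
  by transfer simp

lemma coeff_ms_zero: "coeff_ms 0 M = 0"
  by transfer simp

lemma coeff_ms_sum: "coeff_ms (sum f A) M = (\<Sum>x\<in>A. coeff_ms (f x) M)"
  by (induction A rule: infinite_finite_induct) (simp_all add: coeff_ms_zero coeff_ms_add)

lemma coeff_monom_mult:
  "coeff_ms (monom_ms N * f) M = (if N \<subseteq># M then coeff_ms f (M - N) else 0)"
proof -
  have "coeff_ms (monom_ms N * f) M = (\<Sum>N' | N' \<subseteq># M. if N' = N then coeff_ms f (M - N) else 0)"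
    unfolding coeff_ms_mult by (rule sum.cong) (auto simp: monom_ms.rep_eq)
  then show ?thesis by (simp add: finite_submsets)
qed

lemma monom_mult: "monom_ms N * monom_ms N' = (monom_ms (N + N') :: 'a::comm_ring_1 mseries)"
proof (rule mseries_eqI)
  fix M
  have "N \<subseteq># M \<and> M - N = N' \<longleftrightarrow> M = N + N'"
    by (metis add_diff_cancel_left' mset_subset_eq_add_left subset_mset.add_diff_inverse)
  then show "coeff_ms (monom_ms N * monom_ms N' :: 'a mseries) M = coeff_ms (monom_ms (N + N')) M"
    unfolding coeff_monom_mult by (auto simp: monom_ms.rep_eq)
qed

lemma monom_zero: "monom_ms {#} = 1"
  by transfer auto

lemma monom_prod: "(\<Prod>i\<in>A. monom_ms (f i)) = monom_ms (\<Sum>i\<in>A. f i)"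
  by (induction A rule: infinite_finite_induct) (simp_all add: monom_zero monom_mult)

lemma comm_ring_hom_trunc: "comm_ring_hom (trunc_ms m)"
proof
  fix f g :: "'a mseries"
  show "trunc_ms m (f * g) = trunc_ms m f * trunc_ms m g"
  proof (rule mseries_eqI)
    fix M
    show "coeff_ms (trunc_ms m (f * g)) M = coeff_ms (trunc_ms m f * trunc_ms m g) M"
    proof (cases "set_mset M \<subseteq> {..<m}")
      case True
      have "set_mset N \<subseteq> {..<m} \<and> set_mset (M - N) \<subseteq> {..<m}" if "N \<subseteq># M" for N
        using True that by (meson in_diffD mset_subset_eqD subset_iff)
      then show ?thesis using True unfolding coeff_ms_mult trunc_ms.rep_eq by (auto intro: sum.cong)
    next
      case False
      then obtain x where x: "x \<in># M" "x \<notin> {..<m}" by auto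
      have "coeff_ms (trunc_ms m f) N * coeff_ms (trunc_ms m g) (M - N) = 0" if "N \<subseteq># M" for N
      proof -
        have "x \<in># N \<or> x \<in># M - N" using x(1) that
          by (metis subset_mset.add_diff_inverse union_iff)
        then show ?thesis using x(2) by (auto simp: trunc_ms.rep_eq)
      qed
      then show ?thesis using False unfolding coeff_ms_mult by (simp add: trunc_ms.rep_eq)
    qed
  qed
qed (transfer; auto)+

definition trunc_h :: "nat \<Rightarrow> int \<Rightarrow> int mseries" where
  "trunc_h m k = trunc_ms m (complete_h k)"

definition jt_minor :: "nat \<Rightarrow> nat \<Rightarrow> (nat \<Rightarrow> nat) \<Rightarrow> (nat \<Rightarrow> nat) \<Rightarrow> int mseries" where
  "jt_minor k m beta alpha = det (mat k k (\<lambda>(i, j). trunc_h m (int (alpha i) - int (beta j))))"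

lemma coeff_trunc_h: "coeff_ms (trunc_h m k) M = of_bool (set_mset M \<subseteq> {..<m} \<and> int (size M) = k)"
  by (simp add: trunc_h_def trunc_ms.rep_eq complete_h.rep_eq)

lemma trunc_h_0: "trunc_h 0 k = of_bool (k = 0)"
  by (rule mseries_eqI) (auto simp: coeff_trunc_h one_mseries.rep_eq coeff_ms_zero)

lemma trunc_h_Suc_rec:
  "trunc_h (Suc m) (k + 1) = trunc_h m (k + 1) + monom_ms {#m#} * trunc_h (Suc m) k"
proof (rule mseries_eqI)
  fix M :: "nat multiset"
  show "coeff_ms (trunc_h (Suc m) (k + 1)) M = coeff_ms (trunc_h m (k + 1) + monom_ms {#m#} * trunc_h (Suc m) k) M"
  proof (cases "m \<in># M")
    case True
    then obtain N where M: "M = add_mset m N" by (meson mset_add)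
    show ?thesis by (simp add: M coeff_ms_add coeff_monom_mult coeff_trunc_h)
  next
    case False
    then have "set_mset M \<subseteq> {..<Suc m} \<longleftrightarrow> set_mset M \<subseteq> {..<m}"
      by (auto simp: subset_iff less_Suc_eq)
    with False show ?thesis by (simp add: coeff_ms_add coeff_monom_mult coeff_trunc_h)
  qed
qed

text \<open>Here \<open>g\<close> is what remains of \<open>a\<close> after a power of the last
  variable is split off. Terms with \<open>g < b\<close> vanish; including them makes the range the
  same in all columns, as the row expansion of a determinant requires.\<close>

lemma trunc_h_Suc:
  "trunc_h (Suc m) (int a - int b) =
    (\<Sum>g\<le>a. monom_ms (replicate_mset (a - g) m) * trunc_h m (int g - int b))"
proof (induction a)
  case 0
  have "trunc_h (Suc m) (- int b) = trunc_h m (- int b)"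
  proof (rule mseries_eqI)
    fix M show "coeff_ms (trunc_h (Suc m) (- int b)) M = coeff_ms (trunc_h m (- int b)) M"
      by (cases M) (auto simp: coeff_trunc_h)
  qed
  then show ?case by (simp add: monom_zero)
next
  case (Suc a)
  have "monom_ms (replicate_mset (Suc a - g) m) = monom_ms {#m#} * (monom_ms (replicate_mset (a - g) m) :: int mseries)"
    if "g \<le> a" for g
    using that by (simp add: monom_mult Suc_diff_le)
  then have "(\<Sum>g\<le>a. monom_ms (replicate_mset (Suc a - g) m) * trunc_h m (int g - int b))
      = monom_ms {#m#} * trunc_h (Suc m) (int a - int b)"
    by (simp add: Suc sum_distrib_left mult.assoc)
  then show ?case
    using trunc_h_Suc_rec[of m "int a - int b"] by (simp add: monom_zero algebra_simps)
qed

section \<open>Row expansion and interlacing\<close>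

lemma det_mat_Leibniz:
  "det (mat k k (\<lambda>(i, j). F i j)) = (\<Sum>p | p permutes {..<k}. signof p * (\<Prod>i<k. F i (p i)))"
proof -
  have "det (mat k k (\<lambda>(i, j). F i j))
      = (\<Sum>p | p permutes {..<k}. signof p * (\<Prod>i<k. mat k k (\<lambda>(i, j). F i j) $$ (i, p i)))"
    using det_def'[of "mat k k (\<lambda>(i, j). F i j)" k] by (simp add: atLeast0LessThan)
  also have "\<dots> = (\<Sum>p | p permutes {..<k}. signof p * (\<Prod>i<k. F i (p i)))"
  proof (intro sum.cong prod.cong arg_cong2[where f = "(*)"] refl)
    fix p i assume "p \<in> {p. p permutes {..<k}}" "i \<in> {..<k}"
    then have "i < k" "p i < k" using permutes_in_image[of p "{..<k}" i] by auto
    then show "mat k k (\<lambda>(i, j). F i j) $$ (i, p i) = F i (p i)" by simp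
  qed
  finally show ?thesis .
qed

lemma det_mat_sum_rows:
  fixes f :: "nat \<Rightarrow> nat \<Rightarrow> 'a::comm_ring_1" and alpha :: "nat \<Rightarrow> nat"
  assumes alpha: "\<And>i. k \<le> i \<Longrightarrow> alpha i = 0"
  shows "det (mat k k (\<lambda>(i, j). \<Sum>g\<le>alpha i. c i g * f g j))
    = (\<Sum>g | \<forall>i. g i \<le> alpha i. (\<Prod>i<k. c i (g i)) * det (mat k k (\<lambda>(i, j). f (g i) j)))"
proof -
  let ?P = "{p. p permutes {..<k}}"
  let ?B = "PiE {..<k} (\<lambda>i. {..alpha i})"
  let ?G = "{g. \<forall>i. g i \<le> alpha i}"
  let ?t = "\<lambda>g. \<Sum>p\<in>?P. signof p * (\<Prod>i<k. c i (g i) * f (g i) (p i))"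
  have "det (mat k k (\<lambda>(i, j). \<Sum>g\<le>alpha i. c i g * f g j))
      = (\<Sum>p\<in>?P. signof p * (\<Prod>i<k. \<Sum>g\<le>alpha i. c i g * f g (p i)))"
    by (rule det_mat_Leibniz)
  also have "\<dots> = (\<Sum>p\<in>?P. \<Sum>g\<in>?B. signof p * (\<Prod>i<k. c i (g i) * f (g i) (p i)))"
    by (simp only: prod_sum_PiE finite_lessThan finite_atMost sum_distrib_left)
  also have "\<dots> = sum ?t ?B" by (rule sum.swap)
  also have "\<dots> = sum ?t ?G"
  proof (rule sum.reindex_bij_witness[where i = "\<lambda>g. restrict g {..<k}" and j = "\<lambda>g i. if i < k then g i else 0"])
    fix g assume g: "g \<in> ?B"
    then show "restrict (\<lambda>i. if i < k then g i else 0) {..<k} = g"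
      using PiE_arb[OF g] by (intro ext) simp
    show "(\<lambda>i. if i < k then g i else 0) \<in> ?G"
      using g by (simp add: PiE_iff)
    show "?t (\<lambda>i. if i < k then g i else 0) = ?t g"
      by (intro sum.cong refl arg_cong2[where f = "(*)"] prod.cong) simp_all
  next
    fix g assume g: "g \<in> ?G"
    have "g i = 0" if "k \<le> i" for i using g alpha[OF that] by (metis le_zero_eq mem_Collect_eq)
    then show "(\<lambda>i. if i < k then restrict g {..<k} i else 0) = g" by (intro ext) simp
    show "restrict g {..<k} \<in> ?B" using g by (simp add: PiE_iff)
  qed
  also have "\<dots> = (\<Sum>g\<in>?G. (\<Prod>i<k. c i (g i)) * det (mat k k (\<lambda>(i, j). f (g i) j)))"
    unfolding det_mat_Leibniz sum_distrib_left prod.distrib by (simp add: mult_ac)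
  finally show ?thesis .
qed

lemma finite_pointwise_le:
  fixes alpha :: "nat \<Rightarrow> nat"
  assumes alpha: "\<And>i. k \<le> i \<Longrightarrow> alpha i = 0"
  shows "finite {g. \<forall>i. g i \<le> alpha i}"
proof (rule finite_subset)
  show "{g. \<forall>i. g i \<le> alpha i} \<subseteq> {g. \<forall>i. (i \<in> {..<k} \<longrightarrow> g i \<in> {..sum alpha {..<k}}) \<and> (i \<notin> {..<k} \<longrightarrow> g i = 0)}"
  proof (intro subsetI CollectI allI conjI impI)
    fix g i assume g: "g \<in> {g. \<forall>i. g i \<le> alpha i}"
    show "g i \<in> {..sum alpha {..<k}}" if "i \<in> {..<k}"
      using g member_le_sum[of i "{..<k}" alpha] that by (auto intro: order_trans)
    show "g i = 0" if "i \<notin> {..<k}" using g alpha[of i] that by (metis le_zero_eq lessThan_iff mem_Collect_eq not_less)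
  qed
  show "finite {g. \<forall>i. (i \<in> {..<k} \<longrightarrow> g i \<in> {..sum alpha {..<k}}) \<and> (i \<notin> {..<k} \<longrightarrow> g i = (0::nat))}"
    by (rule finite_set_of_finite_funs) auto
qed

definition interlaced :: "nat \<Rightarrow> (nat \<Rightarrow> nat) \<Rightarrow> (nat \<Rightarrow> nat) set" where
  "interlaced k alpha = {g. (\<forall>i. g i \<le> alpha i) \<and> (\<forall>i. Suc i < k \<longrightarrow> alpha (Suc i) < g i)}"

lemma jt_minor_swap:
  assumes "Suc i < k"
  shows "jt_minor k m beta (g \<circ> transpose i (Suc i)) = - jt_minor k m beta g"
proof -
  let ?A = "mat k k (\<lambda>(i, j). trunc_h m (int (g i) - int (beta j)))"
  have p: "transpose i (Suc i) permutes {0..<k}" using assms by (intro permutes_swap_id) auto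
  have "mat k k (\<lambda>(i', j). trunc_h m (int ((g \<circ> transpose i (Suc i)) i') - int (beta j)))
      = mat k k (\<lambda>(i', j). ?A $$ (transpose i (Suc i) i', j))"
    by (rule eq_matI) (use permutes_in_image[OF p] in auto)
  then show ?thesis
    unfolding jt_minor_def using det_permute_rows[of ?A k, OF _ p]
    by (simp add: sign_swap_id)
qed

lemma mseries_eq_uminus_self:
  fixes f :: "int mseries"
  assumes "f = - f"
  shows "f = 0"
proof (rule mseries_eqI)
  fix M
  have "coeff_ms f M = - coeff_ms f M" using assms coeff_ms_uminus by metis
  then show "coeff_ms f M = coeff_ms 0 M" by (simp add: coeff_ms_zero)
qed

text \<open>
  Splitting off the last variable expands every row. If \<open>g\<close> is not interlaced, take the first \<open>i\<close> with
  \<open>g i \<le> alpha (Suc i)\<close>: exchanging \<open>g i\<close> and \<open>g (Suc i)\<close> gives a term that cancels this one.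
\<close>

lemma jt_minor_Suc:
  assumes alpha: "\<And>i. k \<le> i \<Longrightarrow> alpha i = 0" and dec: "\<And>i. Suc i < k \<Longrightarrow> alpha (Suc i) \<le> alpha i"
  shows "jt_minor k (Suc m) beta alpha
    = (\<Sum>g\<in>interlaced k alpha. monom_ms (replicate_mset (\<Sum>i<k. alpha i - g i) m) * jt_minor k m beta g)"
proof -
  let ?G = "{g. \<forall>i. g i \<le> alpha i}"
  let ?t = "\<lambda>g. monom_ms (replicate_mset (\<Sum>i<k. alpha i - g i) m) * jt_minor k m beta g"
  let ?bad = "{g\<in>?G. \<exists>i. Suc i < k \<and> g i \<le> alpha (Suc i)}"
  have fin: "finite ?G" by (rule finite_pointwise_le[OF alpha])
  have rep: "(\<Sum>i<k. replicate_mset (alpha i - g i) m) = replicate_mset (\<Sum>i<k. alpha i - g i) m" for g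
    by (rule multiset_eqI) (auto simp: count_sum)
  have "jt_minor k (Suc m) beta alpha = sum ?t ?G"
    unfolding jt_minor_def trunc_h_Suc by (subst det_mat_sum_rows[OF alpha]) (simp_all add: monom_prod rep)
  also have "\<dots> = sum ?t (interlaced k alpha) + sum ?t ?bad"
  proof -
    have "?G = interlaced k alpha \<union> ?bad" "interlaced k alpha \<inter> ?bad = {}"
      by (auto simp: interlaced_def not_le)
    then show ?thesis using fin by (metis (no_types, lifting) finite_Un sum.union_disjoint)
  qed
  also have "sum ?t ?bad = 0"
  proof (rule mseries_eq_uminus_self)
    define v where "v g = (LEAST i. Suc i < k \<and> g i \<le> alpha (Suc i))" for g
    define \<phi> where "\<phi> g = g \<circ> transpose (v g) (Suc (v g))" for g
    have step: "\<phi> g \<in> ?bad \<and> \<phi> (\<phi> g) = g \<and> ?t (\<phi> g) = - ?t g" if g: "g \<in> ?bad" for g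
    proof -
      let ?i = "v g"
      have i: "Suc ?i < k" "g ?i \<le> alpha (Suc ?i)"
        using g LeastI_ex[of "\<lambda>i. Suc i < k \<and> g i \<le> alpha (Suc i)"] unfolding v_def by auto
      have before: "\<not> (Suc j < k \<and> g j \<le> alpha (Suc j))" if "j < ?i" for j
        using not_less_Least that unfolding v_def by blast
      have le: "g j \<le> alpha j" for j using g by auto
      have G: "\<phi> g j \<le> alpha j" for j
        using le[of j] le[of "Suc ?i"] i dec[OF i(1)] by (auto simp: \<phi>_def transpose_def intro: order_trans)
      \<comment> \<open>The swap does not touch earlier entries, and both swapped entries are at
        most \<open>alpha (Suc ?i)\<close>, so the first bad index stays the same.\<close>
      have v: "v (\<phi> g) = ?i"
        unfolding v_def[of "\<phi> g"]
      proof (rule Least_equality)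
        show "Suc ?i < k \<and> \<phi> g ?i \<le> alpha (Suc ?i)"
          using i le[of "Suc ?i"] by (simp add: \<phi>_def)
        fix j assume j: "Suc j < k \<and> \<phi> g j \<le> alpha (Suc j)"
        show "?i \<le> j"
        proof (rule ccontr)
          assume "\<not> ?i \<le> j"
          then show False using before[of j] j by (simp add: \<phi>_def)
        qed
      qed
      have "(\<Sum>i<k. \<phi> g i) = (\<Sum>i<k. g i)"
        using sum.permute[of "transpose ?i (Suc ?i)" "{..<k}" g] i
        by (simp add: \<phi>_def permutes_swap_id)
      moreover have "(\<Sum>i<k. alpha i - h i) = (\<Sum>i<k. alpha i) - (\<Sum>i<k. h i)" if "\<And>i. h i \<le> alpha i" for h
        using that by (simp add: sum_subtractf_nat)
      ultimately have "?t (\<phi> g) = - ?t g"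
        using le G jt_minor_swap[OF i(1), of m beta g] by (simp add: \<phi>_def[symmetric])
      moreover have "\<phi> (\<phi> g) = g"
        by (simp add: \<phi>_def[of "\<phi> g"] v) (simp add: \<phi>_def comp_assoc)
      moreover have "\<phi> g \<in> ?bad"
        using G i le[of "Suc ?i"] by (auto simp: \<phi>_def intro!: exI[of _ ?i])
      ultimately show ?thesis by simp
    qed
    have "sum ?t ?bad = (\<Sum>g\<in>?bad. ?t (\<phi> g))"
      by (rule sum.reindex_bij_witness[where i = \<phi> and j = \<phi>]) (use step in simp_all)
    also have "\<dots> = (\<Sum>g\<in>?bad. - ?t g)" by (rule sum.cong) (use step in simp_all)
    finally show "sum ?t ?bad = - sum ?t ?bad" by (simp add: sum_negf)
  qed
  finally show ?thesis by simp
qed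

text \<open>Skew Gelfand-Tsetlin patterns. As a chain is constant from \<open>m\<close> on, the last
  condition forces \<open>alpha\<close> to decrease strictly below \<open>k\<close>: for repeated
  values there is no chain, matching equal rows of the determinant.\<close>

definition chains :: "nat \<Rightarrow> nat \<Rightarrow> (nat \<Rightarrow> nat) \<Rightarrow> (nat \<Rightarrow> nat) \<Rightarrow> (nat \<Rightarrow> nat \<Rightarrow> nat) set" where
  "chains k m beta alpha = {p. p 0 = beta \<and> (\<forall>t\<ge>m. p t = alpha) \<and> (\<forall>t i. p t i \<le> p (Suc t) i) \<and>
     (\<forall>t i. Suc i < k \<longrightarrow> p (Suc t) (Suc i) < p t i)}"

definition chain_content :: "nat \<Rightarrow> nat \<Rightarrow> (nat \<Rightarrow> nat \<Rightarrow> nat) \<Rightarrow> nat multiset" where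
  "chain_content k m p = (\<Sum>t<m. replicate_mset (\<Sum>i<k. p (Suc t) i - p t i) t)"

text \<open>Without variables only degree zero survives. A nonzero Leibniz term makes
  \<open>g\<close> a rearrangement of \<open>beta\<close>, and since \<open>g\<close> decreases
  strictly and \<open>beta\<close> weakly, the rearrangement is the identity.\<close>

lemma jt_minor_0:
  assumes zero: "\<And>i. k \<le> i \<Longrightarrow> g i = 0" "\<And>i. k \<le> i \<Longrightarrow> beta i = 0"
    and g: "\<And>i. Suc i < k \<Longrightarrow> g (Suc i) < g i" and beta: "\<And>i. Suc i < k \<Longrightarrow> beta (Suc i) \<le> beta i"
  shows "jt_minor k 0 beta g = of_bool (g = beta)"
proof (cases "g = beta")
  case True
  have less: "g j < g i" if "i < j" "j < k" for i j
    using that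
  proof (induction j)
    case (Suc j)
    then show ?case using g[of j] by (cases "i = j") auto
  qed simp
  have "mat k k (\<lambda>(i, j). trunc_h 0 (int (g i) - int (g j))) = 1\<^sub>m k"
  proof (rule eq_matI)
    fix i j assume "i < dim_row (1\<^sub>m k)" "j < dim_col (1\<^sub>m k)"
    then show "mat k k (\<lambda>(i, j). trunc_h 0 (int (g i) - int (g j))) $$ (i, j) = 1\<^sub>m k $$ (i, j)"
      using less[of i j] less[of j i] by (cases i j rule: linorder_cases) (auto simp: trunc_h_0)
  qed auto
  then show ?thesis by (simp add: jt_minor_def True[symmetric])
next
  case False
  have "(\<Prod>i<k. trunc_h 0 (int (g i) - int (beta (p i)))) = 0" if p: "p permutes {..<k}" for p
  proof (rule ccontr)
    assume "\<not> ?thesis"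
    then have nz: "trunc_h 0 (int (g i) - int (beta (p i))) \<noteq> 0" if "i < k" for i
      using that by (metis finite_lessThan lessThan_iff prod_zero)
    have eq: "g i = beta (p i)" if "i < k" for i
      using nz[OF that] by (auto simp: trunc_h_0)
    have "p i < p (Suc i)" if "Suc i < k" for i
    proof (rule ccontr)
      assume "\<not> ?thesis"
      moreover have "p i < k" using permutes_in_image[OF p, of i] that by auto
      ultimately have "beta (p i) \<le> beta (p (Suc i))"
        using antimono_from_steps[of k beta "p (Suc i)" "p i"] beta by auto
      then show False using g[OF that] eq[of i] eq[of "Suc i"] that by simp
    qed
    then have "p = id" by (rule permutes_strict_mono_id[OF p])
    then have "g i = beta i" for i using eq[of i] zero[of i] by (cases "i < k") auto
    then show False using False by (simp add: fun_eq_iff)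
  qed
  then show ?thesis
    using False by (simp add: jt_minor_def det_mat_Leibniz)
qed

lemma bij_betw_chains_Suc:
  "bij_betw (\<lambda>p. (p m, \<lambda>t. p (min t m))) (chains k (Suc m) beta alpha)
    (SIGMA g:interlaced k alpha. chains k m beta g)"
proof (rule bij_betw_byWitness[where f' = "\<lambda>(g, p) t. if t \<le> m then p t else alpha"])
  show "\<forall>p\<in>chains k (Suc m) beta alpha.
      (case (p m, \<lambda>t. p (min t m)) of (g, p) \<Rightarrow> \<lambda>t. if t \<le> m then p t else alpha) = p"
    by (auto simp: chains_def fun_eq_iff min_def)
  show "\<forall>gp\<in>SIGMA g:interlaced k alpha. chains k m beta g.
      ((case gp of (g, p) \<Rightarrow> \<lambda>t. if t \<le> m then p t else alpha) m,
       \<lambda>t. (case gp of (g, p) \<Rightarrow> \<lambda>t. if t \<le> m then p t else alpha) (min t m)) = gp"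
    by (auto simp: chains_def fun_eq_iff min_def)
  show "(\<lambda>p. (p m, \<lambda>t. p (min t m))) ` chains k (Suc m) beta alpha \<subseteq> (SIGMA g:interlaced k alpha. chains k m beta g)"
  proof (rule image_subsetI)
    fix p assume "p \<in> chains k (Suc m) beta alpha"
    then have p: "p 0 = beta" "p (Suc m) = alpha" "p t i \<le> p (Suc t) i"
      "Suc i < k \<Longrightarrow> p (Suc t) (Suc i) < p t i" for t i
      by (auto simp: chains_def)
    have "p m \<in> interlaced k alpha"
      using p(3)[of m] p(4)[of _ m] by (auto simp: interlaced_def p(2))
    moreover have "(\<lambda>t. p (min t m)) \<in> chains k m beta (p m)"
      unfolding chains_def
    proof (intro CollectI conjI allI impI)
      fix t i
      show "p (min t m) i \<le> p (min (Suc t) m) i" using p(3)[of t i] by (cases "t < m") (simp_all add: min_def)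
      show "p (min (Suc t) m) (Suc i) < p (min t m) i" if "Suc i < k"
      proof (cases "t < m")
        case True
        then show ?thesis using p(4)[OF that] by (simp add: min_def)
      next
        case False
        then show ?thesis using p(4)[OF that, of m] p(3)[of m "Suc i"] by (simp add: min_def)
      qed
    qed (auto simp: p min_def)
    ultimately show "(p m, \<lambda>t. p (min t m)) \<in> (SIGMA g:interlaced k alpha. chains k m beta g)" by simp
  qed
  show "(\<lambda>(g, p) t. if t \<le> m then p t else alpha) ` (SIGMA g:interlaced k alpha. chains k m beta g)
      \<subseteq> chains k (Suc m) beta alpha"
  proof (rule image_subsetI)
    fix gp assume "gp \<in> (SIGMA g:interlaced k alpha. chains k m beta g)"
    then obtain g p where gp: "gp = (g, p)" and g: "g i \<le> alpha i" "Suc i < k \<Longrightarrow> alpha (Suc i) < g i"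
      and p: "p 0 = beta" "p m = g" "p t i \<le> p (Suc t) i" "Suc i < k \<Longrightarrow> p (Suc t) (Suc i) < p t i" for t i
      by (auto simp: interlaced_def chains_def)
    let ?q = "\<lambda>t. if t \<le> m then p t else alpha"
    have "?q t i \<le> ?q (Suc t) i" for t i
      using p(2) p(3)[of t i] g(1)[of i] by (cases t m rule: linorder_cases) auto
    moreover have "?q (Suc t) (Suc i) < ?q t i" if "Suc i < k" for t i
      using p(2) p(4)[OF that, of t] g(1)[of i] g(2)[OF that] by (cases t m rule: linorder_cases) auto
    ultimately show "(case gp of (g, p) \<Rightarrow> \<lambda>t. if t \<le> m then p t else alpha) \<in> chains k (Suc m) beta alpha"
      by (simp add: gp chains_def p(1))
  qed
qed

lemma finite_interlaced:
  assumes "\<And>i. k \<le> i \<Longrightarrow> alpha i = 0"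
  shows "finite (interlaced k alpha)"
  by (rule finite_subset[OF _ finite_pointwise_le[OF assms]]) (auto simp: interlaced_def)

lemma interlaced_zero:
  assumes "\<And>i. k \<le> i \<Longrightarrow> alpha i = 0" "g \<in> interlaced k alpha" "k \<le> i"
  shows "g i = 0"
  using assms(1)[OF assms(3)] assms(2) by (auto simp: interlaced_def) (metis le_zero_eq)

lemma finite_chains:
  assumes "\<And>i. k \<le> i \<Longrightarrow> alpha i = 0"
  shows "finite (chains k m beta alpha)"
  using assms
proof (induction m arbitrary: alpha)
  case 0
  have "chains k 0 beta alpha \<subseteq> {\<lambda>_. alpha}" by (auto simp: chains_def fun_eq_iff)
  then show ?case by (rule finite_subset) simp
next
  case (Suc m)
  have "finite (SIGMA g:interlaced k alpha. chains k m beta g)"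
    using finite_interlaced[OF Suc.prems] interlaced_zero[OF Suc.prems] by (intro finite_SigmaI Suc.IH)
  then show ?case using bij_betw_finite[OF bij_betw_chains_Suc] by blast
qed

lemma sum_chains_Suc:
  assumes "\<And>i. k \<le> i \<Longrightarrow> alpha i = 0"
  shows "(\<Sum>p\<in>chains k (Suc m) beta alpha. monom_ms (chain_content k (Suc m) p) :: int mseries)
    = (\<Sum>g\<in>interlaced k alpha. monom_ms (replicate_mset (\<Sum>i<k. alpha i - g i) m) *
        (\<Sum>p\<in>chains k m beta g. monom_ms (chain_content k m p)))"
proof -
  have "(\<Sum>g\<in>interlaced k alpha. monom_ms (replicate_mset (\<Sum>i<k. alpha i - g i) m) *
        (\<Sum>p\<in>chains k m beta g. monom_ms (chain_content k m p)) :: int mseries)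
    = (\<Sum>(g, p)\<in>(SIGMA g:interlaced k alpha. chains k m beta g).
        monom_ms (replicate_mset (\<Sum>i<k. alpha i - g i) m + chain_content k m p))"
    using finite_interlaced[OF assms] finite_chains[OF interlaced_zero[OF assms]]
    by (subst sum.Sigma[symmetric]) (auto simp: sum_distrib_left monom_mult)
  also have "\<dots> = (\<Sum>p\<in>chains k (Suc m) beta alpha.
      case (p m, \<lambda>t. p (min t m)) of (g, p) \<Rightarrow>
        monom_ms (replicate_mset (\<Sum>i<k. alpha i - g i) m + chain_content k m p))"
    by (rule sum.reindex_bij_betw[OF bij_betw_chains_Suc, symmetric])
  also have "\<dots> = (\<Sum>p\<in>chains k (Suc m) beta alpha. monom_ms (chain_content k (Suc m) p))"
  proof (rule sum.cong[OF refl])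
    fix p assume "p \<in> chains k (Suc m) beta alpha"
    then have "p (Suc m) = alpha" by (simp add: chains_def)
    then have "chain_content k (Suc m) p = replicate_mset (\<Sum>i<k. alpha i - p m i) m + chain_content k m (\<lambda>t. p (min t m))"
      by (simp add: chain_content_def)
    then show "(case (p m, \<lambda>t. p (min t m)) of (g, p) \<Rightarrow>
        monom_ms (replicate_mset (\<Sum>i<k. alpha i - g i) m + chain_content k m p))
      = (monom_ms (chain_content k (Suc m) p) :: int mseries)" by simp
  qed
  finally show ?thesis ..
qed

lemma jt_minor_strict:
  assumes "\<And>i. k \<le> i \<Longrightarrow> alpha i = 0" "\<And>i. k \<le> i \<Longrightarrow> beta i = 0"
    and "\<And>i. Suc i < k \<Longrightarrow> alpha (Suc i) < alpha i" "\<And>i. Suc i < k \<Longrightarrow> beta (Suc i) \<le> beta i"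
  shows "jt_minor k m beta alpha = (\<Sum>p\<in>chains k m beta alpha. monom_ms (chain_content k m p))"
  using assms(1,3)
proof (induction m arbitrary: alpha)
  case 0
  have "chains k 0 beta alpha = (if alpha = beta then {\<lambda>_. alpha} else {})"
    using 0(2) by (auto simp: chains_def fun_eq_iff)
  moreover have "jt_minor k 0 beta alpha = of_bool (alpha = beta)"
    by (rule jt_minor_0) (use 0 assms in auto)
  ultimately show ?case by (simp add: chain_content_def monom_zero)
next
  case (Suc m)
  have "jt_minor k m beta g = (\<Sum>p\<in>chains k m beta g. monom_ms (chain_content k m p))"
    if g: "g \<in> interlaced k alpha" for g
  proof (rule Suc.IH)
    show "g i = 0" if "k \<le> i" for i by (rule interlaced_zero[OF Suc.prems(1) g that])
    show "g (Suc i) < g i" if "Suc i < k" for i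
      using g that by (auto simp: interlaced_def intro: le_less_trans)
  qed
  then show ?case
    using Suc.prems(2) by (subst jt_minor_Suc[OF Suc.prems(1)]) (simp_all add: sum_chains_Suc[OF Suc.prems(1)] less_imp_le)
qed

text \<open>Now \<open>alpha\<close> may have repeated values. Interlaced sequences are strict all
  the same, so after splitting off one variable the strict case applies; hence
  \<open>Suc m\<close>.\<close>

theorem jt_minor_eq_sum_chains:
  assumes "\<And>i. k \<le> i \<Longrightarrow> alpha i = 0" "\<And>i. k \<le> i \<Longrightarrow> beta i = 0"
    and "\<And>i. Suc i < k \<Longrightarrow> alpha (Suc i) \<le> alpha i" "\<And>i. Suc i < k \<Longrightarrow> beta (Suc i) \<le> beta i"
  shows "jt_minor k (Suc m) beta alpha = (\<Sum>p\<in>chains k (Suc m) beta alpha. monom_ms (chain_content k (Suc m) p))"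
proof -
  have "jt_minor k m beta g = (\<Sum>p\<in>chains k m beta g. monom_ms (chain_content k m p))"
    if g: "g \<in> interlaced k alpha" for g
  proof (rule jt_minor_strict)
    show "g i = 0" if "k \<le> i" for i by (rule interlaced_zero[OF assms(1) g that])
    show "g (Suc i) < g i" if "Suc i < k" for i
      using g that by (auto simp: interlaced_def intro: le_less_trans)
  qed (use assms in auto)
  then show ?thesis
    using assms(3) by (subst jt_minor_Suc[OF assms(1)]) (simp_all add: sum_chains_Suc[OF assms(1)])
qed

section \<open>Products of minors\<close>

lemma shuffles_subset:
  assumes "l \<le> m"
  shows "shuffles l mu la \<subseteq> shuffles m mu la"
  using assms by (auto simp: shuffles_def)

lemma shuffles_shrink:
  assumes L: "L \<in> shuffles m mu la" and z: "\<forall>b\<ge>n. la b = 0"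
    and const: "\<And>t. l \<le> t \<Longrightarrow> weight n L t = 0" and "l \<le> m"
  shows "L \<in> shuffles l mu la"
proof -
  have step: "L (Suc t) = L t" if "l \<le> t" for t
  proof
    fix b
    show "L (Suc t) b = L t b"
    proof (cases "b < n")
      case True
      have "(\<Sum>b<n. L (Suc t) b - L t b) = 0" using const[OF that] by (simp add: weight_def)
      then have "L (Suc t) b - L t b = 0" using True by simp
      then show ?thesis using shufflesD(3)[OF L, of t b] by simp
    next
      case False
      then show ?thesis
        using z shuffles_le_final[OF L, of t b] shuffles_le_final[OF L, of "Suc t" b] by simp
    qed
  qed
  have "L t = L m" if "l \<le> t" "t \<le> m" for t
    using that(2,1) by (induction t rule: inc_induct) (use step in auto)
  then have "L t = la" if "l \<le> t" for t
    using that shufflesD(2)[OF L] by (cases "t \<le> m") auto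
  then show ?thesis using L by (auto simp: shuffles_def)
qed

text \<open>This makes the multiplicities independent of the number of variables: a weight vanishing
  from \<open>l\<close> on means that the outer shape is reached at layer \<open>l\<close>.\<close>

lemma lattice_shuffles_stable:
  assumes z: "\<forall>b\<ge>n. la b = 0" and "length ka \<le> l" "l \<le> m"
  shows "{L\<in>shuffles m mu la. lattice n L \<and> weight n L = part ka}
    = {L\<in>shuffles l mu la. lattice n L \<and> weight n L = part ka}"
proof -
  have "L \<in> shuffles l mu la" if "L \<in> shuffles m mu la" "weight n L = part ka" for L
    by (rule shuffles_shrink[OF that(1) z _ assms(3)]) (use that(2) assms(2) in \<open>simp add: part_def\<close>)
  then show ?thesis using shuffles_subset[OF assms(3)] by blast
qed

text \<open>
  Chains consist of strictly decreasing sequences; adding \<open>i\<close> to the \<open>i\<close>-th entry turns them into row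
  lengths.
\<close>

definition interleave :: "nat \<Rightarrow> (nat \<Rightarrow> nat) \<Rightarrow> (nat \<Rightarrow> nat) \<Rightarrow> nat \<Rightarrow> nat" where
  "interleave k f g b = (if b < 2 * k then (if even b then f else g) (b div 2) + b div 2 else 0)"

lemma interleave_simps:
  "i < k \<Longrightarrow> interleave k f g (2 * i) = f i + i" "i < k \<Longrightarrow> interleave k f g (Suc (2 * i)) = g i + i"
  "2 * k \<le> b \<Longrightarrow> interleave k f g b = 0"
  by (auto simp: interleave_def)

lemma weight_interleave:
  "weight (2 * k) (\<lambda>t. interleave k (q t) (p t)) t = (\<Sum>i<k. q (Suc t) i - q t i) + (\<Sum>i<k. p (Suc t) i - p t i)"
  unfolding weight_def sum_pairs sum.distrib[symmetric]
  by (rule sum.cong) (simp_all add: interleave_simps)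

lemma interleave_in_shuffles:
  assumes p: "p \<in> chains k m beta alpha" and q: "q \<in> chains k m beta' alpha'"
  shows "(\<lambda>t. interleave k (q t) (p t)) \<in> shuffles m (interleave k beta' beta) (interleave k alpha' alpha)"
proof -
  have "interleave k (q t) (p t) b \<le> interleave k (q (Suc t)) (p (Suc t)) b" for t b
    using p q by (auto simp: interleave_def chains_def)
  moreover have "interleave k (q (Suc t)) (p (Suc t)) (Suc (Suc b)) \<le> interleave k (q t) (p t) b" for t b
  proof (cases "Suc (b div 2) < k")
    case True
    then have "q (Suc t) (Suc (b div 2)) < q t (b div 2)" "p (Suc t) (Suc (b div 2)) < p t (b div 2)"
      using p q by (auto simp: chains_def)
    then show ?thesis by (simp add: interleave_def)
  next
    case False
    then show ?thesis by (auto simp: interleave_def)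
  qed
  ultimately show ?thesis using p q by (simp add: shuffles_def chains_def)
qed

lemma bij_betw_interleave:
  assumes alpha: "\<And>i. k \<le> i \<Longrightarrow> alpha i = 0" and alpha': "\<And>i. k \<le> i \<Longrightarrow> alpha' i = 0"
    and beta: "\<And>i. k \<le> i \<Longrightarrow> beta i = 0" and beta': "\<And>i. k \<le> i \<Longrightarrow> beta' i = 0"
  shows "bij_betw (\<lambda>(p, q) t. interleave k (q t) (p t)) (chains k m beta alpha \<times> chains k m beta' alpha')
    (shuffles m (interleave k beta' beta) (interleave k alpha' alpha))"
proof -
  define row where "row e L t i = (if i < k then L t (2 * i + e) - i else 0)" for e and L :: "nat \<Rightarrow> nat \<Rightarrow> nat" and t i
  let ?S = "shuffles m (interleave k beta' beta) (interleave k alpha' alpha)"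
  have chain_zero: "p t i = 0" if "p \<in> chains k m b a" "\<And>i. k \<le> i \<Longrightarrow> a i = 0" "k \<le> i" for p b a t i
  proof -
    have "p t i \<le> p (Suc t) i" for t using that(1) by (simp add: chains_def)
    then have "p t i \<le> p (max t m) i" by (rule lift_Suc_mono_le) simp
    also have "p (max t m) = a" using that(1) unfolding chains_def by (blast intro: max.cobounded2)
    finally show ?thesis using that(2)[OF that(3)] by simp
  qed
  \<comment> \<open>The shift by \<open>i\<close> can be undone by truncated subtraction, since the
    inner shape already reaches column \<open>i\<close> in that row.\<close>
  have ge: "i \<le> L t (2 * i + e)" if L: "L \<in> ?S" and "i < k" and e: "e = 0 \<or> e = 1" for L t i e
  proof -
    have "i \<le> interleave k beta' beta (2 * i + e)"
      using e \<open>i < k\<close> by (elim disjE) (simp_all add: interleave_simps)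
    also have "\<dots> \<le> L t (2 * i + e)"
      using shuffles_mono[OF L, of 0 t "2 * i + e"] shufflesD(1)[OF L] by simp
    finally show ?thesis .
  qed
  have row_chain: "row e L \<in> chains k m b a"
    if L: "L \<in> ?S" and e: "e = 0 \<or> e = 1"
      and "\<And>i. i < k \<Longrightarrow> interleave k beta' beta (2 * i + e) = b i + i" "\<And>i. k \<le> i \<Longrightarrow> b i = 0"
      and "\<And>i. i < k \<Longrightarrow> interleave k alpha' alpha (2 * i + e) = a i + i" "\<And>i. k \<le> i \<Longrightarrow> a i = 0" for L e b a
    unfolding chains_def
  proof (intro CollectI conjI allI impI)
    show "row e L 0 = b" using that(3,4) shufflesD(1)[OF L] by (auto simp: row_def fun_eq_iff)
    show "row e L t = a" if "m \<le> t" for t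
      using \<open>\<And>i. i < k \<Longrightarrow> interleave k alpha' alpha (2 * i + e) = a i + i\<close> \<open>\<And>i. k \<le> i \<Longrightarrow> a i = 0\<close>
        shufflesD(2)[OF L that] by (auto simp: row_def fun_eq_iff)
    show "row e L t i \<le> row e L (Suc t) i" for t i
      using shufflesD(3)[OF L, of t "2 * i + e"] by (simp add: row_def diff_le_mono)
    show "row e L (Suc t) (Suc i) < row e L t i" if "Suc i < k" for t i
      using shufflesD(4)[OF L, of t "2 * i + e"] ge[OF L _ e, of i t] ge[OF L that e, of "Suc t"] that
      by (simp add: row_def)
  qed
  have out: "L t b = 0" if "L \<in> ?S" "2 * k \<le> b" for L t b
    using shuffles_le_final[OF that(1), of t b] that(2) by (simp add: interleave_simps)
  show ?thesis
  proof (rule bij_betw_byWitness[where f' = "\<lambda>L. (row 1 L, row 0 L)"])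
    show "\<forall>pq\<in>chains k m beta alpha \<times> chains k m beta' alpha'.
        (row 1 (case pq of (p, q) \<Rightarrow> \<lambda>t. interleave k (q t) (p t)), row 0 (case pq of (p, q) \<Rightarrow> \<lambda>t. interleave k (q t) (p t))) = pq"
    proof clarify
      fix p q assume pq: "p \<in> chains k m beta alpha" "q \<in> chains k m beta' alpha'"
      have "row 1 (\<lambda>t. interleave k (q t) (p t)) t i = p t i" "row 0 (\<lambda>t. interleave k (q t) (p t)) t i = q t i" for t i
        using chain_zero[OF pq(1) alpha, of i t] chain_zero[OF pq(2) alpha', of i t]
        by (auto simp: row_def interleave_simps)
      then show "row 1 (\<lambda>t. interleave k (q t) (p t)) = p \<and> row 0 (\<lambda>t. interleave k (q t) (p t)) = q"
        by (simp add: fun_eq_iff)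
    qed
    show "\<forall>L\<in>?S. (case (row 1 L, row 0 L) of (p, q) \<Rightarrow> \<lambda>t. interleave k (q t) (p t)) = L"
    proof
      fix L assume L: "L \<in> ?S"
      have "interleave k (row 0 L t) (row 1 L t) b = L t b" for t b
      proof (cases "b < 2 * k")
        case True
        then show ?thesis
          using ge[OF L, of "b div 2" 0 t] ge[OF L, of "b div 2" 1 t]
          by (cases "even b") (auto simp: interleave_def row_def elim!: evenE oddE)
      next
        case False
        then show ?thesis using out[OF L, of b t] by (simp add: interleave_def)
      qed
      then show "(case (row 1 L, row 0 L) of (p, q) \<Rightarrow> \<lambda>t. interleave k (q t) (p t)) = L"
        by (simp add: fun_eq_iff)
    qed
    show "(\<lambda>(p, q) t. interleave k (q t) (p t)) ` (chains k m beta alpha \<times> chains k m beta' alpha') \<subseteq> ?S"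
      using interleave_in_shuffles by fastforce
    show "(\<lambda>L. (row 1 L, row 0 L)) ` ?S \<subseteq> chains k m beta alpha \<times> chains k m beta' alpha'"
      using alpha alpha' beta beta'
      by (auto intro!: row_chain simp: interleave_simps)
  qed
qed

lemma count_chain_content:
  assumes "p \<in> chains k m beta alpha"
  shows "count (chain_content k m p) t = (\<Sum>i<k. p (Suc t) i - p t i)"
proof -
  have "count (chain_content k m p) t = (\<Sum>s<m. if s = t then (\<Sum>i<k. p (Suc s) i - p s i) else 0)"
    unfolding chain_content_def count_sum by (rule sum.cong) auto
  also have "\<dots> = (\<Sum>i<k. p (Suc t) i - p t i)"
    using assms by (auto simp: chains_def)
  finally show ?thesis .
qed

lemma coeff_jt_minor_mult:
  assumes alpha: "\<And>i. k \<le> i \<Longrightarrow> alpha i = 0" "\<And>i. Suc i < k \<Longrightarrow> alpha (Suc i) \<le> alpha i"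
    and alpha': "\<And>i. k \<le> i \<Longrightarrow> alpha' i = 0" "\<And>i. Suc i < k \<Longrightarrow> alpha' (Suc i) \<le> alpha' i"
    and beta: "\<And>i. k \<le> i \<Longrightarrow> beta i = 0" "\<And>i. Suc i < k \<Longrightarrow> beta (Suc i) \<le> beta i"
    and beta': "\<And>i. k \<le> i \<Longrightarrow> beta' i = 0" "\<And>i. Suc i < k \<Longrightarrow> beta' (Suc i) \<le> beta' i"
  shows "coeff_ms (jt_minor k (Suc m) beta alpha * jt_minor k (Suc m) beta' alpha') M
    = int (card {L\<in>shuffles (Suc m) (interleave k beta' beta) (interleave k alpha' alpha). weight (2 * k) L = count M})"
proof -
  let ?C = "chains k (Suc m) beta alpha" and ?C' = "chains k (Suc m) beta' alpha'"
  let ?S = "shuffles (Suc m) (interleave k beta' beta) (interleave k alpha' alpha)"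
  let ?f = "\<lambda>(p, q) t. interleave k (q t) (p t)"
  have prod: "jt_minor k (Suc m) beta alpha * jt_minor k (Suc m) beta' alpha'
      = (\<Sum>(p, q)\<in>?C \<times> ?C'. monom_ms (chain_content k (Suc m) p + chain_content k (Suc m) q))"
  proof -
    have "jt_minor k (Suc m) beta alpha = (\<Sum>p\<in>?C. monom_ms (chain_content k (Suc m) p))"
      by (rule jt_minor_eq_sum_chains) (simp_all add: alpha beta)
    moreover have "jt_minor k (Suc m) beta' alpha' = (\<Sum>p\<in>?C'. monom_ms (chain_content k (Suc m) p))"
      by (rule jt_minor_eq_sum_chains) (simp_all add: alpha' beta')
    ultimately show ?thesis
      by (simp add: sum_product sum.cartesian_product monom_mult)
  qed
  have "coeff_ms (jt_minor k (Suc m) beta alpha * jt_minor k (Suc m) beta' alpha') M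
      = (\<Sum>pq\<in>?C \<times> ?C'. if weight (2 * k) (?f pq) = count M then 1 else 0)"
    unfolding prod coeff_ms_sum
  proof (intro sum.cong refl)
    fix pq assume "pq \<in> ?C \<times> ?C'"
    then obtain p q where pq: "pq = (p, q)" "p \<in> ?C" "q \<in> ?C'" by auto
    have "weight (2 * k) (\<lambda>t. interleave k (q t) (p t)) = count (chain_content k (Suc m) p + chain_content k (Suc m) q)"
      by (simp add: fun_eq_iff weight_interleave count_chain_content[OF pq(2)] count_chain_content[OF pq(3)])
    then show "coeff_ms (case pq of (p, q) \<Rightarrow> monom_ms (chain_content k (Suc m) p + chain_content k (Suc m) q)) M
        = (if weight (2 * k) (?f pq) = count M then 1 else (0::int))"
      by (auto simp: pq(1) monom_ms.rep_eq count_inject)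
  qed
  also have "\<dots> = (\<Sum>L\<in>?S. if weight (2 * k) L = count M then 1 else 0)"
    by (rule sum.reindex_bij_betw[OF bij_betw_interleave]) (use alpha alpha' beta beta' in auto)
  also have "\<dots> = int (card {L\<in>?S. weight (2 * k) L = count M})"
  proof -
    have "finite ?S" by (rule finite_shuffles[of "2 * k"]) (simp add: interleave_simps)
    then show ?thesis by (simp add: sum.If_cases Int_def)
  qed
  finally show ?thesis .
qed

section \<open>Semistandard tableaux as shuffles\<close>

lemma initial_segment_eq:
  fixes A :: "nat set"
  assumes "finite A" and "\<And>i j. j \<in> A \<Longrightarrow> i < j \<Longrightarrow> i \<in> A"
  shows "A = {..<card A}"
  using assms
proof (induction "card A" arbitrary: A)
  case 0
  then show ?case by simp
next
  case (Suc n)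
  then have "A \<noteq> {}" by auto
  let ?x = "Max A"
  have x: "?x \<in> A" using \<open>A \<noteq> {}\<close> Suc.prems(1) by simp
  have "A = {..?x}"
  proof
    show "A \<subseteq> {..?x}" using Suc.prems(1) by auto
    show "{..?x} \<subseteq> A" using x Suc.prems(2) by (auto simp: le_less)
  qed
  then show ?case by (metis card_atMost lessThan_Suc_atMost)
qed

definition ssyt_shuffle :: "nat list \<Rightarrow> (nat \<times> nat \<Rightarrow> nat) \<Rightarrow> nat \<Rightarrow> nat \<Rightarrow> nat" where
  "ssyt_shuffle la T t b = (if even b then card {c. c < part la (b div 2) \<and> T (b div 2, c) < t} else 0)"

definition shuffle_ssyt :: "nat list \<Rightarrow> (nat \<Rightarrow> nat \<Rightarrow> nat) \<Rightarrow> nat \<times> nat \<Rightarrow> nat" where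
  "shuffle_ssyt la L = restrict (\<lambda>(a, c). LEAST t. c < L (Suc t) (2 * a)) (cells la)"

lemma cells_iff: "(a, c) \<in> cells la \<longleftrightarrow> c < part la a"
  by (auto simp: cells_def part_def)

lemma finite_cells: "finite (cells la)"
proof -
  have "cells la = (SIGMA a:{..<length la}. {..<part la a})"
    by (auto simp: cells_def part_def)
  then show ?thesis by simp
qed

lemma ssyt_shuffle_iff:
  assumes T: "T \<in> ssyt la" and c: "c < part la a"
  shows "c < ssyt_shuffle la T t (2 * a) \<longleftrightarrow> T (a, c) < t"
proof -
  let ?A = "{c. c < part la a \<and> T (a, c) < t}"
  have "?A = {..<card ?A}"
  proof (rule initial_segment_eq)
    show "finite ?A" by simp
    fix i j assume "j \<in> ?A" "i < j"
    moreover from this have "T (a, i) \<le> T (a, j)" using T by (auto simp: ssyt_def cells_iff)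
    ultimately show "i \<in> ?A" by simp
  qed
  then have "c \<in> ?A \<longleftrightarrow> c < card ?A" by auto
  then show ?thesis using c by (simp add: ssyt_shuffle_def)
qed

lemma ssyt_shuffle_in_shuffles:
  assumes la: "is_partition la" and T: "T \<in> ssyt la" and bound: "\<And>x. x \<in> cells la \<Longrightarrow> T x < m"
  shows "ssyt_shuffle la T \<in> shuffles m (\<lambda>_. 0) (straight la)"
proof -
  have "ssyt_shuffle la T t = straight la" if "m \<le> t" for t
  proof
    fix b
    have "{c. c < part la (b div 2) \<and> T (b div 2, c) < t} = {..<part la (b div 2)}"
      using that by (auto simp: cells_iff intro: less_le_trans[OF bound])
    then show "ssyt_shuffle la T t b = straight la b" by (simp add: ssyt_shuffle_def straight_def)
  qed
  moreover have "ssyt_shuffle la T t b \<le> ssyt_shuffle la T (Suc t) b" for t b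
    by (auto simp: ssyt_shuffle_def intro!: card_mono)
  moreover have "ssyt_shuffle la T (Suc t) (Suc (Suc b)) \<le> ssyt_shuffle la T t b" for t b
  proof -
    have "{c. c < part la (Suc a) \<and> T (Suc a, c) < Suc t} \<subseteq> {c. c < part la a \<and> T (a, c) < t}" for a
    proof
      fix c assume c: "c \<in> {c. c < part la (Suc a) \<and> T (Suc a, c) < Suc t}"
      then have "T (a, c) < T (Suc a, c)" using T by (auto simp: ssyt_def cells_iff)
      then show "c \<in> {c. c < part la a \<and> T (a, c) < t}"
        using c part_antimono[OF la, of a "Suc a"] by auto
    qed
    then show ?thesis by (auto simp: ssyt_shuffle_def intro!: card_mono)
  qed
  moreover have "ssyt_shuffle la T 0 = (\<lambda>_. 0)" by (simp add: ssyt_shuffle_def fun_eq_iff)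
  ultimately show ?thesis by (simp add: shuffles_def)
qed

lemma shuffle_ssyt_less_iff:
  assumes L: "L \<in> shuffles m (\<lambda>_. 0) (straight la)" and c: "c < part la a"
  shows "shuffle_ssyt la L (a, c) < t \<longleftrightarrow> c < L t (2 * a)"
proof -
  define s where "s = (LEAST t. c < L (Suc t) (2 * a))"
  have "c < L (Suc m) (2 * a)" using shufflesD(2)[OF L, of "Suc m"] c by (simp add: straight_def)
  then have s: "c < L (Suc s) (2 * a)" unfolding s_def by (rule LeastI)
  have "s < t" if "c < L t (2 * a)"
  proof (cases t)
    case 0
    then show ?thesis using that shufflesD(1)[OF L] by simp
  next
    case (Suc t')
    then show ?thesis using that unfolding s_def by (auto intro: le_imp_less_Suc Least_le)
  qed
  moreover have "c < L t (2 * a)" if "s < t"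
    using s shuffles_mono[OF L, of "Suc s" t "2 * a"] that by simp
  moreover have "shuffle_ssyt la L (a, c) = s"
    using c by (simp add: shuffle_ssyt_def cells_iff s_def)
  ultimately show ?thesis by blast
qed

lemma shuffle_ssyt_in_ssyt:
  assumes la: "is_partition la" and L: "L \<in> shuffles m (\<lambda>_. 0) (straight la)"
  shows "shuffle_ssyt la L \<in> ssyt la"
proof -
  let ?T = "shuffle_ssyt la L"
  note iff = shuffle_ssyt_less_iff[OF L]
  have "?T (i, j) \<le> ?T (i, j')" if "j < j'" "(i, j') \<in> cells la" for i j j'
  proof -
    have j: "j < part la i" "j' < part la i" using that by (auto simp: cells_iff)
    have "j' < L (Suc (?T (i, j'))) (2 * i)" using iff[OF j(2), of "Suc (?T (i, j'))"] by simp
    then have "?T (i, j) < Suc (?T (i, j'))" using iff[OF j(1)] that(1) by simp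
    then show ?thesis by simp
  qed
  moreover have "?T (i, j) < ?T (i', j)" if "i < i'" "(i', j) \<in> cells la" for i i' j
  proof -
    have j: "j < part la i'" using that by (simp add: cells_iff)
    then have j': "j < part la i" using part_antimono[OF la, of i i'] that(1) by simp
    have "j < L (Suc (?T (i', j))) (2 * i')" using iff[OF j, of "Suc (?T (i', j))"] by simp
    also have "\<dots> \<le> L (?T (i', j)) (2 * i)"
      using that(1) by (intro shuffles_row_antimono_Suc[OF L]) auto
    finally show ?thesis using iff[OF j'] by simp
  qed
  moreover have "?T \<in> extensional (cells la)" by (simp add: shuffle_ssyt_def)
  ultimately show ?thesis by (simp add: ssyt_def)
qed

lemma count_tableau_monomial: "count (tableau_monomial la T) t = card {x\<in>cells la. T x = t}"
proof -
  have "count (tableau_monomial la T) t = (\<Sum>x | x \<in> cells la \<and> t = T x. count (mset_set (cells la)) x)"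
    by (simp add: tableau_monomial_def count_image_mset' finite_cells)
  also have "\<dots> = (\<Sum>x | x \<in> cells la \<and> t = T x. 1)"
    by (rule sum.cong) (simp_all add: finite_cells)
  finally show ?thesis by (simp add: eq_commute)
qed

lemma weight_ssyt_shuffle:
  assumes T: "T \<in> ssyt la"
  shows "weight (2 * length la) (ssyt_shuffle la T) = count (tableau_monomial la T)"
proof
  fix t
  have row: "ssyt_shuffle la T (Suc t) (2 * a) - ssyt_shuffle la T t (2 * a) = card {c. c < part la a \<and> T (a, c) = t}" for a
  proof -
    have "{c. c < part la a \<and> T (a, c) < Suc t} = {c. c < part la a \<and> T (a, c) < t} \<union> {c. c < part la a \<and> T (a, c) = t}"
      by auto
    then have "card {c. c < part la a \<and> T (a, c) < Suc t} = card {c. c < part la a \<and> T (a, c) < t} + card {c. c < part la a \<and> T (a, c) = t}"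
      by (simp add: card_Un_disjoint disjoint_iff)
    then show ?thesis by (simp add: ssyt_shuffle_def)
  qed
  have odd: "ssyt_shuffle la T t' (Suc (2 * a)) = 0" for t' a by (simp add: ssyt_shuffle_def)
  have "weight (2 * length la) (ssyt_shuffle la T) t = (\<Sum>a<length la. card {c. c < part la a \<and> T (a, c) = t})"
    unfolding weight_def sum_pairs by (simp add: row odd)
  also have "\<dots> = card (SIGMA a:{..<length la}. {c. c < part la a \<and> T (a, c) = t})"
    by (rule card_SigmaI[symmetric]) auto
  also have "(SIGMA a:{..<length la}. {c. c < part la a \<and> T (a, c) = t}) = {x\<in>cells la. T x = t}"
    by (auto simp: cells_def part_def)
  finally show "weight (2 * length la) (ssyt_shuffle la T) t = count (tableau_monomial la T) t"
    by (simp add: count_tableau_monomial)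
qed

lemma coeff_schur:
  assumes la: "is_partition la" and M: "set_mset M \<subseteq> {..<m}"
  shows "coeff_ms (schur la) M
    = int (card {L\<in>shuffles m (\<lambda>_. 0) (straight la). weight (2 * length la) L = count M})"
proof -
  let ?S = "shuffles m (\<lambda>_. 0) (straight la)"
  let ?A = "{T\<in>ssyt la. tableau_monomial la T = M}" and ?B = "{L\<in>?S. weight (2 * length la) L = count M}"
  have bound: "T x < m" if "T \<in> ?A" "x \<in> cells la" for T x
  proof -
    have "T x \<in># tableau_monomial la T" using that(2) finite_cells by (simp add: tableau_monomial_def)
    then show ?thesis using that(1) M by auto
  qed
  have TL: "shuffle_ssyt la (ssyt_shuffle la T) = T" if "T \<in> ssyt la" for T
  proof
    fix x :: "nat \<times> nat"
    obtain a c where x: "x = (a, c)" by (cases x)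
    show "shuffle_ssyt la (ssyt_shuffle la T) x = T x"
    proof (cases "x \<in> cells la")
      case True
      then have c: "c < part la a" by (simp add: x cells_iff)
      have "(LEAST t. T (a, c) < Suc t) = T (a, c)" by (rule Least_equality) auto
      then show ?thesis
        using True ssyt_shuffle_iff[OF that c] by (simp add: x shuffle_ssyt_def)
    next
      case False
      then show ?thesis
        using that extensional_arb[of T "cells la" x] by (simp add: ssyt_def shuffle_ssyt_def)
    qed
  qed
  have LT: "ssyt_shuffle la (shuffle_ssyt la L) = L" if L: "L \<in> ?S" for L
  proof (intro ext)
    fix t b
    have le: "L t b \<le> straight la b" by (rule shuffles_le_final[OF L])
    show "ssyt_shuffle la (shuffle_ssyt la L) t b = L t b"
    proof (cases "even b")
      case True
      then have b: "2 * (b div 2) = b" by simp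
      have "{c. c < part la (b div 2) \<and> shuffle_ssyt la L (b div 2, c) < t} = {..<L t b}"
        using shuffle_ssyt_less_iff[OF L, of _ "b div 2" t] le True by (auto simp: b straight_def)
      then show ?thesis using True by (simp add: ssyt_shuffle_def)
    next
      case False
      then show ?thesis using le by (simp add: ssyt_shuffle_def straight_def)
    qed
  qed
  have "bij_betw (ssyt_shuffle la) ?A ?B"
  proof (rule bij_betw_byWitness[where f' = "shuffle_ssyt la"])
    show "\<forall>T\<in>?A. shuffle_ssyt la (ssyt_shuffle la T) = T" using TL by blast
    show "\<forall>L\<in>?B. ssyt_shuffle la (shuffle_ssyt la L) = L" using LT by blast
    show "ssyt_shuffle la ` ?A \<subseteq> ?B"
    proof (rule image_subsetI)
      fix T assume T: "T \<in> ?A"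
      then have "ssyt_shuffle la T \<in> ?S" by (intro ssyt_shuffle_in_shuffles la bound[OF T]) simp
      with T show "ssyt_shuffle la T \<in> ?B" by (simp add: weight_ssyt_shuffle)
    qed
    show "shuffle_ssyt la ` ?B \<subseteq> ?A"
    proof (rule image_subsetI)
      fix L assume L: "L \<in> ?B"
      then have T: "shuffle_ssyt la L \<in> ssyt la" using shuffle_ssyt_in_ssyt[OF la] by blast
      have "count (tableau_monomial la (shuffle_ssyt la L)) = count M"
        using weight_ssyt_shuffle[OF T] LT[of L] L by simp
      with T show "shuffle_ssyt la L \<in> ?A" by (simp add: count_inject)
    qed
  qed
  then have "card ?A = card ?B" by (rule bij_betw_same_card)
  then show ?thesis by (simp add: schur.rep_eq)
qed

section \<open>The theorem\<close>

lemma pick_image: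
  assumes "\<And>i j. i < j \<Longrightarrow> j < k \<Longrightarrow> (g i :: nat) < g j" "i < k"
  shows "pick (g ` {..<k}) i = g i"
proof -
  have inj: "inj_on g {..<k}"
    using assms(1) by (intro linorder_inj_onI) (auto simp: less_imp_neq)
  have "a < i" if "g a < g i" "a < k" for a
    using assms(1)[of i a] that by (cases a i rule: linorder_cases) auto
  then have "{x \<in> g ` {..<k}. x < g i} = g ` {..<i}"
    using assms by (force simp: image_iff)
  then have "card {x \<in> g ` {..<k}. x < g i} = i"
    using card_image[of g "{..<i}"] inj_on_subset[OF inj, of "{..<i}"] assms(2) by simp
  then show ?thesis using pick_card_in_set[of "g i" "g ` {..<k}"] assms(2) by simp
qed

lemma sorted_list_of_set_pick:
  assumes "finite I" "card I = k"
  shows "sorted_list_of_set I = map (pick I) [0..<k]"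
proof -
  have mono: "pick I i < pick I j" if "i < j" "j < k" for i j
    using pick_mono[of j I i] that assms by simp
  have inj: "inj_on (pick I) {..<k}"
    using mono by (intro linorder_inj_onI) (auto simp: less_imp_neq)
  have "pick I ` {..<k} = I"
    using assms pick_in_set[of _ I] card_image[OF inj] by (intro card_subset_eq) auto
  moreover have "sorted_wrt (<) (map (pick I) [0..<k])"
    using mono by (simp add: sorted_wrt_iff_nth_less)
  ultimately show ?thesis
    using sorted_list_of_set.idem_if_sorted_distinct[of "map (pick I) [0..<k]"]
    by (simp add: strict_sorted_iff atLeast0LessThan)
qed

lemma minor_eq_det:
  assumes "I \<subseteq> {0..<n}" "card I = k" "J \<subseteq> {0..<n}" "card J = k"
  shows "minor I J (mat n n f) = det (mat k k (\<lambda>(i, j). f (pick I i, pick J j)))"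
proof -
  have fin: "finite I" "finite J" using assms by (auto intro: finite_subset)
  have "{i. i < n \<and> i \<in> I} = I" "{j. j < n \<and> j \<in> J} = J" using assms by auto
  then have "submatrix (mat n n f) I J = mat k k (\<lambda>(i, j). mat n n f $$ (pick I i, pick J j))"
    using assms by (simp add: submatrix_def)
  also have "\<dots> = mat k k (\<lambda>(i, j). f (pick I i, pick J j))"
  proof (rule eq_matI)
    fix i j assume ij: "i < dim_row (mat k k (\<lambda>(i, j). f (pick I i, pick J j)))"
      "j < dim_col (mat k k (\<lambda>(i, j). f (pick I i, pick J j)))"
    then have "pick I i \<in> I" "pick J j \<in> J" using pick_in_set assms by auto
    then have "pick I i < n" "pick J j < n" using assms by auto
    with ij show "mat k k (\<lambda>(i, j). mat n n f $$ (pick I i, pick J j)) $$ (i, j)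
        = mat k k (\<lambda>(i, j). f (pick I i, pick J j)) $$ (i, j)"
      by simp
  qed auto
  finally show ?thesis by (simp add: minor_def)
qed

lemma trunc_det:
  "trunc_ms m (det (mat k k (\<lambda>(i, j). complete_h (int (a i) - int (b j))))) = jt_minor k m b a"
proof -
  interpret comm_ring_hom "trunc_ms m" by (rule comm_ring_hom_trunc)
  have "map_mat (trunc_ms m) (mat k k (\<lambda>(i, j). complete_h (int (a i) - int (b j))))
      = mat k k (\<lambda>(i, j). trunc_h m (int (a i) - int (b j)))"
    by (rule eq_matI) (auto simp: trunc_h_def)
  then show ?thesis unfolding jt_minor_def by (metis hom_det)
qed

lemma coeff_trunc_mult:
  assumes "set_mset M \<subseteq> {..<m}"
  shows "coeff_ms (f * g) M = coeff_ms (trunc_ms m f * trunc_ms m g) M"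
proof -
  interpret comm_ring_hom "trunc_ms m" by (rule comm_ring_hom_trunc)
  show ?thesis using assms by (simp add: hom_mult[symmetric] trunc_ms.rep_eq)
qed

lemma coeff_of_nat_mult: "coeff_ms (of_nat c * f) M = of_nat c * coeff_ms (f :: int mseries) M"
  by (induction c) (simp_all add: coeff_ms_zero coeff_ms_add distrib_right)

lemma sum_sort_pairs: "(\<Sum>b<2 * k. sort_pairs f b) = (\<Sum>b<2 * k. f b)"
  unfolding sum_pairs by (rule sum.cong) (auto simp: sort_pairs_def max_def min_def)

lemma sort_pairs_interleave:
  "sort_pairs (interleave k f g) = interleave k (\<lambda>i. max (f i) (g i)) (\<lambda>i. min (f i) (g i))"
proof
  fix b
  show "sort_pairs (interleave k f g) b = interleave k (\<lambda>i. max (f i) (g i)) (\<lambda>i. min (f i) (g i)) b"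
  proof (cases "even b")
    case True
    then obtain a where b: "b = 2 * a" by (elim evenE)
    show ?thesis by (cases "a < k") (simp_all add: b sort_pairs_def interleave_simps)
  next
    case False
    then obtain a where b: "b = Suc (2 * a)" by (elim oddE) simp
    show ?thesis by (cases "a < k") (simp_all add: b sort_pairs_def interleave_simps min.commute)
  qed
qed

text \<open>The counts are tied to a number of variables, but the multiplicities are taken at
  \<open>d\<close>, where they are already stable. So one family \<open>c\<close> serves all
  monomials.\<close>

lemma schur_nonneg_sort_pairs:
  assumes z: "\<forall>b\<ge>2 * k. la b = 0"
    and F: "\<And>m M. set_mset M \<subseteq> {..<Suc m} \<Longrightarrow>
      coeff_ms F M = int (card {L\<in>shuffles (Suc m) mu la. weight (2 * k) L = count M})"
    and F': "\<And>m M. set_mset M \<subseteq> {..<Suc m} \<Longrightarrow>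
      coeff_ms F' M = int (card {L\<in>shuffles (Suc m) (sort_pairs mu) (sort_pairs la). weight (2 * k) L = count M})"
  shows "schur_nonneg (F' - F)"
proof -
  define d where "d = (\<Sum>b<2 * k. la b) - (\<Sum>b<2 * k. mu b)"
  define N where "N mu la ka = card {L\<in>shuffles d mu la. lattice (2 * k) L \<and> weight (2 * k) L = part ka}" for mu la ka
  define c where "c ka = N (sort_pairs mu) (sort_pairs la) ka - N mu la ka" for ka
  let ?P = "{ka. is_partition ka \<and> sum_list ka = d}"
  have z': "\<forall>b\<ge>2 * k. sort_pairs la b = 0" using z by (auto simp: sort_pairs_def)
  have d': "d = (\<Sum>b<2 * k. sort_pairs la b) - (\<Sum>b<2 * k. sort_pairs mu b)"
    by (simp add: d_def sum_sort_pairs)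
  have N_le: "N mu la ka \<le> N (sort_pairs mu) (sort_pairs la) ka" for ka
    unfolding N_def by (rule card_lattice_le_sort_pairs[OF z])
  have expansion: "int (card {L\<in>shuffles (Suc m) mu' la'. weight (2 * k) L = count M})
      = (\<Sum>ka\<in>?P. int (N mu' la' ka) * coeff_ms (schur ka) M)"
    if "d \<le> m" and M: "set_mset M \<subseteq> {..<Suc m}" and z: "\<forall>b\<ge>2 * k. la' b = 0"
      and d: "d = (\<Sum>b<2 * k. la' b) - (\<Sum>b<2 * k. mu' b)" for mu' la' m M
  proof -
    have "int (card {L\<in>shuffles (Suc m) mu' la'. weight (2 * k) L = count M})
      = (\<Sum>ka\<in>?P. int (card {L\<in>shuffles (Suc m) mu' la'. lattice (2 * k) L \<and> weight (2 * k) L = part ka}) *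
        int (card {L\<in>shuffles (Suc m) (\<lambda>_. 0) (straight ka). weight (2 * length ka) L = count M}))"
      by (rule shuffles_schur_expansion[OF z d]) (use \<open>d \<le> m\<close> in simp)
    also have "\<dots> = (\<Sum>ka\<in>?P. int (N mu' la' ka) * coeff_ms (schur ka) M)"
    proof (rule sum.cong[OF refl])
      fix ka assume "ka \<in> ?P"
      then have "is_partition ka" "length ka \<le> d" using length_partition_le by auto
      then show "int (card {L\<in>shuffles (Suc m) mu' la'. lattice (2 * k) L \<and> weight (2 * k) L = part ka}) *
          int (card {L\<in>shuffles (Suc m) (\<lambda>_. 0) (straight ka). weight (2 * length ka) L = count M})
        = int (N mu' la' ka) * coeff_ms (schur ka) M"
        using lattice_shuffles_stable[OF z, of ka d "Suc m" mu'] \<open>d \<le> m\<close>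
        by (simp add: N_def coeff_schur[OF _ M])
    qed
    finally show ?thesis .
  qed
  have "F' - F = (\<Sum>ka\<in>?P. of_int (int (c ka)) * schur ka)"
  proof (rule mseries_eqI)
    fix M :: "nat multiset"
    obtain m0 where "\<forall>x\<in>set_mset M. x < m0"
      using finite_nat_set_iff_bounded finite_set_mset by blast
    \<comment> \<open>Enough variables for this monomial and for all partitions of
      \<open>d\<close>.\<close>
    then have M: "set_mset M \<subseteq> {..<Suc (d + m0)}" by force
    have "coeff_ms (F' - F) M
        = (\<Sum>ka\<in>?P. int (N (sort_pairs mu) (sort_pairs la) ka) * coeff_ms (schur ka) M)
          - (\<Sum>ka\<in>?P. int (N mu la ka) * coeff_ms (schur ka) M)"
      unfolding coeff_ms_diff F[OF M] F'[OF M]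
      by (simp only: expansion[OF le_add1 M z d_def] expansion[OF le_add1 M z' d'])
    also have "\<dots> = (\<Sum>ka\<in>?P. int (c ka) * coeff_ms (schur ka) M)"
      using N_le by (simp add: c_def of_nat_diff sum_subtractf left_diff_distrib)
    also have "\<dots> = coeff_ms (\<Sum>ka\<in>?P. of_int (int (c ka)) * schur ka) M"
      by (simp add: coeff_ms_sum coeff_of_nat_mult)
    finally show "coeff_ms (F' - F) M = coeff_ms (\<Sum>ka\<in>?P. of_int (int (c ka)) * schur ka) M" .
  qed
  then show ?thesis
    unfolding schur_nonneg_def using finite_partitions[of d]
    by (intro exI[of _ ?P] exI[of _ "\<lambda>ka. int (c ka)"]) auto
qed

text \<open>The two properties of \<open>f\<close> are shared by \<open>max\<close> and
  \<open>min\<close>, so join and meet are treated at once.\<close>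

lemma set_map2_pick:
  assumes I: "I \<subseteq> {0..<n}" "card I = k" and I': "I' \<subseteq> {0..<n}" "card I' = k"
    and f: "\<And>x y x' y'. x < x' \<Longrightarrow> y < y' \<Longrightarrow> f x y < f x' y'" "\<And>x y. f x y = x \<or> f x y = (y :: nat)"
  shows "set (map2 f (sorted_list_of_set I) (sorted_list_of_set I')) \<subseteq> {0..<n}"
    "card (set (map2 f (sorted_list_of_set I) (sorted_list_of_set I'))) = k"
    "i < k \<Longrightarrow> pick (set (map2 f (sorted_list_of_set I) (sorted_list_of_set I'))) i = f (pick I i) (pick I' i)"
proof -
  let ?g = "\<lambda>i. f (pick I i) (pick I' i)"
  have fin: "finite I" "finite I'" using I I' by (auto intro: finite_subset)
  have "map2 f (sorted_list_of_set I) (sorted_list_of_set I') = map ?g [0..<k]"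
    by (simp add: sorted_list_of_set_pick[OF fin(1) I(2)] sorted_list_of_set_pick[OF fin(2) I'(2)] zip_map_map map_zip_map2 zip_same_conv_map)
  then have S: "set (map2 f (sorted_list_of_set I) (sorted_list_of_set I')) = ?g ` {..<k}"
    by (simp add: atLeast0LessThan)
  have mono: "?g i < ?g j" if "i < j" "j < k" for i j
    using that I I' by (intro f pick_mono) auto
  show "set (map2 f (sorted_list_of_set I) (sorted_list_of_set I')) \<subseteq> {0..<n}"
    unfolding S
  proof (rule image_subsetI)
    fix i assume "i \<in> {..<k}"
    then have "pick I i \<in> I" "pick I' i \<in> I'" using pick_in_set I I' by auto
    then show "?g i \<in> {0..<n}" using f(2)[of "pick I i" "pick I' i"] I I' by auto
  qed
  have "inj_on ?g {..<k}"
    using mono by (intro linorder_inj_onI) (auto simp: less_imp_neq)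
  then show "card (set (map2 f (sorted_list_of_set I) (sorted_list_of_set I'))) = k"
    unfolding S by (simp add: card_image)
  show "pick (set (map2 f (sorted_list_of_set I) (sorted_list_of_set I'))) i = f (pick I i) (pick I' i)" if "i < k"
    unfolding S by (rule pick_image[OF mono that])
qed

theorem theorem3p1:
  fixes n k :: nat and X :: "int mseries mat" and I J I' J' :: "nat set"
  assumes "gen_jacobi_trudi n X"
    and "I \<subseteq> {0..<n}" "card I = k"
    and "J \<subseteq> {0..<n}" "card J = k"
    and "I' \<subseteq> {0..<n}" "card I' = k"
    and "J' \<subseteq> {0..<n}" "card J' = k"
  shows "schur_nonneg
    (minor (set_join I I') (set_join J J') X * minor (set_meet I I') (set_meet J J') X
     - minor I J X * minor I' J' X)"
proof -
  from assms(1) obtain mu nu :: "nat list" where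
    mu: "length mu = n" "sorted_wrt (\<ge>) mu" and nu: "length nu = n" "sorted_wrt (\<ge>) nu" and
    X: "X = mat n n (\<lambda>(i, j). complete_h (int (mu ! i) - int (nu ! j)))"
    by (auto simp: gen_jacobi_trudi_def)
  \<comment> \<open>The default 0 from \<open>k\<close> on is what the chain lemmas expect; the
    staircase is added only in \<open>interleave\<close>.\<close>
  define pos where "pos xs K i = (if i < k then xs ! pick K i else 0)" for xs :: "nat list" and K i
  let ?sub = "\<lambda>K. K \<subseteq> {0..<n} \<and> card K = k"
  have pos_zero: "k \<le> i \<Longrightarrow> pos xs K i = 0" for xs K i by (simp add: pos_def)
  have nth_antimono: "xs ! j \<le> xs ! i" if "length xs = n" "sorted_wrt (\<ge>) xs" "i \<le> j" "j < n" for xs :: "nat list" and i j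
    using that by (cases "i = j") (auto simp: sorted_wrt_iff_nth_less)
  have pick_less: "pick K i < n" if "?sub K" "i < k" for K i
    using pick_in_set[of i K] that by auto
  have pos_dec: "pos xs K (Suc i) \<le> pos xs K i"
    if "length xs = n" "sorted_wrt (\<ge>) xs" "?sub K" "Suc i < k" for xs K i
  proof -
    have "pick K i < pick K (Suc i)" using that by (intro pick_mono) auto
    then show ?thesis
      using nth_antimono[OF that(1,2), of "pick K i" "pick K (Suc i)"] pick_less[OF that(3,4)] that(4)
      by (simp add: pos_def)
  qed
  have trunc: "trunc_ms m (minor K H X) = jt_minor k m (pos nu H) (pos mu K)" if K: "?sub K" and H: "?sub H" for K H m
  proof -
    have "minor K H X = det (mat k k (\<lambda>(i, j). complete_h (int (mu ! pick K i) - int (nu ! pick H j))))"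
      unfolding X
      using minor_eq_det[of K n k H "\<lambda>(i, j). complete_h (int (mu ! i) - int (nu ! j))"] K H by simp
    also have "\<dots> = det (mat k k (\<lambda>(i, j). complete_h (int (pos mu K i) - int (pos nu H j))))"
      by (intro arg_cong[where f = det] eq_matI) (auto simp: pos_def)
    finally show ?thesis by (simp add: trunc_det)
  qed
  have coeff: "coeff_ms (minor K H X * minor K' H' X) M
      = int (card {L\<in>shuffles (Suc m) (interleave k (pos nu H') (pos nu H)) (interleave k (pos mu K') (pos mu K)).
          weight (2 * k) L = count M})"
    if sub: "?sub K" "?sub H" "?sub K'" "?sub H'" and M: "set_mset M \<subseteq> {..<Suc m}" for K H K' H' m M
  proof -
    have "coeff_ms (minor K H X * minor K' H' X) M
        = coeff_ms (jt_minor k (Suc m) (pos nu H) (pos mu K) * jt_minor k (Suc m) (pos nu H') (pos mu K')) M"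
      unfolding trunc[OF sub(1,2), symmetric] trunc[OF sub(3,4), symmetric] by (rule coeff_trunc_mult[OF M])
    also have "\<dots> = int (card {L\<in>shuffles (Suc m) (interleave k (pos nu H') (pos nu H))
        (interleave k (pos mu K') (pos mu K)). weight (2 * k) L = count M})"
      by (rule coeff_jt_minor_mult) (assumption | rule pos_zero pos_dec mu nu sub)+
    finally show ?thesis .
  qed
  \<comment> \<open>Parts decrease with their index, so the join selects the smaller parts and the
    meet the larger ones. The second factor fills the even rows, where \<open>sort_pairs\<close>
    puts the maxima; hence \<open>B\<close> comes before \<open>A\<close>.\<close>
  have join: "?sub (set_join A B)" "pos xs (set_join A B) = (\<lambda>i. min (pos xs B i) (pos xs A i))"
    and meet: "?sub (set_meet A B)" "pos xs (set_meet A B) = (\<lambda>i. max (pos xs B i) (pos xs A i))"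
    if A: "?sub A" and B: "?sub B" and xs: "length xs = n" "sorted_wrt (\<ge>) xs" for A B and xs :: "nat list"
  proof -
    have A': "A \<subseteq> {0..<n}" "card A = k" and B': "B \<subseteq> {0..<n}" "card B = k" using A B by auto
    have M: "?sub (set_join A B) \<and> (\<forall>i<k. pick (set_join A B) i = max (pick A i) (pick B i))"
      unfolding set_join_def by (intro conjI allI impI set_map2_pick[OF A' B', of max]) (auto simp: max_def)
    have m: "?sub (set_meet A B) \<and> (\<forall>i<k. pick (set_meet A B) i = min (pick A i) (pick B i))"
      unfolding set_meet_def by (intro conjI allI impI set_map2_pick[OF A' B', of min]) (auto simp: min_def)
    show "?sub (set_join A B)" "?sub (set_meet A B)" using M m by blast+
    have nth: "xs ! max (pick A i) (pick B i) = min (xs ! pick B i) (xs ! pick A i)"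
      "xs ! min (pick A i) (pick B i) = max (xs ! pick B i) (xs ! pick A i)" if "i < k" for i
      using nth_antimono[OF xs, of "pick A i" "pick B i"] nth_antimono[OF xs, of "pick B i" "pick A i"]
        pick_less[OF A that] pick_less[OF B that]
      by (auto simp: max_def min_def)
    show "pos xs (set_join A B) = (\<lambda>i. min (pos xs B i) (pos xs A i))"
      using M nth(1) by (simp add: pos_def fun_eq_iff)
    show "pos xs (set_meet A B) = (\<lambda>i. max (pos xs B i) (pos xs A i))"
      using m nth(2) by (simp add: pos_def fun_eq_iff)
  qed
  have sub: "?sub I" "?sub J" "?sub I'" "?sub J'" using assms by auto
  show ?thesis
  proof (rule schur_nonneg_sort_pairs[of k "interleave k (pos mu I') (pos mu I)" _ "interleave k (pos nu J') (pos nu J)"])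
    show "\<forall>b\<ge>2 * k. interleave k (pos mu I') (pos mu I) b = 0" by (simp add: interleave_simps)
    fix m M assume M: "set_mset M \<subseteq> {..<Suc m}"
    show "coeff_ms (minor I J X * minor I' J' X) M
      = int (card {L\<in>shuffles (Suc m) (interleave k (pos nu J') (pos nu J)) (interleave k (pos mu I') (pos mu I)).
          weight (2 * k) L = count M})"
      by (rule coeff[OF sub M])
    show "coeff_ms (minor (set_join I I') (set_join J J') X * minor (set_meet I I') (set_meet J J') X) M
      = int (card {L\<in>shuffles (Suc m) (sort_pairs (interleave k (pos nu J') (pos nu J)))
          (sort_pairs (interleave k (pos mu I') (pos mu I))). weight (2 * k) L = count M})"
      using coeff[OF join(1)[OF sub(1,3) mu] join(1)[OF sub(2,4) mu] meet(1)[OF sub(1,3) mu] meet(1)[OF sub(2,4) mu] M]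
      unfolding join(2)[OF sub(1,3) mu] join(2)[OF sub(2,4) nu] meet(2)[OF sub(1,3) mu] meet(2)[OF sub(2,4) nu]
      by (simp only: sort_pairs_interleave)
  qed
qed

end
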